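(* Let $n\ge 2$, let $\mathscr{X}$ be the variety of complete quadrics in $\mathbb{P}^{n-1}(\mathbb{C})$, and let $I\subset[n-1]$. Let $\mathscr{X}^I\subset\mathscr{X}$ be the $\mathrm{SL}_n$-stable subvariety corresponding to $I$, let $\mathscr{O}^I$ be its dense $\mathrm{SL}_n$-orbit, and let $T\subset \mathrm{SL}_n$ be the maximal torus of diagonal matrices. The following are equivalent: (1) $I$ is special; (2) $\mathscr{X}^I$ is $\mathrm{SL}_2$-regular; (3) $\mathscr{O}^I$ contains a $T$-fixed point.
   Context: All varieties and groups are over $\mathbb{C}$; $\mathrm{SL}_n=\mathrm{SL}_n(\mathbb{C})$, $[m]=\{1,\dots,m\}$. Special subsets: $I\subset[n-1]$ is special if it does not contain any two consecutive numbers; equivalently, $I=\{i_1<i_2<\dots<i_s\}$ is special if $i_{j+1}-i_j\ge 2$ for $j=1,\dots,s-1$. Complete quadrics: Let $X_0$ be the set of classes $[A]$ (up to scaling) of nondegenerate symmetric $n\times n$ matrices, with $\mathrm{SL}_n$ acting by $g\cdot A=(g^{\top})^{-1}Ag^{-1}$. The variety of complete quadrics $\mathscr{X}$ is the Zariski closure of the image of $X_0$ under $[A]\mapsto([A],[\Lambda^2(A)],\dots,[\Lambda^{n-1}(A)])$ in the product, over $i=1,\dots,n-1$, of the projectivized spaces of symmetric matrices of size $\binom{n}{i}$, where $\Lambda^i(A)$ is the $i$-th exterior power (compound matrix) of $A$. The $\mathrm{SL}_n$-action extends to $\mathscr{X}$, and $\mathscr{X}$ is the wonderful embedding of $X_0$: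 it is smooth and projective, and $\mathscr{X}-X_0$ is a union of $n-1$ smooth $\mathrm{SL}_n$-stable irreducible divisors $X_1,\dots,X_{n-1}$ with transverse intersections. Here $X_i$ is the Zariski closure of the set of points of $\mathscr{X}$ whose first component $[A]$ has rank exactly $n-i$ (so $i$ is the dimension of the kernel of $A$). For $I\subset[n-1]$ put $\mathscr{X}^I=\bigcap_{i\in[n-1],\,i\notin I}X_i$ (so $\mathscr{X}^{[n-1]}=\mathscr{X}$). These are smooth and irreducible, and are exactly the irreducible closed $\mathrm{SL}_n$-stable subvarieties of $\mathscr{X}$. The dense $\mathrm{SL}_n$-orbit of $\mathscr{X}^I$ is $\mathscr{O}^I=\mathscr{X}^I-\bigcup_{j\in I}X_j$, and $\mathscr{X}^I=\bigsqcup_{K\subset I}\mathscr{O}^K$. Equivalently, a point of $\mathscr{X}$ is a flag $0=V_0\subset V_1\subset\dots\subset V_s=\mathbb{C}^n$ (strict inclusions) with quadrics $Q_i$ in $\mathbb{P}(V_i)$ whose singular locus is $\mathbb{P}(V_{i-1})$, $i=1,\dots,s$. The orbit $\mathscr{O}^K$ consists of those points with $\{\dim V_i: 1\le i\le s-1\}=[n-1]-K$. $\mathrm{SL}_2$-regularity: Let $U'\subset\mathrm{SL}_2$ be the subgroup of upper triangular unipotent matrices. A smooth projective $\mathrm{SL}_2$-variety is $\mathrm{SL}_2$-regular if $U'$ has exactly one fixed point on it. For an algebraic group $G$, a smooth projective $G$-variety $X$ is $\mathrm{SL}_2$-regular if there exists an injective homomorphism $\phi:\mathrm{SL}_2\hookrightarrow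 G$ such that the induced $\mathrm{SL}_2$-action makes $X$ an $\mathrm{SL}_2$-regular $\mathrm{SL}_2$-variety. Here $G=\mathrm{SL}_n$.
   Formalization: In SL_2-regularity, "injective homomorphism SL_2→SL_n" is read as "homomorphism with finite kernel", since with literal injectivity (2) fails for all I when n is odd (e.g. n=3, I=∅); for even n the literal injective version is also proved equivalent. *)

theory Defs
  imports
    "Jordan_Normal_Form.DL_Rank"
    "Jordan_Normal_Form.DL_Submatrix"
    "HOL-Algebra.Coset"
begin

section \<open>Polynomial functions\<close>

text \<open>The functions that are polynomials in a given set C of coordinate functions.
  The ground field is infinite, so polynomials and polynomial functions need not be distinguished.\<close>

inductive_set poly_funs :: "('v \<Rightarrow> complex) set \<Rightarrow> ('v \<Rightarrow> complex) set"
  for C :: "('v \<Rightarrow> complex) set" where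
  const: "(\<lambda>_. c) \<in> poly_funs C"
| coord: "f \<in> C \<Longrightarrow> f \<in> poly_funs C"
| add: "f \<in> poly_funs C \<Longrightarrow> g \<in> poly_funs C \<Longrightarrow> (\<lambda>v. f v + g v) \<in> poly_funs C"
| mult: "f \<in> poly_funs C \<Longrightarrow> g \<in> poly_funs C \<Longrightarrow> (\<lambda>v. f v * g v) \<in> poly_funs C"


section \<open>The special linear group\<close>

definition SL :: "nat \<Rightarrow> complex mat monoid" where
  "SL n = \<lparr>carrier = {g \<in> carrier_mat n n. det g = 1}, monoid.mult = (*), one = 1\<^sub>m n\<rparr>"

lemma group_SL: "group (SL n)"
proof (rule groupI)
  fix g assume "g \<in> carrier (SL n)"
  then have g: "g \<in> carrier_mat n n" "det g = 1" by (auto simp: SL_def)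
  have "adj_mat g \<in> carrier_mat n n" "adj_mat g * g = 1\<^sub>m n"
    using adj_mat[OF g(1)] g by auto
  moreover have "det (adj_mat g) = 1"
    using det_mult[OF \<open>adj_mat g \<in> carrier_mat n n\<close> g(1)] g calculation by simp
  ultimately show "\<exists>h\<in>carrier (SL n). h \<otimes>\<^bsub>SL n\<^esub> g = \<one>\<^bsub>SL n\<^esub>"
    by (auto simp: SL_def)
qed (auto simp: SL_def det_mult)

definition diagonal_torus :: "nat \<Rightarrow> complex mat set" where
  "diagonal_torus n = {t \<in> carrier (SL n). diagonal_mat t}"

definition unipotent_SL2 :: "complex mat set" where
  "unipotent_SL2 = {mat_of_rows_list 2 [[1, a], [0, 1]] | a. True}"

text \<open>Homomorphisms of algebraic groups.\<close>

definition algebraic_hom :: "nat \<Rightarrow> nat \<Rightarrow> (complex mat \<Rightarrow> complex mat) set" where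
  "algebraic_hom m n = {\<phi> \<in> hom (SL m) (SL n).
     \<forall>i<n. \<forall>j<n. \<exists>f \<in> poly_funs {\<lambda>g. g $$ (k, l) | k l. k < m \<and> l < m}.
       \<forall>g \<in> carrier (SL m). \<phi> g $$ (i, j) = f g}"


section \<open>The ambient product of projective spaces\<close>

text \<open>A matrix of size n choose k is a function on pairs of k-element subsets of {..<n},
  extended by zero to all pairs.\<close>

type_synonym set_mat = "nat set \<times> nat set \<Rightarrow> complex"

definition k_subsets :: "nat \<Rightarrow> nat \<Rightarrow> nat set set" where
  "k_subsets n k = {S. S \<subseteq> {..<n} \<and> card S = k}"

definition sym_mats :: "nat \<Rightarrow> nat \<Rightarrow> set_mat set" where
  "sym_mats n k = {B. (\<forall>S T. (S, T) \<notin> k_subsets n k \<times> k_subsets n k \<longrightarrow> B (S, T) = 0)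
     \<and> (\<forall>S T. B (S, T) = B (T, S))}"

definition compound :: "nat \<Rightarrow> nat \<Rightarrow> complex mat \<Rightarrow> set_mat" where
  "compound n k A = (\<lambda>(S, T).
     if S \<in> k_subsets n k \<and> T \<in> k_subsets n k then det (submatrix A S T) else 0)"

text \<open>A point of a projective space is represented by the set of its nonzero representatives.\<close>

definition proj_class :: "set_mat \<Rightarrow> set_mat set" where
  "proj_class B = {\<lambda>x. c * B x | c. c \<noteq> 0}"

definition proj_space :: "set_mat set \<Rightarrow> set_mat set set" where
  "proj_space V = proj_class ` (V - {\<lambda>_. 0})"

type_synonym point = "nat \<Rightarrow> set_mat set"

definition ambient :: "nat \<Rightarrow> point set" where
  "ambient n = (\<Pi>\<^sub>E k\<in>{1..n-1}. proj_space (sym_mats n k))"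

text \<open>Multihomogeneous polynomials of multidegree d. The scaling condition says exactly that
  every monomial has degree d k in the coordinates of the k-th factor.\<close>

definition multihom_polys :: "nat \<Rightarrow> ((nat \<Rightarrow> set_mat) \<Rightarrow> complex) set" where
  "multihom_polys n =
    {f \<in> poly_funs {\<lambda>v. v k (S, T) | k S T.
           k \<in> {1..n-1} \<and> S \<in> k_subsets n k \<and> T \<in> k_subsets n k}.
     \<exists>d. \<forall>c v. f (\<lambda>k x. c k * v k x) = (\<Prod>k=1..n-1. c k ^ d k) * f v}"

definition vanishes_at :: "nat \<Rightarrow> ((nat \<Rightarrow> set_mat) \<Rightarrow> complex) \<Rightarrow> point \<Rightarrow> bool" where
  "vanishes_at n f p \<longleftrightarrow> (\<forall>v \<in> Pi {1..n-1} p. f v = 0)"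

definition zariski_closed :: "nat \<Rightarrow> point set \<Rightarrow> bool" where
  "zariski_closed n Z \<longleftrightarrow>
     (\<exists>F \<subseteq> multihom_polys n. Z = {p \<in> ambient n. \<forall>f\<in>F. vanishes_at n f p})"

definition zariski_closure :: "nat \<Rightarrow> point set \<Rightarrow> point set" where
  "zariski_closure n S = zariski_closed n hull S"

text \<open>The action extending that on classes of nondegenerate symmetric matrices, in which g sends
  A to the product of the transpose of h, A and h, where h is the inverse of g. By
  the Cauchy--Binet formula it acts on the k-th factor in the same way, through the k-th compound
  matrix of h.\<close>

definition congr :: "nat \<Rightarrow> nat \<Rightarrow> complex mat \<Rightarrow> set_mat \<Rightarrow> set_mat" where
  "congr n k h B = (\<lambda>(S, T). \<Sum>S'\<in>k_subsets n k. \<Sum>T'\<in>k_subsets n k.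
     compound n k h (S', S) * B (S', T') * compound n k h (T', T))"

definition act :: "nat \<Rightarrow> complex mat \<Rightarrow> point \<Rightarrow> point" where
  "act n g p = (\<lambda>k\<in>{1..n-1}. congr n k (inv\<^bsub>SL n\<^esub> g) ` p k)"


section \<open>Complete quadrics\<close>

definition quadric_point :: "nat \<Rightarrow> complex mat \<Rightarrow> point" where
  "quadric_point n A = (\<lambda>k\<in>{1..n-1}. proj_class (compound n k A))"

definition nondegenerate_quadrics :: "nat \<Rightarrow> point set" where
  "nondegenerate_quadrics n =
     quadric_point n ` {A \<in> carrier_mat n n. transpose_mat A = A \<and> det A \<noteq> 0}"

definition complete_quadrics :: "nat \<Rightarrow> point set" where
  "complete_quadrics n = zariski_closure n (nondegenerate_quadrics n)"

text \<open>The rank of the first component is that of any of its representatives, which are indexed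
  by pairs of singletons.\<close>

definition first_rank :: "nat \<Rightarrow> point \<Rightarrow> nat \<Rightarrow> bool" where
  "first_rank n p r \<longleftrightarrow> (\<exists>B \<in> p 1. vec_space.rank n (mat n n (\<lambda>(i, j). B ({i}, {j}))) = r)"

definition boundary_divisor :: "nat \<Rightarrow> nat \<Rightarrow> point set" where
  "boundary_divisor n i = zariski_closure n {p \<in> complete_quadrics n. first_rank n p (n - i)}"

definition stratum_closure :: "nat \<Rightarrow> nat set \<Rightarrow> point set" where
  "stratum_closure n I =
     complete_quadrics n \<inter> (\<Inter>i\<in>{1..n-1} - I. boundary_divisor n i)"

definition stratum :: "nat \<Rightarrow> nat set \<Rightarrow> point set" where
  "stratum n I = stratum_closure n I - (\<Union>j\<in>I. boundary_divisor n j)"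

definition special :: "nat set \<Rightarrow> bool" where
  "special I \<longleftrightarrow> \<not> (\<exists>i. i \<in> I \<and> i + 1 \<in> I)"


section \<open>Regularity\<close>

text \<open>Regularity is a notion for smooth projective varieties with an action. It is applied here to
  the varieties \<^term>\<open>stratum_closure n I\<close>, which are smooth, closed in \<^term>\<open>ambient n\<close> and stable
  under the group (De Concini--Procesi), so these properties are not repeated in the definitions.\<close>

definition one_unipotent_fixed_point ::
    "nat \<Rightarrow> (complex mat \<Rightarrow> complex mat) \<Rightarrow> point set \<Rightarrow> bool" where
  "one_unipotent_fixed_point n \<phi> Z \<longleftrightarrow>
     (\<exists>!p. p \<in> Z \<and> (\<forall>u \<in> unipotent_SL2. act n (\<phi> u) p = p))"

definition SL2_regular_inj :: "nat \<Rightarrow> point set \<Rightarrow> bool" where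
  "SL2_regular_inj n Z \<longleftrightarrow>
     (\<exists>\<phi> \<in> algebraic_hom 2 n. inj_on \<phi> (carrier (SL 2)) \<and> one_unipotent_fixed_point n \<phi> Z)"

text \<open>For odd n every injective homomorphism from SL 2 to SL n is a reducible representation, whose
  unipotent elements fix infinitely many complete flags. Hence no \<^term>\<open>stratum_closure n I\<close>
  satisfies \<^const>\<open>SL2_regular_inj\<close>; the irreducible representation of odd dimension has
  kernel of order two. The notion that is meaningful for all n
  asks for injectivity up to a finite kernel (equivalently, of the differential).\<close>

definition SL2_regular :: "nat \<Rightarrow> point set \<Rightarrow> bool" where
  "SL2_regular n Z \<longleftrightarrow>
     (\<exists>\<phi> \<in> algebraic_hom 2 n. finite (kernel (SL 2) (SL n) \<phi>) \<and> one_unipotent_fixed_point n \<phi> Z)"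

end

theory Submission
  imports Defs "Jordan_Normal_Form.DL_Rank_Submatrix" "Jordan_Normal_Form.Schur_Decomposition"
begin

text \<open>A point of the stratum with set of block boundaries \<open>[n-1] - K\<close> is a translate of a standard
  point, whose quadrics are sums of squares: on the chart where the leading coordinates do not vanish,
  a complete quadric has the form \<open>R\<^sup>T D R\<close> with \<open>R\<close> unitriangular and \<open>D\<close> given by the ratios of
  consecutive diagonal entries, some of which may be zero.

  If \<open>K\<close> is special, all blocks have size at most two. A regular unipotent matrix fixes a single
  flag, and acts on each block as a regular unipotent matrix, which leaves no nondegenerate quadric in
  two variables invariant, so that all blocks at a fixed point have size one. Hence the fixed point
  lies in the closed orbit and is unique; the irreducible representation of \<open>SL\<^sub>2\<close> supplies the
  regular unipotent matrix. If \<open>K\<close> contains \<open>i\<close> and \<open>i + 1\<close>, every unipotent one-parameter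
  subgroup has a second fixed point: if it is not regular, another flag, and if it is regular, a conic
  on a block of size three. Finally, the torus fixes a nondegenerate quadric in two variables, such as
  \<open>xy\<close>, but none in three.\<close>

section \<open>Minors\<close>

text \<open>Complete quadrics are given only as a Zariski closure, and nothing about their orbits is
  presupposed, so every statement about a boundary point has to come from polynomial identities on
  nondegenerate quadrics. Two devices do this. An identity in the affine coordinates of the chart
  becomes, after clearing denominators, a multihomogeneous polynomial and so extends to the closure.
  Conversely, a point is placed in a closed stable set by a one-parameter degeneration, where a
  limit is just a polynomial in one variable that vanishes off zero. Flags are encoded dually: rows
  of a matrix are linear forms, a boundary \<open>m\<close> stands for the span of the first
  \<open>m\<close> rows, and the member of the flag is their common zero set, of dimension
  \<open>n - m\<close>. Hence orbits carry the index set \<open>reflected n I\<close> instead of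
  \<open>I\<close>. The action is written as a right action by congruence, and the whole general
  linear group is allowed, so that scalings and permutations need no correction of the
  determinant.\<close>

lemma finite_k_subsets [simp]: "finite (k_subsets n k)"
  unfolding k_subsets_def by (rule finite_subset[of _ "Pow {..<n}"]) auto

lemma k_subsetsD:
  assumes "S \<in> k_subsets n k"
  shows "S \<subseteq> {..<n}" "card S = k" "finite S"
  using assms finite_subset[of S "{..<n}"] unfolding k_subsets_def by auto

lemma lessThan_k_subsets [simp]: "{..<k} \<in> k_subsets n k \<longleftrightarrow> k \<le> n"
  unfolding k_subsets_def by auto

section \<open>Enumeration of index sets and the Cauchy-Binet formula\<close>

lemma bij_betw_pick:
  assumes "card S = k" "finite S"
  shows "bij_betw (pick S) {0..<k} S"
proof -
  have inj: "inj_on (pick S) {0..<k}"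
    by (rule linorder_inj_onI') (use assms pick_mono_le[of _ S] in force)
  moreover have "pick S ` {0..<k} \<subseteq> S" using assms pick_in_set_le[of _ S] by auto
  ultimately have "pick S ` {0..<k} = S"
    by (intro card_subset_eq) (auto simp: card_image assms)
  with inj show ?thesis by (simp add: bij_betw_def)
qed

lemma pick_lessThan: "i < k \<Longrightarrow> pick {..<k} i = i"
  using pick_card_in_set[of i "{..<k}"]
  by (metis (no_types, lifting) Collect_cong card_Collect_less_nat lessThan_iff less_trans)

text \<open>A bijection from \<open>{0..<k}\<close> onto \<open>S\<close> is a permutation followed
  by the increasing enumeration of \<open>S\<close>. This regroups the terms of an expanded
  determinant by the set of indices they use; restricting to extensional functions makes the
  correspondence one to one.\<close>

lemma bijections_onto_set:
  assumes "card S = k" "finite S"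
  shows "bij_betw (\<lambda>p. restrict (pick S \<circ> p) {0..<k}) {p. p permutes {0..<k}}
    {f \<in> extensional {0..<k}. bij_betw f {0..<k} S}"
proof (rule bij_betwI')
  have b: "bij_betw (pick S) {0..<k} S" by (rule bij_betw_pick[OF assms])
  show "(restrict (pick S \<circ> p) {0..<k} = restrict (pick S \<circ> q) {0..<k}) = (p = q)"
    if p: "p \<in> {p. p permutes {0..<k}}" and q: "q \<in> {p. p permutes {0..<k}}" for p q
  proof
    assume eq: "restrict (pick S \<circ> p) {0..<k} = restrict (pick S \<circ> q) {0..<k}"
    show "p = q"
    proof
      fix i
      show "p i = q i"
      proof (cases "i < k")
        case True
        then have "pick S (p i) = pick S (q i)" using fun_cong[OF eq, of i] by simp
        moreover have "p i \<in> {0..<k}" "q i \<in> {0..<k}" using True p q permutes_in_image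
          by (metis atLeast0LessThan lessThan_iff mem_Collect_eq)+
        ultimately show ?thesis using b unfolding bij_betw_def inj_on_def by blast
      next
        case False
        then show ?thesis using p q by (auto simp: permutes_def)
      qed
    qed
  qed simp
  show "restrict (pick S \<circ> p) {0..<k} \<in> {f \<in> extensional {0..<k}. bij_betw f {0..<k} S}"
    if "p \<in> {p. p permutes {0..<k}}" for p
  proof -
    have "bij_betw (pick S \<circ> p) {0..<k} S"
      using that b by (intro bij_betw_trans[of p _ "{0..<k}"]) (auto simp: permutes_imp_bij)
    then have "bij_betw (restrict (pick S \<circ> p) {0..<k}) {0..<k} S"
      by (rule bij_betw_cong[THEN iffD1, rotated]) simp
    then show ?thesis by simp
  qed
  show "\<exists>p\<in>{p. p permutes {0..<k}}. f = restrict (pick S \<circ> p) {0..<k}"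
    if "f \<in> {f \<in> extensional {0..<k}. bij_betw f {0..<k} S}" for f
  proof -
    from that have f: "f \<in> extensional {0..<k}" "bij_betw f {0..<k} S" by auto
    define p where "p i = (if i \<in> {0..<k} then the_inv_into {0..<k} (pick S) (f i) else i)" for i
    have "bij_betw (the_inv_into {0..<k} (pick S) \<circ> f) {0..<k} {0..<k}"
      using f(2) bij_betw_the_inv_into[OF b] by (rule bij_betw_trans)
    then have "bij_betw p {0..<k} {0..<k}"
      by (rule bij_betw_cong[THEN iffD1, rotated]) (simp add: p_def)
    then have "p permutes {0..<k}" by (rule bij_imp_permutes) (simp add: p_def)
    moreover have "f = restrict (pick S \<circ> p) {0..<k}"
    proof
      fix i
      show "f i = restrict (pick S \<circ> p) {0..<k} i"
      proof (cases "i \<in> {0..<k}")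
        case True
        then have "f i \<in> S" using f(2) by (auto simp: bij_betw_def)
        then show ?thesis using True b
          by (simp add: p_def f_the_inv_into_f_bij_betw)
      qed (use f(1) in \<open>auto simp: extensional_def\<close>)
    qed
    ultimately show ?thesis by blast
  qed
qed

lemma det_rows_not_inj:
  fixes b :: "nat \<Rightarrow> nat \<Rightarrow> 'a :: comm_ring_1"
  assumes "\<not> inj_on f {0..<k}"
  shows "det (mat k k (\<lambda>(i, j). b (f i) j)) = 0"
proof -
  obtain i j where ij: "i < k" "j < k" "i \<noteq> j" "f i = f j"
    using assms by (auto simp: inj_on_def)
  show ?thesis
    by (rule det_identical_rows[of _ k i j]) (use ij in auto)
qed

lemma det_rows_permuted:
  fixes b :: "nat \<Rightarrow> nat \<Rightarrow> 'a :: comm_ring_1"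
  assumes "p permutes {0..<k}"
  shows "det (mat k k (\<lambda>(i, j). b (f (p i)) j)) = signof p * det (mat k k (\<lambda>(i, j). b (f i) j))"
proof -
  have "p i < k" if "i < k" for i using permutes_in_image[OF assms] that by auto
  then have "mat k k (\<lambda>(i, j). b (f (p i)) j)
      = mat k k (\<lambda>(i, j). mat k k (\<lambda>(i, j). b (f i) j) $$ (p i, j))"
    by (intro eq_matI) auto
  then show ?thesis using det_permute_rows[OF _ assms, of "mat k k (\<lambda>(i, j). b (f i) j)"] by simp
qed

text \<open>Multilinearity in the rows: each row of the product is a combination of the rows of
  \<open>b\<close>, and \<open>f\<close> records which row of \<open>b\<close> is chosen in each
  place.\<close>

lemma det_product_expand:
  fixes a b :: "nat \<Rightarrow> nat \<Rightarrow> 'a :: comm_ring_1"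
  assumes "finite L"
  shows "det (mat k k (\<lambda>(i, j). \<Sum>l\<in>L. a i l * b l j)) =
    (\<Sum>f\<in>PiE {0..<k} (\<lambda>_. L). (\<Prod>i=0..<k. a i (f i)) * det (mat k k (\<lambda>(i, j). b (f i) j)))"
    (is "?l = ?r")
proof -
  have "?l = (\<Sum>p | p permutes {0..<k}. signof p * (\<Prod>i=0..<k. \<Sum>l\<in>L. a i l * b l (p i)))"
    using permutes_in_image[of _ "{0..<k}"]
    by (subst det_def'[of _ k]) (auto intro!: sum.cong prod.cong)
  also have "\<dots> = (\<Sum>p | p permutes {0..<k}. \<Sum>f\<in>PiE {0..<k} (\<lambda>_. L).
      signof p * (\<Prod>i=0..<k. a i (f i) * b (f i) (p i)))"
    by (simp add: prod_sum_PiE assms sum_distrib_left)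
  also have "\<dots> = (\<Sum>f\<in>PiE {0..<k} (\<lambda>_. L). \<Sum>p | p permutes {0..<k}.
      signof p * (\<Prod>i=0..<k. a i (f i) * b (f i) (p i)))"
    by (rule sum.swap)
  also have "\<dots> = ?r"
  proof (rule sum.cong[OF refl])
    fix f assume "f \<in> PiE {0..<k} (\<lambda>_. L)"
    have "det (mat k k (\<lambda>(i, j). b (f i) j))
        = (\<Sum>p | p permutes {0..<k}. signof p * (\<Prod>i=0..<k. b (f i) (p i)))"
      using permutes_in_image[of _ "{0..<k}"]
      by (subst det_def'[of _ k]) (auto intro!: sum.cong prod.cong)
    then show "(\<Sum>p | p permutes {0..<k}. signof p * (\<Prod>i=0..<k. a i (f i) * b (f i) (p i)))
        = (\<Prod>i=0..<k. a i (f i)) * det (mat k k (\<lambda>(i, j). b (f i) j))"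
      by (simp add: prod.distrib sum_distrib_left algebra_simps)
  qed
  finally show ?thesis .
qed

text \<open>In the expansion over all choices \<open>f\<close> the non-injective ones produce
  repeated rows and vanish. The injective ones are grouped by their image \<open>U\<close>; within
  one group the signs of the rearrangements assemble the minor of \<open>a\<close> on the columns
  \<open>U\<close>.\<close>

theorem Cauchy_Binet:
  fixes a b :: "nat \<Rightarrow> nat \<Rightarrow> 'a :: comm_ring_1"
  shows "det (mat k k (\<lambda>(i, j). \<Sum>l<n. a i l * b l j)) =
    (\<Sum>U\<in>k_subsets n k. det (mat k k (\<lambda>(i, j). a i (pick U j)))
       * det (mat k k (\<lambda>(i, j). b (pick U i) j)))"
proof -
  let ?D = "\<lambda>f. det (mat k k (\<lambda>(i, j). b (f i) j))"
  let ?h = "\<lambda>f. (\<Prod>i=0..<k. a i (f i)) * ?D f"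
  let ?F = "PiE {0..<k} (\<lambda>_. {..<n})"
  let ?G = "{f \<in> ?F. inj_on f {0..<k}}"
  have fin: "finite ?G" by (rule finite_subset[of _ ?F]) (auto intro!: finite_PiE)
  have "sum ?h ?F = sum ?h ?G"
    by (rule sum.mono_neutral_right) (auto intro!: finite_PiE simp: det_rows_not_inj)
  also have "\<dots> = (\<Sum>U\<in>k_subsets n k. sum ?h {f \<in> ?G. f ` {0..<k} = U})"
    by (rule sum.group[symmetric])
      (use fin in \<open>auto simp: k_subsets_def card_image PiE_def Pi_def\<close>)
  also have "\<dots> = (\<Sum>U\<in>k_subsets n k. det (mat k k (\<lambda>(i, j). a i (pick U j)))
       * det (mat k k (\<lambda>(i, j). b (pick U i) j)))"
  proof (rule sum.cong[OF refl])
    fix U assume U: "U \<in> k_subsets n k"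
    note U' = k_subsetsD[OF U]
    have "{f \<in> ?G. f ` {0..<k} = U} = {f \<in> extensional {0..<k}. bij_betw f {0..<k} U}"
      using U' by (auto simp: bij_betw_def PiE_def Pi_def)
    then have "sum ?h {f \<in> ?G. f ` {0..<k} = U}
        = (\<Sum>p | p permutes {0..<k}. ?h (restrict (pick U \<circ> p) {0..<k}))"
      using sum.reindex_bij_betw[OF bijections_onto_set[OF U'(2,3)], of ?h] by simp
    also have "\<dots> = (\<Sum>p | p permutes {0..<k}.
        signof p * (\<Prod>i=0..<k. a i (pick U (p i))) * ?D (pick U))"
    proof (rule sum.cong[OF refl])
      fix p assume "p \<in> {p. p permutes {0..<k}}"
      moreover have "mat k k (\<lambda>(i, j). b (restrict (pick U \<circ> p) {0..<k} i) j)
          = mat k k (\<lambda>(i, j). b (pick U (p i)) j)"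
        by (intro eq_matI) auto
      ultimately show "?h (restrict (pick U \<circ> p) {0..<k})
          = signof p * (\<Prod>i=0..<k. a i (pick U (p i))) * ?D (pick U)"
        using det_rows_permuted[of p k b "pick U"] by (simp add: algebra_simps)
    qed
    also have "\<dots> = det (mat k k (\<lambda>(i, j). a i (pick U j))) * ?D (pick U)"
      using permutes_in_image[of _ "{0..<k}"]
      by (subst det_def'[of "mat k k (\<lambda>(i, j). a i (pick U j))" k])
        (auto simp: sum_distrib_right intro!: sum.cong prod.cong)
    finally show "sum ?h {f \<in> ?G. f ` {0..<k} = U} =
      det (mat k k (\<lambda>(i, j). a i (pick U j))) * det (mat k k (\<lambda>(i, j). b (pick U i) j))" .
  qed
  finally show ?thesis by (simp add: det_product_expand)
qed

section \<open>Minors as entries of compound matrices\<close>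

lemma compound_eq_det:
  assumes "A \<in> carrier_mat n n" "S \<in> k_subsets n k" "T \<in> k_subsets n k"
  shows "compound n k A (S, T) = det (mat k k (\<lambda>(i, j). A $$ (pick S i, pick T j)))"
proof -
  note S = k_subsetsD[OF assms(2)] and T = k_subsetsD[OF assms(3)]
  have "{i. i < n \<and> i \<in> S} = S" "{i. i < n \<and> i \<in> T} = T" using S T by auto
  then show ?thesis using assms S(2) T(2) by (simp add: compound_def submatrix_def)
qed

lemma compound_outside:
  "S \<notin> k_subsets n k \<or> T \<notin> k_subsets n k \<Longrightarrow> compound n k A (S, T) = 0"
  by (auto simp: compound_def)

lemma pick_k_subsets: "S \<in> k_subsets n k \<Longrightarrow> i < k \<Longrightarrow> pick S i \<in> S \<and> pick S i < n"
  using pick_in_set_le[of i S] k_subsetsD[of S n k] by auto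

lemma compound_mult:
  assumes A: "A \<in> carrier_mat n n" and B: "B \<in> carrier_mat n n"
  shows "compound n k (A * B) (S, T) =
    (\<Sum>U\<in>k_subsets n k. compound n k A (S, U) * compound n k B (U, T))"
proof (cases "S \<in> k_subsets n k \<and> T \<in> k_subsets n k")
  case True
  have "mat k k (\<lambda>(i, j). (A * B) $$ (pick S i, pick T j))
      = mat k k (\<lambda>(i, j). \<Sum>l<n. A $$ (pick S i, l) * B $$ (l, pick T j))"
    using A B True
    by (intro eq_matI) (auto simp: scalar_prod_def pick_k_subsets atLeast0LessThan intro!: sum.cong)
  then show ?thesis
    using True A B
      Cauchy_Binet[where a = "\<lambda>i l. A $$ (pick S i, l)" and b = "\<lambda>l j. B $$ (l, pick T j)"
        and k = k and n = n]
    by (simp add: compound_eq_det)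
qed (auto simp: compound_outside)

lemma compound_transpose:
  assumes A: "A \<in> carrier_mat n n"
  shows "compound n k (transpose_mat A) (S, T) = compound n k A (T, S)"
proof (cases "S \<in> k_subsets n k \<and> T \<in> k_subsets n k")
  case True
  have "transpose_mat (mat k k (\<lambda>(i, j). A $$ (pick T i, pick S j)))
      = mat k k (\<lambda>(i, j). transpose_mat A $$ (pick S i, pick T j))"
    using True A by (intro eq_matI) (auto simp: pick_k_subsets)
  then show ?thesis using True A det_transpose[of "mat k k (\<lambda>(i, j). A $$ (pick T i, pick S j))" k]
    by (simp add: compound_eq_det)
qed (auto simp: compound_outside)

text \<open>Some term of the Leibniz expansion is nonzero, and its permutation matches rows with
  columns along nonzero entries. Sparsity of a matrix is transferred to its compounds in this
  way.\<close>

lemma compound_nonzeroE: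
  assumes "A \<in> carrier_mat n n" "compound n k A (S, T) \<noteq> 0"
  obtains p where "S \<in> k_subsets n k" "T \<in> k_subsets n k" "bij_betw p S T"
    "\<And>i. i \<in> S \<Longrightarrow> A $$ (i, p i) \<noteq> 0"
proof -
  have ST: "S \<in> k_subsets n k" "T \<in> k_subsets n k" using assms compound_outside by blast+
  note S = k_subsetsD[OF ST(1)] and T = k_subsetsD[OF ST(2)]
  have "(\<Sum>p | p permutes {0..<k}. signof p * (\<Prod>i=0..<k. A $$ (pick S i, pick T (p i)))) \<noteq> 0"
    using assms(2) ST assms(1) permutes_in_image[of _ "{0..<k}"]
    by (simp add: compound_eq_det det_def'[of _ k])
  then obtain p where p: "p permutes {0..<k}" "(\<Prod>i=0..<k. A $$ (pick S i, pick T (p i))) \<noteq> 0"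
    by (metis (no_types, lifting) mem_Collect_eq mult_zero_right sum.neutral)
  let ?q = "pick T \<circ> p \<circ> the_inv_into {0..<k} (pick S)"
  have S': "bij_betw (pick S) {0..<k} S" and T': "bij_betw (pick T) {0..<k} T"
    using S T by (auto intro: bij_betw_pick)
  show thesis
  proof (rule that[OF ST])
    show "bij_betw ?q S T"
      by (rule bij_betw_trans[OF bij_betw_the_inv_into[OF S']
            bij_betw_trans[OF permutes_imp_bij[OF p(1)] T']])
    show "A $$ (i, ?q i) \<noteq> 0" if "i \<in> S" for i
    proof -
      have "the_inv_into {0..<k} (pick S) i \<in> {0..<k}"
        using bij_betw_the_inv_into[OF S'] that by (auto simp: bij_betw_def)
      moreover have "\<forall>a\<in>{0..<k}. A $$ (pick S a, pick T (p a)) \<noteq> 0"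
        using p(2) by (simp add: prod_zero_iff)
      ultimately show ?thesis using that f_the_inv_into_f_bij_betw[OF S', of i] by force
    qed
  qed
qed

lemma prod_pick:
  assumes "S \<in> k_subsets n k"
  shows "(\<Prod>i=0..<k. d (pick S i)) = prod d S"
  using prod.reindex_bij_betw[OF bij_betw_pick, of S k d] k_subsetsD[OF assms] by simp

lemma compound_diagonal:
  "compound n k (mat n n (\<lambda>(i, j). if i = j then d i else 0)) (S, T)
    = (if S = T \<and> S \<in> k_subsets n k then prod d S else 0)"
proof (cases "S \<in> k_subsets n k \<and> T \<in> k_subsets n k")
  case True
  let ?D = "mat n n (\<lambda>(i, j). if i = j then d i else 0)"
  show ?thesis
  proof (cases "S = T")
    case [simp]: True
    have "S \<in> k_subsets n k" using \<open>S \<in> _ \<and> T \<in> _\<close> by simp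
    note S = this k_subsetsD[OF this]
    have "inj_on (pick S) {0..<k}" using bij_betw_pick[OF S(3,4)] by (simp add: bij_betw_def)
    then have "mat k k (\<lambda>(i, j). ?D $$ (pick S i, pick S j))
        = mat k k (\<lambda>(i, j). if i = j then d (pick S i) else 0)"
      using S(1) by (intro eq_matI) (auto simp: pick_k_subsets inj_on_def)
    then have "compound n k ?D (S, T) = prod_list (diag_mat (mat k k (\<lambda>(i, j). if i = j then d (pick S i) else 0)))"
      using S(1) by (simp add: compound_eq_det) (subst det_upper_triangular[of _ k]; auto)
    also have "\<dots> = (\<Prod>i=0..<k. d (pick S i))"
      by (simp add: diag_mat_def prod.list_conv_set_nth)
    finally show ?thesis using S(1) prod_pick[OF S(1), of d] by simp
  next
    case False
    have "compound n k ?D (S, T) = 0"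
    proof (rule ccontr)
      assume "compound n k ?D (S, T) \<noteq> 0"
      then obtain p where p: "S \<in> k_subsets n k" "bij_betw p S T" "\<And>i. i \<in> S \<Longrightarrow> ?D $$ (i, p i) \<noteq> 0"
        by (auto elim: compound_nonzeroE[rotated])
      have "p i = i" if "i \<in> S" for i
      proof -
        have "i < n" "p i < n" using that p(1,2) True by (auto dest!: k_subsetsD(1) simp: bij_betw_def)
        then show ?thesis using p(3)[OF that] by (auto split: if_splits)
      qed
      then have "p ` S = S" by auto
      then show False using p(2) False by (simp add: bij_betw_def)
    qed
    then show ?thesis using False by simp
  qed
qed (auto simp: compound_outside)

lemma det_rows_bij:
  fixes b :: "nat \<Rightarrow> nat \<Rightarrow> 'a :: comm_ring_1"
  assumes f: "bij_betw f {0..<k} U"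
  shows "\<exists>p. p permutes {0..<k} \<and>
    det (mat k k (\<lambda>(i, j). b (f i) j)) = signof p * det (mat k k (\<lambda>(i, j). b (pick U i) j))"
proof -
  have U: "card U = k" "finite U" using f bij_betw_same_card bij_betw_finite by fastforce+
  have "restrict f {0..<k} \<in> {f \<in> extensional {0..<k}. bij_betw f {0..<k} U}"
    using f bij_betw_cong[of "{0..<k}" "restrict f {0..<k}" f U] by simp
  then obtain p where p: "p permutes {0..<k}" "restrict f {0..<k} = restrict (pick U \<circ> p) {0..<k}"
    using bij_betw_imp_surj_on[OF bijections_onto_set[OF U]] by blast
  have "f i = pick U (p i)" if "i < k" for i using fun_cong[OF p(2), of i] that by simp
  then have "mat k k (\<lambda>(i, j). b (f i) j) = mat k k (\<lambda>(i, j). b (pick U (p i)) j)"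
    by (intro eq_matI) auto
  then show ?thesis using p(1) det_rows_permuted[OF p(1), of b "pick U"] by auto
qed

text \<open>The columns \<open>c\<close> may be repeated or out of order, as happens in the
  cofactors of a bordered matrix: a repetition kills the determinant, and sorting changes only its
  sign.\<close>

lemma det_columns_eq_0:
  assumes A: "A \<in> carrier_mat n n" and k: "k \<le> n" and c: "c ` {0..<k} \<subseteq> {..<n}"
    and zero: "c ` {0..<k} \<in> k_subsets n k \<Longrightarrow> compound n k A ({..<k}, c ` {0..<k}) = 0"
  shows "det (mat k k (\<lambda>(i, j). A $$ (i, c j))) = 0"
proof -
  let ?b = "\<lambda>i j. A $$ (j, i)"
  have "det (mat k k (\<lambda>(i, j). A $$ (i, c j))) = det (mat k k (\<lambda>(i, j). ?b (c i) j))"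
    by (subst det_transpose[of _ k, symmetric]) (auto intro!: arg_cong[of _ _ det] eq_matI)
  also have "\<dots> = 0"
  proof (cases "inj_on c {0..<k}")
    case True
    let ?U = "c ` {0..<k}"
    have U: "?U \<in> k_subsets n k" using True c by (auto simp: k_subsets_def card_image)
    have "det (mat k k (\<lambda>(i, j). ?b (pick ?U i) j)) = det (mat k k (\<lambda>(i, j). A $$ (i, pick ?U j)))"
      by (subst det_transpose[of _ k, symmetric]) (auto intro!: arg_cong[of _ _ det] eq_matI)
    also have "\<dots> = compound n k A ({..<k}, ?U)"
      using U k A by (subst compound_eq_det)
        (auto intro!: arg_cong[of _ _ det] eq_matI simp: pick_lessThan)
    also have "\<dots> = 0" by (rule zero[OF U])
    finally show ?thesis
      using det_rows_bij[of c k ?U ?b] True by (auto simp: bij_betw_def)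
  qed (rule det_rows_not_inj)
  finally show ?thesis .
qed

text \<open>Repeating row \<open>i\<close> below the first \<open>k\<close> rows gives a vanishing minor of size \<open>k + 1\<close>
  on the columns \<open>C \<union> {j}\<close>, whose expansion along the repeated row has one term.\<close>

lemma rows_supported_on_columns:
  assumes A: "A \<in> carrier_mat n n" and C: "C \<in> k_subsets n k"
    and nz: "compound n k A ({..<k}, C) \<noteq> 0"
    and zero: "\<And>S. S \<in> k_subsets n k \<Longrightarrow> S \<noteq> C \<Longrightarrow> compound n k A ({..<k}, S) = 0"
    and i: "i < k" and j: "j < n" "j \<notin> C"
  shows "A $$ (i, j) = 0"
proof -
  have k: "k \<le> n" using C card_mono[of "{..<n}" C] by (auto simp: k_subsets_def)
  define M where "M = mat (Suc k) (Suc k)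
    (\<lambda>(p, q). A $$ (if p < k then p else i, if q < k then pick C q else j))"
  have M: "M \<in> carrier_mat (Suc k) (Suc k)" by (simp add: M_def)
  have "det M = 0"
    by (rule det_identical_rows[OF M, of i k]) (use i in \<open>auto simp: M_def\<close>)
  moreover have "det M = (\<Sum>q<Suc k. M $$ (k, q) * cofactor M k q)"
    by (rule laplace_expansion_row[OF M]) simp
  moreover have "cofactor M k q = 0" if q: "q < k" for q
  proof -
    let ?c = "\<lambda>q'. if q' < q then pick C q' else if q' < k - 1 then pick C (Suc q') else j"
    have "mat_delete M k q = mat k k (\<lambda>(p, q'). A $$ (p, ?c q'))"
      unfolding mat_delete_def M_def using q by (intro eq_matI) auto
    moreover have "det (mat k k (\<lambda>(p, q'). A $$ (p, ?c q'))) = 0"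
    proof (rule det_columns_eq_0[OF A k])
      show "?c ` {0..<k} \<subseteq> {..<n}"
        using C j q by (auto simp: pick_k_subsets simp del: pick.simps)
      have "j = ?c (k - 1)" using q by simp
      then have "j \<in> ?c ` {0..<k}" using q by (intro image_eqI[of _ _ "k - 1"]) auto
      then show "compound n k A ({..<k}, ?c ` {0..<k}) = 0" if "?c ` {0..<k} \<in> k_subsets n k"
        using zero[OF that] j(2) by blast
    qed
    ultimately show ?thesis by (simp add: cofactor_def)
  qed
  moreover have "cofactor M k k = compound n k A ({..<k}, C)"
  proof -
    have "mat_delete M k k = mat k k (\<lambda>(p, q). A $$ (pick {..<k} p, pick C q))"
      unfolding mat_delete_def M_def by (intro eq_matI) (auto simp: pick_lessThan)
    then show ?thesis using C k A by (simp add: cofactor_def compound_eq_det)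
  qed
  ultimately have "M $$ (k, k) * compound n k A ({..<k}, C) = 0" by simp
  then show ?thesis using nz by (simp add: M_def)
qed

section \<open>Weights on indices and block triangular matrices\<close>

definition weight_part :: "(nat \<Rightarrow> nat) \<Rightarrow> complex mat \<Rightarrow> complex mat" where
  "weight_part w A = mat (dim_row A) (dim_col A) (\<lambda>(i, j). if w i = w j then A $$ (i, j) else 0)"

lemma weight_part_carrier [simp]: "A \<in> carrier_mat n m \<Longrightarrow> weight_part w A \<in> carrier_mat n m"
  by (simp add: weight_part_def)

definition weight_lower :: "(nat \<Rightarrow> nat) \<Rightarrow> complex mat \<Rightarrow> bool" where
  "weight_lower w A \<longleftrightarrow> (\<forall>i < dim_row A. \<forall>j < dim_col A. w i < w j \<longrightarrow> A $$ (i, j) = 0)"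

lemma compound_weight_part_nonzero:
  assumes A: "A \<in> carrier_mat n n" and nz: "compound n k (weight_part w A) (S, T) \<noteq> 0"
  shows "sum w T = sum w S"
proof -
  obtain p where ST: "S \<in> k_subsets n k" "T \<in> k_subsets n k" and p: "bij_betw p S T"
    "\<And>i. i \<in> S \<Longrightarrow> weight_part w A $$ (i, p i) \<noteq> 0"
    using compound_nonzeroE[OF weight_part_carrier[OF A] nz] by metis
  have "sum w T = (\<Sum>i\<in>S. w (p i))" using sum.reindex_bij_betw[OF p(1), of w] by simp
  also have "\<dots> = sum w S"
  proof (rule sum.cong[OF refl])
    fix i assume i: "i \<in> S"
    then have "i < n" "p i < n" using k_subsetsD(1)[OF ST(1)] k_subsetsD(1)[OF ST(2)] p(1)
      by (auto simp: bij_betw_def)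
    then show "w (p i) = w i" using p(2)[OF i] A by (auto simp: weight_part_def split: if_splits)
  qed
  finally show ?thesis .
qed

text \<open>Along a nonzero term of the Leibniz expansion the weight cannot increase from row to
  column. If the columns have at least the total weight of the rows, every step must preserve the
  weight, so only entries of the diagonal blocks contribute.\<close>

lemma compound_weight_part:
  assumes A: "A \<in> carrier_mat n n" and low: "weight_lower w A"
    and ST: "S \<in> k_subsets n k" "T \<in> k_subsets n k" and le: "sum w S \<le> sum w T"
  shows "compound n k A (S, T) = compound n k (weight_part w A) (S, T)"
proof -
  note bS = bij_betw_pick[OF k_subsetsD(2,3)[OF ST(1)]]
    and bT = bij_betw_pick[OF k_subsetsD(2,3)[OF ST(2)]]
  have eq: "(\<Prod>i=0..<k. A $$ (pick S i, pick T (p i)))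
      = (\<Prod>i=0..<k. weight_part w A $$ (pick S i, pick T (p i)))" (is "?l = ?r")
    if p: "p permutes {0..<k}" for p
  proof -
    have pk: "p i < k" if "i < k" for i using permutes_in_image[OF p] that by auto
    have entry: "weight_part w A $$ (pick S i, pick T (p i))
        = (if w (pick S i) = w (pick T (p i)) then A $$ (pick S i, pick T (p i)) else 0)" if "i < k" for i
      using A pick_k_subsets[OF ST(1) that] pick_k_subsets[OF ST(2) pk[OF that]]
      by (simp add: weight_part_def)
    show ?thesis
    proof (cases "\<forall>i<k. A $$ (pick S i, pick T (p i)) \<noteq> 0")
      case True
      have ge: "w (pick T (p i)) \<le> w (pick S i)" if "i < k" for i
      proof (rule ccontr)
        assume "\<not> ?thesis"
        moreover have "pick S i < n" "pick T (p i) < n"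
          using pick_k_subsets[OF ST(1) that] pick_k_subsets[OF ST(2) pk[OF that]] by auto
        ultimately have "A $$ (pick S i, pick T (p i)) = 0"
          using low A unfolding weight_lower_def by (simp only: carrier_matD not_le)
        then show False using True that by blast
      qed
      have "(\<Sum>i=0..<k. w (pick T (p i))) = sum w T"
        using sum.reindex_bij_betw[OF bij_betw_trans[OF permutes_imp_bij[OF p] bT], of w] by simp
      moreover have "(\<Sum>i=0..<k. w (pick S i)) = sum w S"
        using sum.reindex_bij_betw[OF bS, of w] by simp
      ultimately have "(\<Sum>i=0..<k. w (pick T (p i))) = (\<Sum>i=0..<k. w (pick S i))"
        using sum_mono[of "{0..<k}" "\<lambda>i. w (pick T (p i))" "\<lambda>i. w (pick S i)"] ge le by simp
      then have "w (pick T (p i)) = w (pick S i)" if "i < k" for i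
        using sum_mono_inv[of "\<lambda>i. w (pick T (p i))" "{0..<k}" "\<lambda>i. w (pick S i)" i] ge that by simp
      then show ?thesis by (intro prod.cong) (simp_all add: entry)
    next
      case False
      then obtain i where i: "i < k" "A $$ (pick S i, pick T (p i)) = 0" by blast
      then have "?l = 0" by (intro prod_zero) auto
      moreover have "?r = 0"
        by (rule prod_zero) (use i entry[OF i(1)] in \<open>auto intro!: bexI[of _ i]\<close>)
      ultimately show ?thesis by (rule trans[OF _ sym])
    qed
  qed
  have "det (mat k k (\<lambda>(i, j). A $$ (pick S i, pick T j)))
      = det (mat k k (\<lambda>(i, j). weight_part w A $$ (pick S i, pick T j)))"
    using eq permutes_in_image[of _ "{0..<k}"] by (simp add: det_def'[of _ k])
  then show ?thesis using A ST by (simp add: compound_eq_det)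
qed

subsection \<open>Congruence of compound matrices\<close>

definition supported :: "nat \<Rightarrow> nat \<Rightarrow> set_mat \<Rightarrow> bool" where
  "supported n k B \<longleftrightarrow> (\<forall>S T. (S, T) \<notin> k_subsets n k \<times> k_subsets n k \<longrightarrow> B (S, T) = 0)"

lemma supportedD: "supported n k B \<Longrightarrow> S \<notin> k_subsets n k \<or> T \<notin> k_subsets n k \<Longrightarrow> B (S, T) = 0"
  by (auto simp: supported_def)

lemma supported_compound [simp]: "supported n k (compound n k A)"
  by (auto simp: supported_def compound_def)

lemma supported_congr [simp]: "supported n k (congr n k h B)"
  unfolding supported_def congr_def
  by (auto simp: compound_outside intro!: sum.neutral)

lemma congr_scale: "congr n k h (\<lambda>x. c * B x) = (\<lambda>x. c * congr n k h B x)"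
  by (rule ext) (auto simp: congr_def sum_distrib_left algebra_simps)

lemma compound_one: "compound n k (1\<^sub>m n) (S, T) = (if S = T \<and> S \<in> k_subsets n k then 1 else 0)"
  using compound_diagonal[of n k "\<lambda>_. 1" S T] by (auto simp: one_mat_def)

lemma congr_one: 
  assumes "supported n k B"
  shows "congr n k (1\<^sub>m n) B = B"
proof
  fix x :: "nat set \<times> nat set"
  obtain S T where x: "x = (S, T)" by fastforce
  show "congr n k (1\<^sub>m n) B x = B x"
  proof (cases "S \<in> k_subsets n k \<and> T \<in> k_subsets n k")
    case True
    have "congr n k (1\<^sub>m n) B x = (\<Sum>S'\<in>k_subsets n k. if S' = S
        then \<Sum>T'\<in>k_subsets n k. if T' = T then B (S, T) else 0 else 0)"
      unfolding x congr_def case_prod_conv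
      by (intro sum.cong refl) (auto simp: compound_one if_distrib[of "(*) (B _)"] cong: if_cong)
    also have "\<dots> = B x" using True by (simp add: x)
    finally show ?thesis .
  next
    case False
    then show ?thesis using supportedD[OF assms] supportedD[OF supported_congr] x by metis
  qed
qed

text \<open>Associativity for a product of five matrices written as sums: the outer factors are
  moved next to the inner ones, so that two successive congruences become one.\<close>

lemma sum_product_swap:
  "(\<Sum>a\<in>A. \<Sum>b\<in>B. f a * (\<Sum>c\<in>C. \<Sum>d\<in>D. g a c * X c d * h d b) * k b)
   = (\<Sum>c\<in>C. \<Sum>d\<in>D. (\<Sum>a\<in>A. g a c * f a) * X c d * (\<Sum>b\<in>B. h d b * (k b :: complex)))"
proof -
  have "(\<Sum>a\<in>A. \<Sum>b\<in>B. f a * (\<Sum>c\<in>C. \<Sum>d\<in>D. g a c * X c d * h d b) * k b)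
      = (\<Sum>a\<in>A. \<Sum>b\<in>B. \<Sum>c\<in>C. \<Sum>d\<in>D. g a c * f a * X c d * (h d b * k b))"
    by (simp only: sum_distrib_left sum_distrib_right) (simp only: mult_ac)
  also have "\<dots> = (\<Sum>a\<in>A. \<Sum>c\<in>C. \<Sum>b\<in>B. \<Sum>d\<in>D. g a c * f a * X c d * (h d b * k b))"
    by (rule sum.cong[OF refl], rule sum.swap)
  also have "\<dots> = (\<Sum>c\<in>C. \<Sum>a\<in>A. \<Sum>b\<in>B. \<Sum>d\<in>D. g a c * f a * X c d * (h d b * k b))"
    by (rule sum.swap)
  also have "\<dots> = (\<Sum>c\<in>C. \<Sum>a\<in>A. \<Sum>d\<in>D. \<Sum>b\<in>B. g a c * f a * X c d * (h d b * k b))"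
    by (rule sum.cong[OF refl], rule sum.cong[OF refl], rule sum.swap)
  also have "\<dots> = (\<Sum>c\<in>C. \<Sum>d\<in>D. \<Sum>a\<in>A. \<Sum>b\<in>B. g a c * f a * X c d * (h d b * k b))"
    by (rule sum.cong[OF refl], rule sum.swap)
  also have "\<dots> = (\<Sum>c\<in>C. \<Sum>d\<in>D. (\<Sum>a\<in>A. g a c * f a) * X c d * (\<Sum>b\<in>B. h d b * k b))"
    by (simp only: sum_product[symmetric] sum_distrib_right[symmetric])
  finally show ?thesis .
qed

lemma congr_congr:
  assumes g: "g \<in> carrier_mat n n" and h: "h \<in> carrier_mat n n"
  shows "congr n k h (congr n k g B) = congr n k (g * h) B"
proof
  fix x :: "nat set \<times> nat set"
  obtain S T where x: "x = (S, T)" by fastforce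
  show "congr n k h (congr n k g B) x = congr n k (g * h) B x"
    unfolding x congr_def using compound_mult[OF g h, of k]
      sum_product_swap[where A = "k_subsets n k" and B = "k_subsets n k" and C = "k_subsets n k"
        and D = "k_subsets n k" and f = "\<lambda>a. compound n k h (a, S)" and k = "\<lambda>b. compound n k h (b, T)"
        and g = "\<lambda>a c. compound n k g (c, a)" and h = "\<lambda>d b. compound n k g (d, b)"
        and X = "\<lambda>c d. B (c, d)"]
    by simp
qed

lemma congr_compound:
  assumes h: "h \<in> carrier_mat n n" and A: "A \<in> carrier_mat n n"
  shows "congr n k h (compound n k A) = compound n k (transpose_mat h * A * h)"
proof
  fix x :: "nat set \<times> nat set"
  obtain S T where x: "x = (S, T)" by fastforce
  have hT: "transpose_mat h \<in> carrier_mat n n" using h by simp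
  have "compound n k (transpose_mat h * A * h) (S, T)
      = (\<Sum>V\<in>k_subsets n k. \<Sum>U\<in>k_subsets n k. 
          compound n k h (U, S) * compound n k A (U, V) * compound n k h (V, T))"
    using compound_mult[OF mult_carrier_mat[OF hT A] h, of k] compound_mult[OF hT A, of k]
    by (simp add: compound_transpose[OF h] sum_distrib_right)
  also have "\<dots> = congr n k h (compound n k A) (S, T)"
    unfolding congr_def prod.case by (rule sum.swap)
  finally show "congr n k h (compound n k A) x = compound n k (transpose_mat h * A * h) x" by (simp add: x)
qed

section \<open>Invertible congruences\<close>

definition GL :: "nat \<Rightarrow> complex mat set" where
  "GL n = {h \<in> carrier_mat n n. det h \<noteq> 0}"

lemma GL_carrier: "h \<in> GL n \<Longrightarrow> h \<in> carrier_mat n n"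
  by (simp add: GL_def)

lemma GL_mult: "g \<in> GL n \<Longrightarrow> h \<in> GL n \<Longrightarrow> g * h \<in> GL n"
  using det_mult[of g n h] mult_carrier_mat[of g n n h n] by (simp add: GL_def)

lemma GL_inverse:
  assumes "h \<in> GL n"
  obtains g where "g \<in> GL n" "g * h = 1\<^sub>m n" "h * g = 1\<^sub>m n"
proof -
  from assms have h: "h \<in> carrier_mat n n" "det h \<noteq> 0" by (auto simp: GL_def)
  let ?g = "(1 / det h) \<cdot>\<^sub>m adj_mat h"
  have g: "?g \<in> carrier_mat n n" using adj_mat(1)[OF h(1)] by simp
  have 1: "?g * h = 1\<^sub>m n" "h * ?g = 1\<^sub>m n"
    using adj_mat[OF h(1)] h
    by (auto simp: mult_smult_assoc_mat[of _ n n _ n] mult_smult_distrib[of _ n n _ n] intro!: eq_matI)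
  then have "det ?g * det h = 1" using det_mult[OF g h(1)] by simp
  then have "?g \<in> GL n" using g by (auto simp: GL_def)
  then show thesis using that 1 by blast
qed

lemma congr_inverse:
  assumes "g \<in> carrier_mat n n" "h \<in> carrier_mat n n" "g * h = 1\<^sub>m n" "supported n k B"
  shows "congr n k h (congr n k g B) = B"
  using assms congr_congr congr_one by metis

lemma congr_nonzero:
  assumes "h \<in> GL n" "supported n k B" "B \<noteq> (\<lambda>_. 0)"
  shows "congr n k h B \<noteq> (\<lambda>_. 0)"
proof
  assume 0: "congr n k h B = (\<lambda>_. 0)"
  obtain g where g: "g \<in> GL n" "h * g = 1\<^sub>m n" using GL_inverse[OF assms(1)] by metis
  have "congr n k g (congr n k h B) = B" using congr_inverse assms g by (metis GL_carrier)
  then have "B = (\<lambda>_. 0)" unfolding 0 by (simp add: congr_def fun_eq_iff)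
  then show False using assms(3) by contradiction
qed

section \<open>Closed sets of points\<close>

lemma poly_funs_sum:
  "finite A \<Longrightarrow> (\<And>a. a \<in> A \<Longrightarrow> f a \<in> poly_funs C) \<Longrightarrow> (\<lambda>v. \<Sum>a\<in>A. f a v) \<in> poly_funs C"
proof (induction A rule: finite_induct)
  case empty
  then show ?case using poly_funs.const[of 0] by simp
next
  case (insert a A)
  then have "(\<lambda>v. f a v + (\<Sum>a\<in>A. f a v)) \<in> poly_funs C" by (intro poly_funs.add) auto
  then show ?case using insert by simp
qed

lemma poly_funs_prod:
  "finite A \<Longrightarrow> (\<And>a. a \<in> A \<Longrightarrow> f a \<in> poly_funs C) \<Longrightarrow> (\<lambda>v. \<Prod>a\<in>A. f a v) \<in> poly_funs C"
proof (induction A rule: finite_induct)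
  case empty
  then show ?case using poly_funs.const[of 1] by simp
next
  case (insert a A)
  then have "(\<lambda>v. f a v * (\<Prod>a\<in>A. f a v)) \<in> poly_funs C" by (intro poly_funs.mult) auto
  then show ?case using insert by simp
qed

lemma poly_funs_power: "f \<in> poly_funs C \<Longrightarrow> (\<lambda>v. f v ^ m) \<in> poly_funs C"
  by (induction m) (auto intro: poly_funs.const poly_funs.mult)

lemma poly_funs_if:
  "(P \<Longrightarrow> f \<in> poly_funs C) \<Longrightarrow> (\<not> P \<Longrightarrow> g \<in> poly_funs C)
    \<Longrightarrow> (\<lambda>v. if P then f v else g v) \<in> poly_funs C"
  by (cases P) simp_all

lemma poly_funs_diff:
  assumes "f \<in> poly_funs C" "g \<in> poly_funs C"
  shows "(\<lambda>v. f v - g v) \<in> poly_funs C"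
  using poly_funs.add[OF assms(1) poly_funs.mult[OF poly_funs.const[of "-1"] assms(2)]] by simp

lemma poly_funs_det:
  assumes "\<And>v. M v \<in> carrier_mat k k"
    and "\<And>i j. i < k \<Longrightarrow> j < k \<Longrightarrow> (\<lambda>v. M v $$ (i, j)) \<in> poly_funs C"
  shows "(\<lambda>v. det (M v)) \<in> poly_funs C"
  unfolding det_def'[OF assms(1)]
  by (intro poly_funs_sum poly_funs.mult poly_funs.const poly_funs_prod assms(2))
    (auto simp: finite_permutations permutes_in_image[of _ "{0..<k}", simplified])

lemma poly_funs_compound:
  assumes "\<And>v. M v \<in> carrier_mat n n"
    and "\<And>i j. i < n \<Longrightarrow> j < n \<Longrightarrow> (\<lambda>v. M v $$ (i, j)) \<in> poly_funs C"
  shows "(\<lambda>v. compound n k (M v) (S, T)) \<in> poly_funs C"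
proof (cases "S \<in> k_subsets n k \<and> T \<in> k_subsets n k")
  case True
  then show ?thesis
    by (auto simp: compound_eq_det[OF assms(1)] pick_k_subsets intro!: poly_funs_det assms(2))
next
  case False
  then have "(\<lambda>v. compound n k (M v) (S, T)) = (\<lambda>_. 0)" by (auto simp: compound_outside)
  then show ?thesis using poly_funs.const[of 0] by simp
qed

lemma poly_funs_congr:
  assumes "\<And>v. M v \<in> carrier_mat n n"
    and "\<And>i j. i < n \<Longrightarrow> j < n \<Longrightarrow> (\<lambda>v. M v $$ (i, j)) \<in> poly_funs C"
    and "\<And>S T. S \<in> k_subsets n k \<Longrightarrow> T \<in> k_subsets n k \<Longrightarrow> (\<lambda>v. B v (S, T)) \<in> poly_funs C"
  shows "(\<lambda>v. congr n k (M v) (B v) (S, T)) \<in> poly_funs C"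
  unfolding congr_def prod.case
  by (intro poly_funs_sum poly_funs.mult poly_funs_compound assms) auto

lemma poly_funs_cong:
  assumes "f \<in> poly_funs C" "\<And>c. c \<in> C \<Longrightarrow> c v = c v'"
  shows "f v = f v'"
  using assms by induction auto

lemma poly_funs_compose:
  assumes "f \<in> poly_funs C" "\<And>c. c \<in> C \<Longrightarrow> (\<lambda>s. c (h s)) \<in> poly_funs D"
  shows "(\<lambda>s. f (h s)) \<in> poly_funs D"
  using assms by induction (auto intro: poly_funs.intros)

lemma poly_funs_id: "(\<lambda>s. s) \<in> poly_funs {\<lambda>s. s}"
  by (rule poly_funs.coord) simp

lemma poly_funs_univariate:
  assumes "f \<in> poly_funs {\<lambda>s. s}"
  shows "\<exists>p. f = poly p"
  using assms
proof induction
  case (const c)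
  then show ?case by (intro exI[of _ "[:c:]"]) auto
next
  case (coord f)
  then show ?case by (intro exI[of _ "[:0, 1:]"]) auto
next
  case (add f g)
  then obtain p q where "f = poly p" "g = poly q" by auto
  then show ?case by (intro exI[of _ "p + q"]) auto
next
  case (mult f g)
  then obtain p q where "f = poly p" "g = poly q" by auto
  then show ?case by (intro exI[of _ "p * q"]) auto
qed

lemma univariate_finite_zeros:
  assumes "f \<in> poly_funs {\<lambda>s. s}" "f s \<noteq> 0"
  shows "finite {s. f s = 0}"
proof -
  obtain p where p: "f = poly p" using poly_funs_univariate[OF assms(1)] by blast
  then have "p \<noteq> 0" using assms(2) by auto
  then show ?thesis using poly_roots_finite p by simp
qed

lemma univariate_eq_0:
  assumes "f \<in> poly_funs {\<lambda>s. s}" "infinite {s. f s = 0}"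
  shows "f s = 0"
  using assms univariate_finite_zeros by blast

text \<open>The substitute for a passage to the limit: a nonzero polynomial has only finitely many
  zeros.\<close>

lemma univariate_eq_0_limit:
  assumes "f \<in> poly_funs {\<lambda>s. s}" "\<And>s. s \<noteq> 0 \<Longrightarrow> f s = 0"
  shows "f 0 = 0"
proof (rule univariate_eq_0[OF assms(1)])
  have "infinite (UNIV - {0 :: complex})" by (intro Diff_infinite_finite infinite_UNIV_char_0) auto
  moreover have "UNIV - {0} \<subseteq> {s. f s = 0}" using assms(2) by auto
  ultimately show "infinite {s. f s = 0}" using infinite_super by blast
qed

section \<open>Points, their representatives and the Zariski closure\<close>

definition coords :: "nat \<Rightarrow> ((nat \<Rightarrow> set_mat) \<Rightarrow> complex) set" where
  "coords n = {\<lambda>v. v k (S, T) | k S T.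
     k \<in> {1..n-1} \<and> S \<in> k_subsets n k \<and> T \<in> k_subsets n k}"

lemma multihom_polys_alt:
  "multihom_polys n = {f \<in> poly_funs (coords n).
     \<exists>d. \<forall>c v. f (\<lambda>k x. c k * v k x) = (\<Prod>k=1..n-1. c k ^ d k) * f v}"
  by (simp add: multihom_polys_def coords_def)

lemma coordsI:
  "k \<in> {1..n-1} \<Longrightarrow> S \<in> k_subsets n k \<Longrightarrow> T \<in> k_subsets n k \<Longrightarrow> (\<lambda>v. v k (S, T)) \<in> poly_funs (coords n)"
  by (rule poly_funs.coord) (auto simp: coords_def)

definition pt :: "nat \<Rightarrow> (nat \<Rightarrow> set_mat) \<Rightarrow> point" where
  "pt n B = (\<lambda>k\<in>{1..n-1}. proj_class (B k))"

definition frame :: "nat \<Rightarrow> (nat \<Rightarrow> set_mat) \<Rightarrow> bool" where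
  "frame n B \<longleftrightarrow> (\<forall>k\<in>{1..n-1}. B k \<in> sym_mats n k \<and> B k \<noteq> (\<lambda>_. 0))"

lemma frame_supported: "frame n B \<Longrightarrow> k \<in> {1..n-1} \<Longrightarrow> supported n k (B k)"
  by (auto simp: frame_def sym_mats_def supported_def)

lemma ambient_eq: "ambient n = pt n ` {B. frame n B}"
proof (intro equalityI subsetI)
  fix p assume p: "p \<in> ambient n"
  then have "\<forall>k\<in>{1..n-1}. \<exists>B. B \<in> sym_mats n k \<and> B \<noteq> (\<lambda>_. 0) \<and> p k = proj_class B"
    unfolding ambient_def proj_space_def by fastforce
  then obtain B where B: "\<forall>k\<in>{1..n-1}. B k \<in> sym_mats n k \<and> B k \<noteq> (\<lambda>_. 0) \<and> p k = proj_class (B k)"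
    by metis
  have "p = pt n B"
    by (rule PiE_ext[of p "{1..n-1}" "\<lambda>k. proj_space (sym_mats n k)"])
      (use p B in \<open>auto simp: ambient_def pt_def proj_space_def\<close>)
  then show "p \<in> pt n ` {B. frame n B}" using B by (auto simp: frame_def)
qed (auto simp: ambient_def pt_def frame_def proj_space_def)

lemma pt_ambient: "frame n B \<Longrightarrow> pt n B \<in> ambient n"
  by (auto simp: ambient_eq)

lemma proj_class_self: "B \<in> proj_class B"
  by (auto simp: proj_class_def intro!: exI[of _ 1])

lemma proj_class_scale: "c \<noteq> 0 \<Longrightarrow> proj_class (\<lambda>x. c * B x) = proj_class B"
proof (intro equalityI subsetI)
  assume c: "c \<noteq> 0"
  fix D assume "D \<in> proj_class B"
  then obtain d where "d \<noteq> 0" "D = (\<lambda>x. d * B x)" by (auto simp: proj_class_def)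
  then show "D \<in> proj_class (\<lambda>x. c * B x)" using c by (auto simp: proj_class_def intro!: exI[of _ "d / c"])
next
  assume c: "c \<noteq> 0"
  fix D assume "D \<in> proj_class (\<lambda>x. c * B x)"
  then obtain d where "d \<noteq> 0" "D = (\<lambda>x. d * (c * B x))" by (auto simp: proj_class_def)
  then show "D \<in> proj_class B" using c by (auto simp: proj_class_def intro!: exI[of _ "d * c"])
qed

lemma proj_class_eq_iff:
  "proj_class B = proj_class D \<longleftrightarrow> (\<exists>c. c \<noteq> 0 \<and> D = (\<lambda>x. c * B x))"
proof
  assume "proj_class B = proj_class D"
  then have "D \<in> proj_class B" using proj_class_self by blast
  then show "\<exists>c. c \<noteq> 0 \<and> D = (\<lambda>x. c * B x)" by (auto simp: proj_class_def)
qed (auto simp: proj_class_scale)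

lemma pt_eq_iff:
  "pt n B = pt n D \<longleftrightarrow> (\<forall>k\<in>{1..n-1}. \<exists>c. c \<noteq> 0 \<and> D k = (\<lambda>x. c * B k x))"
proof -
  have "pt n B = pt n D \<longleftrightarrow> (\<forall>k\<in>{1..n-1}. proj_class (B k) = proj_class (D k))"
    unfolding pt_def by (metis (no_types, lifting) restrict_apply' restrict_ext)
  then show ?thesis by (simp add: proj_class_eq_iff)
qed

lemma vanishes_at_pt:
  assumes "f \<in> multihom_polys n"
  shows "vanishes_at n f (pt n B) \<longleftrightarrow> f B = 0"
proof
  assume "vanishes_at n f (pt n B)"
  moreover have "B \<in> Pi {1..n-1} (pt n B)" by (auto simp: pt_def proj_class_self)
  ultimately show "f B = 0" by (simp add: vanishes_at_def)
next
  assume 0: "f B = 0"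
  show "vanishes_at n f (pt n B)"
    unfolding vanishes_at_def
  proof
    fix v assume v: "v \<in> Pi {1..n-1} (pt n B)"
    have "\<exists>c. \<forall>k\<in>{1..n-1}. v k = (\<lambda>x. c k * B k x)"
      by (rule bchoice) (use v in \<open>auto simp: pt_def proj_class_def Pi_iff\<close>)
    then obtain c where c: "\<forall>k\<in>{1..n-1}. v k = (\<lambda>x. c k * B k x)" ..
    \<comment> \<open>\<open>v\<close> and the rescaled \<open>B\<close> are known to agree only in
      the degrees from \<open>1\<close> to \<open>n - 1\<close>; the coordinate functions look at no
      others.\<close>
    have "f v = f (\<lambda>k x. c k * B k x)"
      by (rule poly_funs_cong[of f "coords n"])
        (use assms c in \<open>auto simp: multihom_polys_alt coords_def\<close>)
    then show "f v = 0" using assms 0 by (auto simp: multihom_polys_alt)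
  qed
qed

lemma zariski_closure_eq:
  assumes "S \<subseteq> ambient n"
  shows "zariski_closure n S = {p \<in> ambient n. \<forall>f\<in>multihom_polys n.
     (\<forall>q\<in>S. vanishes_at n f q) \<longrightarrow> vanishes_at n f p}" (is "_ = ?R")
proof (intro equalityI)
  let ?F = "{f \<in> multihom_polys n. \<forall>q\<in>S. vanishes_at n f q}"
  have "zariski_closed n ?R"
    unfolding zariski_closed_def by (intro exI[of _ ?F]) auto
  moreover have "S \<subseteq> ?R" using assms by auto
  ultimately show "zariski_closure n S \<subseteq> ?R"
    unfolding zariski_closure_def by (simp add: hull_minimal)
  show "?R \<subseteq> zariski_closure n S"
    unfolding zariski_closure_def hull_def zariski_closed_def by blast
qed

lemma zariski_closure_closed:
  assumes "S \<subseteq> ambient n"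
  shows "zariski_closed n (zariski_closure n S)"
  unfolding zariski_closure_eq[OF assms] zariski_closed_def
  by (intro exI[of _ "{f \<in> multihom_polys n. \<forall>q\<in>S. vanishes_at n f q}"]) auto

lemma zariski_closure_ambient: "S \<subseteq> ambient n \<Longrightarrow> zariski_closure n S \<subseteq> ambient n"
  by (auto simp: zariski_closure_eq)

lemma zariski_closure_superset: "S \<subseteq> zariski_closure n S"
  unfolding zariski_closure_def by (rule hull_subset)

lemma pt_in_closureD:
  assumes "S \<subseteq> ambient n" "pt n B \<in> zariski_closure n S" "f \<in> multihom_polys n"
    "\<And>D. frame n D \<Longrightarrow> pt n D \<in> S \<Longrightarrow> f D = 0"
  shows "f B = 0"
proof -
  have "vanishes_at n f q" if q: "q \<in> S" for q
  proof -
    obtain D where "q = pt n D" "frame n D" using assms(1) \<open>q \<in> S\<close> unfolding ambient_eq by blast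
    then show ?thesis using assms(3,4) q by (simp add: vanishes_at_pt)
  qed
  then have "vanishes_at n f (pt n B)" using assms(1-3) by (simp add: zariski_closure_eq)
  then show ?thesis using assms(3) by (simp add: vanishes_at_pt)
qed

subsection \<open>The action of the general linear group\<close>

text \<open>A right action: \<open>trp n g\<close> followed by \<open>trp n h\<close> is
  \<open>trp n (g * h)\<close>. The left action \<open>act\<close> of an element is
  \<open>trp\<close> of its inverse.\<close>

definition trp :: "nat \<Rightarrow> complex mat \<Rightarrow> point \<Rightarrow> point" where
  "trp n h p = (\<lambda>k\<in>{1..n-1}. congr n k h ` p k)"

lemma act_eq_trp: "act n g p = trp n (inv\<^bsub>SL n\<^esub> g) p"
  by (simp add: act_def trp_def)

lemma trp_pt: "trp n h (pt n B) = pt n (\<lambda>k. congr n k h (B k))"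
proof -
  have "congr n k h ` proj_class B = proj_class (congr n k h B)" for k B
  proof -
    have "proj_class B = (\<lambda>c x. c * B x) ` {c. c \<noteq> 0}"
      "proj_class (congr n k h B) = (\<lambda>c x. c * congr n k h B x) ` {c. c \<noteq> 0}"
      unfolding proj_class_def by blast+
    then show ?thesis by (simp add: image_image congr_scale)
  qed
  then show ?thesis unfolding trp_def pt_def by (intro restrict_ext) simp
qed

lemma congr_sym_mats: "B \<in> sym_mats n k \<Longrightarrow> congr n k h B \<in> sym_mats n k"
proof -
  assume B: "B \<in> sym_mats n k"
  have "congr n k h B (S, T) = congr n k h B (T, S)" for S T
  proof -
    have "congr n k h B (S, T) = (\<Sum>T'\<in>k_subsets n k. \<Sum>S'\<in>k_subsets n k.
        compound n k h (S', S) * B (S', T') * compound n k h (T', T))"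
      unfolding congr_def prod.case by (rule sum.swap)
    also have "\<dots> = congr n k h B (T, S)"
      unfolding congr_def prod.case using B by (intro sum.cong refl) (auto simp: sym_mats_def)
    finally show ?thesis .
  qed
  moreover have "supported n k (congr n k h B)" by simp
  ultimately show ?thesis unfolding sym_mats_def supported_def by blast
qed

lemma frame_congr:
  assumes "h \<in> GL n" "frame n B"
  shows "frame n (\<lambda>k. congr n k h (B k))"
  using assms congr_sym_mats congr_nonzero frame_supported unfolding frame_def by blast

lemma trp_ambient: "h \<in> GL n \<Longrightarrow> p \<in> ambient n \<Longrightarrow> trp n h p \<in> ambient n"
  by (auto simp: ambient_eq trp_pt intro!: imageI frame_congr)

lemma trp_trp:
  assumes "g \<in> carrier_mat n n" "h \<in> carrier_mat n n" "p \<in> ambient n"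
  shows "trp n h (trp n g p) = trp n (g * h) p"
  using assms by (auto simp: ambient_eq trp_pt congr_congr)

lemma pt_cong: "(\<And>k. k \<in> {1..n-1} \<Longrightarrow> B k = D k) \<Longrightarrow> pt n B = pt n D"
  unfolding pt_def by (rule restrict_ext) simp

lemma trp_one: "p \<in> ambient n \<Longrightarrow> trp n (1\<^sub>m n) p = p"
  by (auto simp: ambient_eq trp_pt intro!: pt_cong congr_one frame_supported)

lemma trp_cancel:
  assumes "g \<in> GL n" "h \<in> GL n" "g * h = 1\<^sub>m n" "p \<in> ambient n"
  shows "trp n h (trp n g p) = p"
  using assms by (simp add: trp_trp trp_one GL_carrier)

definition GL_stable :: "nat \<Rightarrow> point set \<Rightarrow> bool" where
  "GL_stable n Z \<longleftrightarrow> (\<forall>h\<in>GL n. \<forall>p\<in>Z. trp n h p \<in> Z)"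

lemma GL_stable_iff:
  assumes "GL_stable n Z" "h \<in> GL n" "p \<in> ambient n"
  shows "trp n h p \<in> Z \<longleftrightarrow> p \<in> Z"
proof
  assume "trp n h p \<in> Z"
  moreover obtain g where "g \<in> GL n" "h * g = 1\<^sub>m n" using GL_inverse[OF assms(2)] by metis
  ultimately show "p \<in> Z" using trp_cancel[OF assms(2) _ _ assms(3)] assms(1)
    unfolding GL_stable_def by metis
qed (use assms in \<open>auto simp: GL_stable_def\<close>)

lemma multihom_congr:
  assumes f: "f \<in> multihom_polys n" and h: "h \<in> carrier_mat n n"
  shows "(\<lambda>v. f (\<lambda>k. congr n k h (v k))) \<in> multihom_polys n"
proof -
  have "(\<lambda>v. f (\<lambda>k. congr n k h (v k))) \<in> poly_funs (coords n)"
  proof (rule poly_funs_compose[of f "coords n"])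
    fix c assume "c \<in> coords n"
    then obtain k S T where c: "c = (\<lambda>v. v k (S, T))" and k: "k \<in> {1..n-1}" by (auto simp: coords_def)
    show "(\<lambda>v. c (\<lambda>k. congr n k h (v k))) \<in> poly_funs (coords n)"
      unfolding c by (intro poly_funs_congr h poly_funs.const coordsI[OF k])
  qed (use f in \<open>simp add: multihom_polys_alt\<close>)
  then show ?thesis using f by (auto simp: multihom_polys_alt congr_scale)
qed

text \<open>Composition with a congruence keeps a polynomial multihomogeneous, so the pullback of a
  polynomial that vanishes on the stable set \<open>S\<close> is again such a polynomial and must
  vanish on the closure.\<close>

lemma closure_GL_stable:
  assumes S: "S \<subseteq> ambient n" and stable: "GL_stable n S"
  shows "GL_stable n (zariski_closure n S)"
  unfolding GL_stable_def
proof (intro ballI)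
  fix h p assume h: "h \<in> GL n" and p: "p \<in> zariski_closure n S"
  then obtain B where B: "p = pt n B" "frame n B"
    using zariski_closure_ambient[OF S] by (auto simp: ambient_eq)
  have hc: "h \<in> carrier_mat n n" using h by (rule GL_carrier)
  have "vanishes_at n f (trp n h p)"
    if f: "f \<in> multihom_polys n" "\<forall>q\<in>S. vanishes_at n f q" for f
  proof -
    have "f (\<lambda>k. congr n k h (B k)) = 0"
    proof (rule pt_in_closureD[OF S p[unfolded B] multihom_congr[OF f(1) hc]])
      fix D assume "frame n D" "pt n D \<in> S"
      then have "trp n h (pt n D) \<in> S" using stable h by (auto simp: GL_stable_def)
      then show "f (\<lambda>k. congr n k h (D k)) = 0" using f vanishes_at_pt[OF f(1)] by (auto simp: trp_pt)
    qed
    then show ?thesis using f(1) B by (simp add: trp_pt vanishes_at_pt)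
  qed
  moreover have "trp n h p \<in> ambient n"
    using trp_ambient[OF h] p zariski_closure_ambient[OF S] by blast
  ultimately show "trp n h p \<in> zariski_closure n S" by (simp add: zariski_closure_eq[OF S])
qed

section \<open>Base points\<close>

text \<open>In the flag description, \<^term>\<open>adapted n K S\<close> says that the coordinate subspace of \<open>S\<close>
  lies between the two consecutive members, of dimensions in the complement of \<open>K\<close>, of the standard flag.\<close>

definition adapted :: "nat \<Rightarrow> nat set \<Rightarrow> nat set \<Rightarrow> bool" where
  "adapted n K S \<longleftrightarrow> (\<forall>m\<in>{1..n-1} - K. S \<subseteq> {..<m} \<or> {..<m} \<subseteq> S)"

text \<open>The number of the block that contains \<open>i\<close>, counted from zero. Used as an
  exponent, it defines the one-parameter subgroup that degenerates a form to its blocks.\<close>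

definition block_weight :: "nat \<Rightarrow> nat set \<Rightarrow> nat \<Rightarrow> nat" where
  "block_weight n K i = card {m \<in> {1..n-1} - K. m \<le> i}"

lemma adapted_lessThan [simp]: "adapted n K {..<k}"
  by (auto simp: adapted_def)

lemma adapted_mono: "adapted n K S \<Longrightarrow> K \<subseteq> K' \<Longrightarrow> adapted n K' S"
  by (auto simp: adapted_def)

lemma block_weight_sum:
  assumes "finite S"
  shows "sum (block_weight n K) S = (\<Sum>m\<in>{1..n-1} - K. card {i \<in> S. m \<le> i})"
proof -
  have "sum (block_weight n K) S = (\<Sum>i\<in>S. \<Sum>m\<in>{1..n-1} - K. if m \<le> i then 1 else 0)"
    by (auto simp: block_weight_def sum.If_cases intro!: sum.cong arg_cong[of _ _ card])
  also have "\<dots> = (\<Sum>m\<in>{1..n-1} - K. \<Sum>i\<in>S. if m \<le> i then 1 else 0)" by (rule sum.swap)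
  also have "\<dots> = (\<Sum>m\<in>{1..n-1} - K. card {i \<in> S. m \<le> i})"
    using assms by (auto simp: sum.If_cases intro!: sum.cong arg_cong[of _ _ card])
  finally show ?thesis .
qed

text \<open>At most \<open>min k m\<close> elements of \<open>S\<close> lie below \<open>m\<close>,
  and the bound is attained exactly when one of \<open>S\<close> and \<open>{..<m}\<close> contains
  the other.\<close>

lemma card_above:
  assumes "S \<in> k_subsets n k"
  shows "card {i \<in> {..<k}. m \<le> i} \<le> card {i \<in> S. m \<le> i}"
    and "card {i \<in> S. m \<le> i} = card {i \<in> {..<k}. m \<le> i} \<longleftrightarrow> S \<subseteq> {..<m} \<or> {..<m} \<subseteq> S"
proof -
  note S = k_subsetsD[OF assms]
  have "{i \<in> {..<k}. m \<le> i} = {m..<k}" by auto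
  then have 1: "card {i \<in> {..<k}. m \<le> i} = k - m" by simp
  have "{i \<in> S. m \<le> i} = S - S \<inter> {..<m}" by auto
  then have 2: "card {i \<in> S. m \<le> i} = k - card (S \<inter> {..<m})"
    using S by (simp add: card_Diff_subset)
  have c: "card (S \<inter> {..<m}) \<le> k" "card (S \<inter> {..<m}) \<le> m"
    using S card_mono[of S "S \<inter> {..<m}"] card_mono[of "{..<m}" "S \<inter> {..<m}"] by auto
  show "card {i \<in> {..<k}. m \<le> i} \<le> card {i \<in> S. m \<le> i}" using 1 2 c by simp
  have "S \<subseteq> {..<m} \<longleftrightarrow> card (S \<inter> {..<m}) = k"
    using S card_subset_eq[of S "S \<inter> {..<m}"] by (auto simp: Int_absorb2)
  moreover have "{..<m} \<subseteq> S \<longleftrightarrow> card (S \<inter> {..<m}) = m"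
    using card_subset_eq[of "{..<m}" "S \<inter> {..<m}"] by (auto simp: Int_absorb1)
  ultimately show "card {i \<in> S. m \<le> i} = card {i \<in> {..<k}. m \<le> i} \<longleftrightarrow> S \<subseteq> {..<m} \<or> {..<m} \<subseteq> S"
    unfolding 1 2 using c by linarith
qed

text \<open>Adapted sets are the sets of minimal total weight, and are therefore the indices whose
  coordinates survive a degeneration.\<close>

lemma block_weight_min:
  assumes S: "S \<in> k_subsets n k"
  shows "sum (block_weight n K) {..<k} \<le> sum (block_weight n K) S"
    and "sum (block_weight n K) S = sum (block_weight n K) {..<k} \<longleftrightarrow> adapted n K S"
proof -
  let ?f = "\<lambda>S m. card {i \<in> S. m \<le> i}"
  have 1: "sum (block_weight n K) S = (\<Sum>m\<in>{1..n-1} - K. ?f S m)"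
    "sum (block_weight n K) {..<k} = (\<Sum>m\<in>{1..n-1} - K. ?f {..<k} m)"
    using k_subsetsD[OF S] by (simp_all add: block_weight_sum)
  show "sum (block_weight n K) {..<k} \<le> sum (block_weight n K) S"
    unfolding 1 by (intro sum_mono card_above(1)[OF S])
  have "sum (block_weight n K) S = sum (block_weight n K) {..<k}
      \<longleftrightarrow> (\<forall>m\<in>{1..n-1} - K. ?f S m = ?f {..<k} m)"
  proof
    assume eq: "sum (block_weight n K) S = sum (block_weight n K) {..<k}"
    show "\<forall>m\<in>{1..n-1} - K. ?f S m = ?f {..<k} m"
    proof
      fix m assume "m \<in> {1..n-1} - K"
      then show "?f S m = ?f {..<k} m"
        using sum_mono_inv[OF eq[unfolded 1, symmetric] card_above(1)[OF S]] by simp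
    qed
  qed (simp add: 1)
  then show "sum (block_weight n K) S = sum (block_weight n K) {..<k} \<longleftrightarrow> adapted n K S"
    using card_above(2)[OF S] by (simp add: adapted_def)
qed

text \<open>The limit of the compounds of \<open>E\<close> under the degeneration attached to
  \<open>K\<close>: after rescaling, coordinates whose row or column set is not of minimal weight
  tend to zero.\<close>

definition limit_form :: "nat \<Rightarrow> nat set \<Rightarrow> complex mat \<Rightarrow> nat \<Rightarrow> set_mat" where
  "limit_form n K E k = (\<lambda>(S, T). if adapted n K S \<and> adapted n K T then compound n k E (S, T) else 0)"

abbreviation block_lower :: "nat \<Rightarrow> nat set \<Rightarrow> complex mat \<Rightarrow> bool" where
  "block_lower n K \<equiv> weight_lower (block_weight n K)"

abbreviation block_part :: "nat \<Rightarrow> nat set \<Rightarrow> complex mat \<Rightarrow> complex mat" where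
  "block_part n K \<equiv> weight_part (block_weight n K)"

text \<open>A parabolic subgroup acts on a limit through its Levi part: starting from a row set of
  minimal weight, nonzero minors lead only to column sets of the same weight, and there the blocks
  off the diagonal do not contribute.\<close>

lemma congr_limit_form:
  assumes h: "h \<in> carrier_mat n n" and low: "block_lower n K h" and E: "E \<in> carrier_mat n n"
  shows "congr n k h (limit_form n K E k)
    = limit_form n K (transpose_mat (block_part n K h) * E * block_part n K h) k"
proof
  fix x :: "nat set \<times> nat set"
  obtain S T where x: "x = (S, T)" by fastforce
  let ?h = "block_part n K h" let ?w = "block_weight n K"
  have h0: "?h \<in> carrier_mat n n" using h by simp
  have adapted_rows: "compound n k h (S', S)
      = (if adapted n K S then compound n k ?h (S', S) else 0)" if "adapted n K S'" for S' S
  proof (cases "S' \<in> k_subsets n k \<and> S \<in> k_subsets n k")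
    case True
    have "sum ?w S' = sum ?w {..<k}" using that True block_weight_min(2) by blast
    moreover have "sum ?w {..<k} \<le> sum ?w S" using True block_weight_min(1) by blast
    ultimately have "compound n k h (S', S) = compound n k ?h (S', S)"
      using compound_weight_part[OF h low] True by simp
    moreover have "compound n k ?h (S', S) = 0" if "\<not> adapted n K S"
      using compound_weight_part_nonzero[OF h, of k ?w S' S] that True block_weight_min(2)[of S n k K]
        \<open>sum ?w S' = sum ?w {..<k}\<close> by auto
    ultimately show ?thesis by auto
  qed (auto simp: compound_outside)
  have adapted_columns: "compound n k ?h (S', S) = 0" if "adapted n K S" "\<not> adapted n K S'" for S' S
  proof (cases "S' \<in> k_subsets n k \<and> S \<in> k_subsets n k")
    case True
    then show ?thesis using compound_weight_part_nonzero[OF h, of k ?w S' S] that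
        block_weight_min(2)[of S n k K] block_weight_min(2)[of S' n k K] by auto
  qed (auto simp: compound_outside)
  define P where "P \<longleftrightarrow> adapted n K S \<and> adapted n K T"
  have "congr n k h (limit_form n K E k) (S, T) = (\<Sum>S'\<in>k_subsets n k. \<Sum>T'\<in>k_subsets n k.
      if P then compound n k ?h (S', S) * compound n k E (S', T') * compound n k ?h (T', T) else 0)"
    unfolding congr_def limit_form_def prod.case P_def
    by (intro sum.cong refl) (auto simp: adapted_rows adapted_columns)
  also have "\<dots> = (if P then congr n k ?h (compound n k E) (S, T) else 0)"
    by (cases P) (simp_all add: congr_def)
  finally show "congr n k h (limit_form n K E k) x
      = limit_form n K (transpose_mat ?h * E * ?h) k x"
    by (simp add: x limit_form_def congr_compound[OF h0 E] P_def)
qed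

definition base :: "nat \<Rightarrow> nat set \<Rightarrow> nat \<Rightarrow> set_mat" where
  "base n K k = (\<lambda>(S, T). if S = T \<and> S \<in> k_subsets n k \<and> adapted n K S then 1 else 0)"

definition base_point :: "nat \<Rightarrow> nat set \<Rightarrow> point" where
  "base_point n K = pt n (base n K)"

lemma base_eq_limit_form: "base n K k = limit_form n K (1\<^sub>m n) k"
  by (auto simp: base_def limit_form_def compound_one fun_eq_iff)

lemma frame_base: "frame n (base n K)"
proof -
  have "base n K k \<noteq> (\<lambda>_. 0)" if "k \<in> {1..n-1}" for k
  proof -
    have "base n K k ({..<k}, {..<k}) = 1" using that by (auto simp: base_def)
    then show ?thesis by (metis zero_neq_one)
  qed
  then show ?thesis by (auto simp: frame_def sym_mats_def base_def)
qed

lemma base_point_ambient: "base_point n K \<in> ambient n"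
  unfolding base_point_def by (rule pt_ambient[OF frame_base])

definition diag :: "nat \<Rightarrow> (nat \<Rightarrow> complex) \<Rightarrow> complex mat" where
  "diag n d = mat n n (\<lambda>(i, j). if i = j then d i else 0)"

lemma diag_carrier [simp]: "diag n d \<in> carrier_mat n n"
  by (simp add: diag_def)

lemma det_diag: "det (diag n d) = prod d {..<n}"
  by (subst det_upper_triangular[of _ n])
    (auto simp: diag_def diag_mat_def prod.list_conv_set_nth atLeast0LessThan)

lemma diag_GL: "(\<And>i. i < n \<Longrightarrow> d i \<noteq> 0) \<Longrightarrow> diag n d \<in> GL n"
  by (auto simp: GL_def det_diag)

lemma congr_diag:
  assumes "supported n k B"
  shows "congr n k (diag n d) B (S, T) = prod d S * B (S, T) * prod d T"
proof (cases "S \<in> k_subsets n k \<and> T \<in> k_subsets n k")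
  case True
  have "congr n k (diag n d) B (S, T) = (\<Sum>S'\<in>k_subsets n k. if S' = S
      then \<Sum>T'\<in>k_subsets n k. if T' = T then prod d S * B (S, T) * prod d T else 0 else 0)"
    unfolding congr_def prod.case using True
    by (intro sum.cong refl) (auto simp: diag_def compound_diagonal
        if_distrib[of "(*) (prod _ _ * B _)"], simp cong: if_cong)
  then show ?thesis using True by simp
next
  case False
  then have "B (S, T) = 0" using supportedD[OF assms] by blast
  moreover have "congr n k (diag n d) B (S, T) = 0"
    using False supportedD[OF supported_congr] by blast
  ultimately show ?thesis by simp
qed

text \<open>The point of \<open>K\<close> is the limit of translates of the point of \<open>K'\<close> by the diagonal matrices
  with entries \<open>s\<close> to the power \<^term>\<open>block_weight n K i\<close>, as \<open>s\<close> tends to zero.\<close>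

lemma base_point_degenerate:
  assumes closed: "zariski_closed n Z" and stable: "GL_stable n Z"
    and K: "K \<subseteq> K'" and Z: "base_point n K' \<in> Z"
  shows "base_point n K \<in> Z"
proof -
  obtain F where F: "F \<subseteq> multihom_polys n" "Z = {p \<in> ambient n. \<forall>f\<in>F. vanishes_at n f p}"
    using closed by (auto simp: zariski_closed_def)
  let ?w = "block_weight n K"
  \<comment> \<open>Representatives of the translates, divided by the power of \<open>s\<close>
    carried by the leading coordinate. The remaining exponents are nonnegative, so the family is
    polynomial in \<open>s\<close>; at \<open>s = 0\<close> only the exponent zero survives, which
    singles out the sets adapted to \<open>K\<close>.\<close>
  define v :: "complex \<Rightarrow> nat \<Rightarrow> set_mat" where "v s k = (\<lambda>(S, T). if S = T \<and> S \<in> k_subsets n k \<and> adapted n K' S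
    then s ^ (2 * (sum ?w S - sum ?w {..<k})) else 0)" for s k
  have "f (base n K) = 0" if f: "f \<in> F" for f
  proof -
    have fm: "f \<in> multihom_polys n" using f F by auto
    have "(\<lambda>s. f (v s)) \<in> poly_funs {\<lambda>s. s}"
    proof (rule poly_funs_compose[of f "coords n"])
      fix c assume "c \<in> coords n"
      then obtain k S T where c: "c = (\<lambda>v. v k (S, T))" by (auto simp: coords_def)
      show "(\<lambda>s. c (v s)) \<in> poly_funs {\<lambda>s. s}"
        unfolding c v_def prod.case
        by (intro poly_funs_if poly_funs_power poly_funs_id poly_funs.const)
    qed (use fm in \<open>simp add: multihom_polys_alt\<close>)
    moreover have "f (v s) = 0" if s: "s \<noteq> 0" for s
    proof -
      let ?d = "diag n (\<lambda>i. s ^ ?w i)"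
      have "?d \<in> GL n" using s by (intro diag_GL) auto
      then have "trp n ?d (base_point n K') \<in> Z" using stable Z by (auto simp: GL_stable_def)
      moreover have "trp n ?d (base_point n K') = pt n (v s)"
        unfolding base_point_def trp_pt pt_eq_iff
      proof
        fix k assume k: "k \<in> {1..n-1}"
        have eq: "v s k x = (1 / s ^ (2 * sum ?w {..<k})) * congr n k ?d (base n K' k) x" for x
        proof -
          obtain S T where x: "x = (S, T)" by fastforce
          have "congr n k ?d (base n K' k) (S, T)
              = prod (\<lambda>i. s ^ ?w i) S * base n K' k (S, T) * prod (\<lambda>i. s ^ ?w i) T"
            by (rule congr_diag[OF frame_supported[OF frame_base k]])
          also have "\<dots> = (if S = T \<and> S \<in> k_subsets n k \<and> adapted n K' S then s ^ (2 * sum ?w S) else 0)"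
            by (auto simp: base_def power_sum[symmetric] power_add[symmetric] mult_2)
          finally show ?thesis using block_weight_min(1)[of S n k K] s
            by (auto simp: x v_def power_diff diff_mult_distrib2)
        qed
        show "\<exists>c. c \<noteq> 0 \<and> v s k = (\<lambda>x. c * congr n k ?d (base n K' k) x)"
          by (rule exI[of _ "1 / s ^ (2 * sum ?w {..<k})"]) (use eq s in auto)
      qed
      ultimately show ?thesis using F(2) f vanishes_at_pt[OF fm] by auto
    qed
    ultimately have "f (v 0) = 0" by (rule univariate_eq_0_limit)
    moreover have "v 0 = base n K"
      using block_weight_min[of _ n _ K] adapted_mono[OF _ K]
      by (fastforce simp: v_def base_def fun_eq_iff power_0_left)
    ultimately show ?thesis by simp
  qed
  then show ?thesis using F base_point_ambient vanishes_at_pt unfolding base_point_def by blast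
qed

subsection \<open>Complete quadrics\<close>

lemma quadric_point_eq: "quadric_point n A = pt n (\<lambda>k. compound n k A)"
  by (simp add: quadric_point_def pt_def)

lemma compound_nonzero:
  assumes "A \<in> GL n" "k \<le> n"
  shows "compound n k A \<noteq> (\<lambda>_. 0)"
proof
  assume 0: "compound n k A = (\<lambda>_. 0)"
  obtain B where B: "B \<in> GL n" "A * B = 1\<^sub>m n" using GL_inverse[OF assms(1)] by metis
  have "compound n k (A * B) ({..<k}, {..<k}) = 0"
    using compound_mult[OF GL_carrier[OF assms(1)] GL_carrier[OF B(1)], of k] 0 by simp
  then show False using B assms(2) by (simp add: compound_one)
qed

lemma frame_compound:
  assumes "A \<in> GL n" "transpose_mat A = A"
  shows "frame n (\<lambda>k. compound n k A)"
proof -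
  have "compound n k A (S, T) = compound n k A (T, S)" for k S T
    using compound_transpose[OF GL_carrier[OF assms(1)], of k S T] assms(2) by simp
  moreover have "compound n k A \<noteq> (\<lambda>_. 0)" if "k \<in> {1..n-1}" for k
    using compound_nonzero[OF assms(1), of k] that by (metis atLeastAtMost_iff diff_le_self le_trans)
  moreover have "supported n k (compound n k A)" for k by simp
  ultimately show ?thesis unfolding frame_def sym_mats_def supported_def by blast
qed

lemma nondegenerate_quadrics_eq:
  "nondegenerate_quadrics n = {pt n (\<lambda>k. compound n k A) | A. A \<in> GL n \<and> transpose_mat A = A}"
  unfolding nondegenerate_quadrics_def GL_def quadric_point_eq by blast

lemma nondegenerate_quadrics_ambient: "nondegenerate_quadrics n \<subseteq> ambient n"
  unfolding nondegenerate_quadrics_eq using pt_ambient[OF frame_compound] by blast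

lemma congruent_GL:
  assumes "A \<in> GL n" "h \<in> GL n"
  shows "transpose_mat h * A * h \<in> GL n"
proof -
  have "transpose_mat h \<in> GL n" using assms(2) det_transpose[of h n] by (simp add: GL_def)
  then show ?thesis using assms GL_mult by blast
qed

lemma congruent_symmetric:
  fixes A :: "complex mat"
  assumes A: "A \<in> carrier_mat n n" and h: "h \<in> carrier_mat n n" and "transpose_mat A = A"
  shows "transpose_mat (transpose_mat h * A * h) = transpose_mat h * A * h"
proof -
  have hT: "transpose_mat h \<in> carrier_mat n n" using h by simp
  have "transpose_mat (transpose_mat h * A * h) = transpose_mat h * transpose_mat (transpose_mat h * A)"
    by (rule transpose_mult[OF mult_carrier_mat[OF hT A] h])
  also have "transpose_mat (transpose_mat h * A) = A * h"
    using transpose_mult[OF hT A] assms(3) by simp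
  finally show ?thesis using assoc_mult_mat[OF hT A h] by simp
qed

lemma nondegenerate_quadrics_GL_stable: "GL_stable n (nondegenerate_quadrics n)"
  unfolding GL_stable_def
proof (intro ballI)
  fix h p assume h: "h \<in> GL n" and "p \<in> nondegenerate_quadrics n"
  then obtain A where A: "A \<in> GL n" "transpose_mat A = A" "p = pt n (\<lambda>k. compound n k A)"
    by (auto simp: nondegenerate_quadrics_eq)
  have "trp n h p = pt n (\<lambda>k. compound n k (transpose_mat h * A * h))"
    using A h by (simp add: trp_pt congr_compound[OF GL_carrier GL_carrier])
  then show "trp n h p \<in> nondegenerate_quadrics n"
    using congruent_GL[OF A(1) h] congruent_symmetric[OF GL_carrier[OF A(1)] GL_carrier[OF h] A(2)]
    by (auto simp: nondegenerate_quadrics_eq)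
qed

lemma complete_quadrics_ambient: "complete_quadrics n \<subseteq> ambient n"
  unfolding complete_quadrics_def by (rule zariski_closure_ambient[OF nondegenerate_quadrics_ambient])

lemma complete_quadrics_closed: "zariski_closed n (complete_quadrics n)"
  unfolding complete_quadrics_def by (rule zariski_closure_closed[OF nondegenerate_quadrics_ambient])

lemma complete_quadrics_GL_stable: "GL_stable n (complete_quadrics n)"
  unfolding complete_quadrics_def
  by (rule closure_GL_stable[OF nondegenerate_quadrics_ambient nondegenerate_quadrics_GL_stable])

text \<open>For \<open>K = UNIV\<close> there are no boundaries and the point is the class of the
  identity matrix; all other standard points are degenerations of it.\<close>

lemma base_point_complete_quadrics: "base_point n K \<in> complete_quadrics n"
proof -
  have "adapted n UNIV S" for S by (simp add: adapted_def)
  then have "base_point n UNIV = pt n (\<lambda>k. compound n k (1\<^sub>m n))"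
    unfolding base_point_def by (intro pt_cong) (auto simp: base_eq_limit_form limit_form_def)
  moreover have "1\<^sub>m n \<in> GL n" "transpose_mat (1\<^sub>m n) = (1\<^sub>m n :: complex mat)" by (simp_all add: GL_def)
  ultimately have "base_point n UNIV \<in> nondegenerate_quadrics n"
    unfolding nondegenerate_quadrics_eq by blast
  then have "base_point n UNIV \<in> complete_quadrics n"
    unfolding complete_quadrics_def using zariski_closure_superset by blast
  then show ?thesis
    using base_point_degenerate[OF complete_quadrics_closed complete_quadrics_GL_stable] by blast
qed

section \<open>Normal form\<close>

definition unitriangular :: "complex mat \<Rightarrow> bool" where
  "unitriangular R \<longleftrightarrow> (\<forall>i<dim_row R. R $$ (i, i) = 1 \<and> (\<forall>j<i. R $$ (i, j) = 0))"

lemma index_congruent_diag: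
  assumes R: "R \<in> carrier_mat n n" and ij: "i < n" "j < n"
  shows "(transpose_mat R * diag n d * R) $$ (i, j) = (\<Sum>l<n. R $$ (l, i) * d l * R $$ (l, j))"
proof -
  have "(transpose_mat R * diag n d) $$ (i, l) = R $$ (l, i) * d l" if "l < n" for l
  proof -
    have "(transpose_mat R * diag n d) $$ (i, l) = (\<Sum>m<n. R $$ (m, i) * (if m = l then d m else 0))"
      using R ij that by (auto simp: scalar_prod_def diag_def atLeast0LessThan intro!: sum.cong)
    also have "\<dots> = (\<Sum>m<n. if m = l then R $$ (m, i) * d m else 0)" by (intro sum.cong) auto
    finally show ?thesis using that by simp
  qed
  moreover have "(transpose_mat R * diag n d * R) $$ (i, j)
      = (\<Sum>l<n. (transpose_mat R * diag n d) $$ (i, l) * R $$ (l, j))"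
    using R ij by (auto simp: scalar_prod_def atLeast0LessThan diag_def intro!: sum.cong)
  ultimately show ?thesis by simp
qed

lemma det_unitriangular:
  assumes "R \<in> carrier_mat n n" "unitriangular R"
  shows "det R = 1"
  using assms by (subst det_upper_triangular[of _ n])
    (auto simp: unitriangular_def diag_mat_def prod.list_conv_set_nth)

lemma mat_solve:
  assumes M: "M \<in> carrier_mat n n" "det M \<noteq> (0 :: complex)"
  shows "\<exists>x. \<forall>i<n. (\<Sum>l<n. M $$ (i, l) * x l) = v i"
proof -
  obtain N where N: "N \<in> GL n" "M * N = 1\<^sub>m n" using GL_inverse[of M n] M by (auto simp: GL_def)
  let ?y = "N *\<^sub>v vec n v"
  have Nc: "N \<in> carrier_mat n n" using N by (auto simp: GL_def)
  have "M *\<^sub>v ?y = vec n v"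
    using assoc_mult_mat_vec[OF M(1) Nc, of "vec n v"] N(2) by simp
  moreover have "(M *\<^sub>v ?y) $ i = (\<Sum>l<n. M $$ (i, l) * ?y $ l)" if "i < n" for i
    using that M(1) Nc by (auto simp: mult_mat_vec_def scalar_prod_def atLeast0LessThan intro!: sum.cong)
  ultimately show ?thesis by (metis index_vec)
qed

text \<open>Bordering: the leading block is decomposed by induction, the last column of
  \<open>R\<close> solves a linear system with matrix \<open>R\<^sup>T D\<close>, and the last
  diagonal entry is what remains. That system is solvable because the leading minor is nonzero; the
  last entry of \<open>D\<close> itself may vanish.\<close>

lemma LDL_decomposition:
  fixes A :: "complex mat"
  assumes "A \<in> carrier_mat n n" "\<And>i j. i < n \<Longrightarrow> j < n \<Longrightarrow> A $$ (i, j) = A $$ (j, i)"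
    and "\<And>k. k < n \<Longrightarrow> det (mat k k (\<lambda>(i, j). A $$ (i, j))) \<noteq> 0"
  shows "\<exists>R d. R \<in> carrier_mat n n \<and> unitriangular R \<and> A = transpose_mat R * diag n d * R"
  using assms
proof (induction n arbitrary: A)
  case 0
  then have "A = transpose_mat (1\<^sub>m 0) * diag 0 (\<lambda>_. 0) * 1\<^sub>m 0" by (intro eq_matI) auto
  then show ?case by (intro exI[of _ "1\<^sub>m 0"] exI[of _ "\<lambda>_. 0"]) (auto simp: unitriangular_def)
next
  case (Suc n)
  define A' where "A' = mat n n (\<lambda>(i, j). A $$ (i, j))"
  have minor: "mat k k (\<lambda>(i, j). A' $$ (i, j)) = mat k k (\<lambda>(i, j). A $$ (i, j))" if "k \<le> n" for k
    using that by (intro eq_matI) (auto simp: A'_def)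
  have "\<exists>R d. R \<in> carrier_mat n n \<and> unitriangular R \<and> A' = transpose_mat R * diag n d * R"
    by (rule Suc.IH) (use Suc.prems minor in \<open>auto simp: A'_def\<close>)
  then obtain R d where R: "R \<in> carrier_mat n n" "unitriangular R" "A' = transpose_mat R * diag n d * R"
    by blast
  let ?M = "transpose_mat R * diag n d"
  have M: "?M \<in> carrier_mat n n" using R(1) diag_carrier by (intro mult_carrier_mat[of _ n n]) auto
  have "det A' \<noteq> 0" using Suc.prems(3)[of n] by (simp add: A'_def)
  then have "det ?M \<noteq> 0" unfolding R(3) using det_mult[OF M R(1)] by auto
  then obtain x where x: "\<forall>i<n. (\<Sum>l<n. ?M $$ (i, l) * x l) = A $$ (i, n)"
    using mat_solve[OF M, of "\<lambda>i. A $$ (i, n)"] by blast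
  have Mi: "?M $$ (i, l) = R $$ (l, i) * d l" if "i < n" "l < n" for i l
  proof -
    have "?M $$ (i, l) = (\<Sum>m<n. R $$ (m, i) * (if m = l then d m else 0))"
      using R that by (auto simp: scalar_prod_def diag_def atLeast0LessThan intro!: sum.cong)
    also have "\<dots> = (\<Sum>m<n. if m = l then R $$ (m, i) * d m else 0)" by (intro sum.cong) auto
    finally show ?thesis using that by simp
  qed
  define R' where "R' = mat (Suc n) (Suc n)
    (\<lambda>(i, j). if j < n then if i < n then R $$ (i, j) else 0 else if i < n then x i else 1)"
  \<comment> \<open>The new entry is the Schur complement of the leading block.\<close>
  define d' where "d' i = (if i < n then d i else A $$ (n, n) - (\<Sum>l<n. x l * d l * x l))" for i
  have R': "R' \<in> carrier_mat (Suc n) (Suc n)" by (simp add: R'_def)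
  have "unitriangular R'" using R(1,2) by (auto simp: unitriangular_def R'_def)
  moreover have "A = transpose_mat R' * diag (Suc n) d' * R'"
  proof (rule eq_matI)
    fix i j
    assume "i < dim_row (transpose_mat R' * diag (Suc n) d' * R')"
      "j < dim_col (transpose_mat R' * diag (Suc n) d' * R')"
    then have ij: "i < Suc n" "j < Suc n" using R' by auto
    have "(transpose_mat R' * diag (Suc n) d' * R') $$ (i, j)
        = (\<Sum>l<n. R' $$ (l, i) * d l * R' $$ (l, j)) + R' $$ (n, i) * d' n * R' $$ (n, j)"
      by (simp add: index_congruent_diag[OF R' ij] d'_def)
    also have "\<dots> = A $$ (i, j)"
    proof -
      consider "i < n" "j < n" | "i < n" "j = n" | "i = n" "j < n" | "i = n" "j = n"
        using ij by linarith
      then show ?thesis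
      proof cases
        case 1
        then have "A $$ (i, j) = (\<Sum>l<n. R $$ (l, i) * d l * R $$ (l, j))"
          using index_congruent_diag[OF R(1), of i j d] R(3) by (metis (no_types, lifting) A'_def case_prod_conv index_mat(1))
        then show ?thesis using 1 by (simp add: R'_def)
      next
        case 2
        then have "A $$ (i, n) = (\<Sum>l<n. R $$ (l, i) * d l * x l)" using x Mi by force
        then show ?thesis using 2 by (simp add: R'_def)
      next
        case 3
        then have "A $$ (j, n) = (\<Sum>l<n. R $$ (l, j) * d l * x l)" using x Mi by force
        then show ?thesis using 3 Suc.prems(2)[of n j] by (simp add: R'_def mult_ac)
      next
        case 4
        then show ?thesis by (simp add: R'_def d'_def)
      qed
    qed
    finally show "A $$ (i, j) = (transpose_mat R' * diag (Suc n) d' * R') $$ (i, j)" by simp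
  qed (use Suc.prems R' in auto)
  ultimately show ?case using R' by blast
qed

lemma compound_leading:
  assumes "A \<in> carrier_mat n n" "k \<le> n"
  shows "compound n k A ({..<k}, {..<k}) = det (mat k k (\<lambda>(i, j). A $$ (i, j)))"
  using assms by (subst compound_eq_det) (auto intro!: arg_cong[of _ _ det] eq_matI simp: pick_lessThan)

text \<open>Complex square roots of the diagonal factor are absorbed into \<open>R\<close>. A
  generic symmetric matrix thus takes the form \<open>V\<^sup>T V\<close>, which the orthogonality
  argument below can handle.\<close>

lemma symmetric_square:
  assumes A: "A \<in> carrier_mat n n" "transpose_mat A = A"
    and "\<And>k. k \<in> {1..n-1} \<Longrightarrow> compound n k A ({..<k}, {..<k}) \<noteq> 0"
  shows "\<exists>V\<in>carrier_mat n n. A = transpose_mat V * V"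
proof -
  have "det (mat k k (\<lambda>(i, j). A $$ (i, j))) \<noteq> 0" if "k < n" for k
    using that assms(3)[of k] compound_leading[OF A(1), of k] by (cases k) auto
  moreover have "A $$ (i, j) = A $$ (j, i)" if "i < n" "j < n" for i j
    using A that by (metis carrier_matD index_transpose_mat(1))
  ultimately obtain R d where R: "R \<in> carrier_mat n n" "A = transpose_mat R * diag n d * R"
    using LDL_decomposition[OF A(1)] by blast
  let ?V = "mat n n (\<lambda>(i, j). csqrt (d i) * R $$ (i, j))"
  have "A = transpose_mat ?V * ?V"
  proof (rule eq_matI)
    fix i j assume "i < dim_row (transpose_mat ?V * ?V)" "j < dim_col (transpose_mat ?V * ?V)"
    then have ij: "i < n" "j < n" by auto
    have "A $$ (i, j) = (\<Sum>l<n. R $$ (l, i) * d l * R $$ (l, j))"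
      unfolding R(2) by (rule index_congruent_diag[OF R(1) ij])
    also have "\<dots> = (\<Sum>l<n. csqrt (d l) * R $$ (l, i) * (csqrt (d l) * R $$ (l, j)))"
    proof (rule sum.cong[OF refl])
      fix l
      have "csqrt (d l) * csqrt (d l) = d l"
        using power2_csqrt[of "d l"] by (simp only: power2_eq_square)
      moreover have "csqrt (d l) * R $$ (l, i) * (csqrt (d l) * R $$ (l, j))
          = csqrt (d l) * csqrt (d l) * R $$ (l, i) * R $$ (l, j)" by (simp only: mult_ac)
      ultimately show "R $$ (l, i) * d l * R $$ (l, j)
          = csqrt (d l) * R $$ (l, i) * (csqrt (d l) * R $$ (l, j))" by (simp only: mult_ac)
    qed
    also have "\<dots> = (transpose_mat ?V * ?V) $$ (i, j)"
      using ij by (auto simp: scalar_prod_def atLeast0LessThan intro!: sum.cong)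
    finally show "A $$ (i, j) = (transpose_mat ?V * ?V) $$ (i, j)" .
  qed (use A in auto)
  then show ?thesis by (intro bexI[of _ ?V]) auto
qed

section \<open>Translates with nonzero leading coordinates\<close>

definition line :: "nat \<Rightarrow> complex mat \<Rightarrow> complex mat \<Rightarrow> complex \<Rightarrow> complex mat" where
  "line n g h s = mat n n (\<lambda>(i, j). (1 - s) * g $$ (i, j) + s * h $$ (i, j))"

lemma line_carrier [simp]: "line n g h s \<in> carrier_mat n n"
  by (simp add: line_def)

lemma line_0: "g \<in> carrier_mat n n \<Longrightarrow> line n g h 0 = g"
  and line_1: "h \<in> carrier_mat n n \<Longrightarrow> line n g h 1 = h"
  by (auto simp: line_def)

lemma poly_funs_line:
  "i < n \<Longrightarrow> j < n \<Longrightarrow> (\<lambda>s. line n g h s $$ (i, j)) \<in> poly_funs {\<lambda>s. s}"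
  by (simp add: line_def)
    (intro poly_funs.add poly_funs.mult poly_funs_diff poly_funs_id poly_funs.const)

text \<open>Irreducibility of the space of matrices in elementary form: on the line that joins a
  point good for \<open>I\<close> to a point good for \<open>a\<close>, every function involved is a
  nonzero polynomial and has finitely many zeros.\<close>

lemma common_nonzero:
  assumes "finite I"
    and "\<And>a g h. a \<in> I \<Longrightarrow> (\<lambda>s. \<phi> a (line n g h s)) \<in> poly_funs {\<lambda>s. s}"
    and "\<And>a. a \<in> I \<Longrightarrow> \<exists>g\<in>carrier_mat n n. \<phi> a g \<noteq> 0"
  shows "\<exists>g\<in>carrier_mat n n. \<forall>a\<in>I. \<phi> a g \<noteq> 0"
  using assms
proof (induction I rule: finite_induct)
  case empty
  then show ?case using one_carrier_mat by blast
next
  case (insert a I)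
  then obtain g where g: "g \<in> carrier_mat n n" "\<forall>b\<in>I. \<phi> b g \<noteq> 0" by auto
  obtain h where h: "h \<in> carrier_mat n n" "\<phi> a h \<noteq> 0" using insert.prems(2)[of a] by auto
  let ?f = "\<lambda>b s. \<phi> b (line n g h s)"
  have "finite {s. ?f b s = 0}" if b: "b \<in> insert a I" for b
  proof (cases "b = a")
    case True
    then show ?thesis using univariate_finite_zeros[of "?f b" 1] insert.prems(1)[OF b] h by (simp add: line_1)
  next
    case False
    then show ?thesis using univariate_finite_zeros[of "?f b" 0] insert.prems(1)[OF b] b g by (simp add: line_0)
  qed
  then have "finite (\<Union>b\<in>insert a I. {s. ?f b s = 0})" using insert.hyps(1) by blast
  then obtain s where "s \<notin> (\<Union>b\<in>insert a I. {s. ?f b s = 0})"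
    using ex_new_if_finite[OF infinite_UNIV_char_0] by metis
  then show ?case by (intro bexI[of _ "line n g h s"]) auto
qed

lemma cnj_det:
  assumes "M \<in> carrier_mat k k"
  shows "cnj (det M) = det (mat k k (\<lambda>(i, j). cnj (M $$ (i, j))))"
  using assms permutes_in_image[of _ "{0..<k}"]
  by (simp add: det_def'[of _ k] cnj_sum cnj_prod sign_def)

text \<open>If all leading coordinates of all translates of \<open>B\<close> vanish, then \<open>B\<close> is orthogonal, for the
  standard Hermitian form, to the compounds of all matrices \<open>V\<^sup>T V\<close>, hence to every component of
  every complete quadric, hence to itself.\<close>

lemma leading_coordinate_nonzero:
  assumes B: "frame n B" "pt n B \<in> complete_quadrics n" and k: "k \<in> {1..n-1}"
  shows "\<exists>g\<in>carrier_mat n n. congr n k g (B k) ({..<k}, {..<k}) \<noteq> 0"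
proof (rule ccontr)
  assume neg: "\<not> ?thesis"
  let ?K = "k_subsets n k"
  have kn: "{..<k} \<in> ?K" using k by auto
  \<comment> \<open>The pairing with the conjugate of \<open>B k\<close>, linear in the factor
    number \<open>k\<close>; its value at \<open>B\<close> itself is a sum of squared absolute
    values.\<close>
  define l where "l v = (\<Sum>S\<in>?K. \<Sum>T\<in>?K. v k (S, T) * cnj (B k (S, T)))" for v :: "nat \<Rightarrow> set_mat"
  have "l \<in> poly_funs (coords n)" unfolding l_def
    by (intro poly_funs_sum poly_funs.mult poly_funs.const coordsI k) auto
  moreover have "l (\<lambda>j x. c j * v j x) = (\<Prod>j=1..n-1. c j ^ (if j = k then 1 else 0)) * l v" for c v
  proof -
    have "(\<Prod>j=1..n-1. c j ^ (if j = k then 1 else 0)) = (\<Prod>j=1..n-1. if j = k then c j else 1)"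
      by (intro prod.cong) auto
    also have "\<dots> = c k" using k by simp
    finally show ?thesis by (simp add: l_def sum_distrib_left mult.assoc)
  qed
  ultimately have l: "l \<in> multihom_polys n"
    unfolding multihom_polys_alt mem_Collect_eq by (intro conjI exI[of _ "\<lambda>j. if j = k then 1 else 0"]) auto
  have square: "l (\<lambda>k. compound n k (transpose_mat V * V)) = 0" if V: "V \<in> carrier_mat n n" for V
  proof -
    have VT: "transpose_mat V \<in> carrier_mat n n" using V by simp
    have zero: "(\<Sum>S\<in>?K. \<Sum>T\<in>?K. compound n k V (Z, S) * cnj (B k (S, T)) * compound n k V (Z, T)) = 0"
      if Z: "Z \<in> ?K" for Z
    proof -
      \<comment> \<open>The conjugates of the rows \<open>Z\<close> of \<open>V\<close> become the
        first \<open>k\<close> columns of \<open>g\<close>. The leading coordinate of the translate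
        by \<open>g\<close> is then the conjugate of the sum that has to vanish.\<close>
      define g where "g = mat n n (\<lambda>(i, c). if c < k then cnj (V $$ (pick Z c, i)) else 0)"
      have g: "g \<in> carrier_mat n n" by (simp add: g_def)
      have "compound n k g (S, {..<k}) = cnj (compound n k V (Z, S))" if S: "S \<in> ?K" for S
      proof -
        have "compound n k g (S, {..<k}) = det (mat k k (\<lambda>(i, j). cnj (V $$ (pick Z j, pick S i))))"
          using S kn g by (simp add: compound_eq_det, intro arg_cong[of _ _ det] eq_matI)
            (use pick_k_subsets[OF S] k in \<open>auto simp: g_def pick_lessThan\<close>)
        also have "\<dots> = det (mat k k (\<lambda>(i, j). cnj (V $$ (pick Z i, pick S j))))"
          by (subst det_transpose[of _ k, symmetric]) (auto intro!: arg_cong[of _ _ det] eq_matI)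
        also have "\<dots> = cnj (det (mat k k (\<lambda>(i, j). V $$ (pick Z i, pick S j))))"
          by (subst cnj_det[of _ k]) (auto intro!: arg_cong[of _ _ det] eq_matI)
        finally show ?thesis using V Z S by (simp add: compound_eq_det)
      qed
      then have "congr n k g (B k) ({..<k}, {..<k})
          = (\<Sum>S\<in>?K. \<Sum>T\<in>?K. cnj (compound n k V (Z, S)) * B k (S, T) * cnj (compound n k V (Z, T)))"
        unfolding congr_def prod.case by (intro sum.cong refl) simp
      then have "(\<Sum>S\<in>?K. \<Sum>T\<in>?K. cnj (compound n k V (Z, S)) * B k (S, T) * cnj (compound n k V (Z, T))) = 0"
        using neg g by auto
      then have "cnj (\<Sum>S\<in>?K. \<Sum>T\<in>?K. cnj (compound n k V (Z, S)) * B k (S, T) * cnj (compound n k V (Z, T))) = 0"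
        by simp
      then show ?thesis by (simp add: cnj_sum)
    qed
    have "l (\<lambda>k. compound n k (transpose_mat V * V))
        = (\<Sum>S\<in>?K. \<Sum>T\<in>?K. \<Sum>Z\<in>?K. compound n k V (Z, S) * cnj (B k (S, T)) * compound n k V (Z, T))"
      unfolding l_def using compound_mult[OF VT V, of k]
      by (simp add: compound_transpose[OF V] sum_distrib_left sum_distrib_right mult_ac)
    also have "\<dots> = (\<Sum>S\<in>?K. \<Sum>Z\<in>?K. \<Sum>T\<in>?K. compound n k V (Z, S) * cnj (B k (S, T)) * compound n k V (Z, T))"
      by (rule sum.cong[OF refl], rule sum.swap)
    also have "\<dots> = (\<Sum>Z\<in>?K. \<Sum>S\<in>?K. \<Sum>T\<in>?K. compound n k V (Z, S) * cnj (B k (S, T)) * compound n k V (Z, T))"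
      by (rule sum.swap)
    finally show ?thesis using zero by simp
  qed
  have "l (\<lambda>k. compound n k A) = 0" if A: "A \<in> carrier_mat n n" "transpose_mat A = A" for A
  proof -
    \<comment> \<open>On the line from \<open>A\<close> to the identity almost all matrices have
      nonzero leading minors and so have the form \<open>V\<^sup>T V\<close>; the polynomial in
      \<open>s\<close> then vanishes at the end point \<open>A\<close> as well.\<close>
    let ?A = "line n A (1\<^sub>m n)"
    have poly: "(\<lambda>s. compound n m (?A s) (S, T)) \<in> poly_funs {\<lambda>s. s}" for m S T
      by (intro poly_funs_compound poly_funs_line line_carrier)
    have fin: "finite {s. compound n m (?A s) ({..<m}, {..<m}) = 0}" if "m \<in> {1..n-1}" for m
      by (rule univariate_finite_zeros[OF poly, where s = 1])
        (use that in \<open>auto simp: line_1 compound_one\<close>)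
    have "l (\<lambda>k. compound n k (?A s)) = 0"
      if s: "s \<notin> (\<Union>m\<in>{1..n-1}. {s. compound n m (?A s) ({..<m}, {..<m}) = 0})" for s
    proof -
      have "A $$ (i, j) = A $$ (j, i)" if "i < n" "j < n" for i j
        using A that by (metis carrier_matD index_transpose_mat(1))
      then have "transpose_mat (?A s) = ?A s" by (intro eq_matI) (auto simp: line_def)
      then obtain V where "V \<in> carrier_mat n n" "?A s = transpose_mat V * V"
        using symmetric_square[of "?A s" n] s by auto
      then show ?thesis using square by metis
    qed
    then have "UNIV - (\<Union>m\<in>{1..n-1}. {s. compound n m (?A s) ({..<m}, {..<m}) = 0})
        \<subseteq> {s. l (\<lambda>k. compound n k (?A s)) = 0}" by blast
    moreover have "infinite (UNIV - (\<Union>m\<in>{1..n-1}. {s. compound n m (?A s) ({..<m}, {..<m}) = 0}))"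
      using fin by (intro Diff_infinite_finite infinite_UNIV_char_0) blast
    ultimately have "infinite {s. l (\<lambda>k. compound n k (?A s)) = 0}" using infinite_super by blast
    moreover have "(\<lambda>s. l (\<lambda>k. compound n k (?A s))) \<in> poly_funs {\<lambda>s. s}"
      unfolding l_def by (intro poly_funs_sum poly_funs.mult poly_funs.const poly) auto
    ultimately have "l (\<lambda>k. compound n k (?A 0)) = 0" using univariate_eq_0 by fast
    then show ?thesis by (simp add: line_0[OF A(1)])
  qed
  then have "l D = 0" if "frame n D" "pt n D \<in> nondegenerate_quadrics n" for D
    using that vanishes_at_pt[OF l] unfolding nondegenerate_quadrics_eq
    by (smt (verit) GL_carrier mem_Collect_eq)
  then have "l B = 0"
    using pt_in_closureD[OF nondegenerate_quadrics_ambient _ l] B(2) unfolding complete_quadrics_def by blast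
  then have "(\<Sum>S\<in>?K. \<Sum>T\<in>?K. complex_of_real ((cmod (B k (S, T)))\<^sup>2)) = 0"
    by (simp only: l_def complex_norm_square)
  then have "complex_of_real (\<Sum>S\<in>?K. \<Sum>T\<in>?K. (cmod (B k (S, T)))\<^sup>2) = 0"
    by (simp only: of_real_sum)
  then have "(\<Sum>S\<in>?K. \<Sum>T\<in>?K. (cmod (B k (S, T)))\<^sup>2) = 0" by (simp only: of_real_eq_0_iff)
  then have "B k (S, T) = 0" if "S \<in> ?K" "T \<in> ?K" for S T
    using that by (simp add: sum_nonneg_eq_0_iff sum_nonneg)
  then have "B k = (\<lambda>_. 0)"
    using supportedD[OF frame_supported[OF B(1) k]] by fastforce
  then show False using B(1) k by (simp add: frame_def)
qed

lemma leading_coordinates_nonzero: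
  assumes B: "frame n B" "pt n B \<in> complete_quadrics n"
  shows "\<exists>g\<in>GL n. \<forall>k\<in>{1..n-1}. congr n k g (B k) ({..<k}, {..<k}) \<noteq> 0"
proof -
  \<comment> \<open>The index \<open>0\<close> carries the determinant, so that the common choice of
    \<open>g\<close> is also invertible.\<close>
  define \<phi> where "\<phi> k g = (if k = 0 then det g else congr n k g (B k) ({..<k}, {..<k}))" for k g
  have "\<exists>g\<in>carrier_mat n n. \<forall>k\<in>{0..n-1}. \<phi> k g \<noteq> 0"
  proof (rule common_nonzero)
    show "(\<lambda>s. \<phi> k (line n g h s)) \<in> poly_funs {\<lambda>s. s}" for k g h
      unfolding \<phi>_def by (intro poly_funs_if poly_funs_det[of _ n] poly_funs_congr poly_funs.const
          poly_funs_line line_carrier)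
    show "\<exists>g\<in>carrier_mat n n. \<phi> k g \<noteq> 0" if "k \<in> {0..n-1}" for k
      using leading_coordinate_nonzero[OF B, of k] that one_carrier_mat[of n]
      by (cases "k = 0") (auto simp: \<phi>_def intro!: bexI[of _ "1\<^sub>m n"])
  qed simp
  then obtain g where g: "g \<in> carrier_mat n n" "\<forall>k\<in>{0..n-1}. \<phi> k g \<noteq> 0" by blast
  have "g \<in> GL n" using g(1) g(2)[rule_format, of 0] by (simp add: GL_def \<phi>_def)
  moreover have "congr n k g (B k) ({..<k}, {..<k}) \<noteq> 0" if "k \<in> {1..n-1}" for k
    using g(2)[rule_format, of k] that by (simp add: \<phi>_def)
  ultimately show ?thesis by blast
qed

section \<open>The affine chart and the extension of polynomial identities\<close>

definition lead :: "(nat \<Rightarrow> set_mat) \<Rightarrow> nat \<Rightarrow> complex" where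
  "lead v k = v k ({..<k}, {..<k})"

definition normalized :: "(nat \<Rightarrow> set_mat) \<Rightarrow> nat \<Rightarrow> set_mat" where
  "normalized v = (\<lambda>k x. v k x / lead v k)"

lemma poly_funs_lead: "k \<in> {1..n-1} \<Longrightarrow> (\<lambda>v. lead v k) \<in> poly_funs (coords n)"
  unfolding lead_def by (rule coordsI) auto

lemma multihom_mult:
  assumes "f \<in> multihom_polys n" "g \<in> multihom_polys n"
  shows "(\<lambda>v. f v * g v) \<in> multihom_polys n"
proof -
  obtain d e where "\<forall>c v. f (\<lambda>k x. c k * v k x) = (\<Prod>k=1..n-1. c k ^ d k) * f v"
    "\<forall>c v. g (\<lambda>k x. c k * v k x) = (\<Prod>k=1..n-1. c k ^ e k) * g v"
    using assms by (auto simp: multihom_polys_alt)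
  then show ?thesis using assms
    by (auto simp: multihom_polys_alt poly_funs.mult power_add prod.distrib intro!: exI[of _ "\<lambda>k. d k + e k"])
qed

lemma multihom_lead_monomial:
  "(\<lambda>v. \<Prod>k=1..n-1. lead v k ^ d k) \<in> multihom_polys n"
proof -
  have "(\<lambda>v. \<Prod>k=1..n-1. lead v k ^ d k) \<in> poly_funs (coords n)"
    by (intro poly_funs_prod poly_funs_power poly_funs_lead) auto
  then show ?thesis
    by (auto simp: multihom_polys_alt lead_def power_mult_distrib prod.distrib intro!: exI[of _ d])
qed

text \<open>Clearing denominators. In a sum the two degrees may differ, and each summand is
  multiplied by the monomial in the leading coordinates that the other one requires.\<close>

lemma homogenization:
  assumes "f \<in> poly_funs (coords n)"
  shows "\<exists>F d. F \<in> poly_funs (coords n) \<and>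
    (\<forall>c v. F (\<lambda>k x. c k * v k x) = (\<Prod>k=1..n-1. c k ^ d k) * F v) \<and>
    (\<forall>v. (\<forall>k\<in>{1..n-1}. lead v k \<noteq> 0) \<longrightarrow> F v = (\<Prod>k=1..n-1. lead v k ^ d k) * f (normalized v))"
  using assms
proof induction
  case (const c)
  then show ?case by (intro exI[of _ "\<lambda>_. c"] exI[of _ "\<lambda>_. 0"]) (auto intro: poly_funs.const)
next
  case (coord f)
  then obtain k S T where f: "f = (\<lambda>v. v k (S, T))" and k: "k \<in> {1..n-1}" by (auto simp: coords_def)
  have "(\<Prod>j=1..n-1. c j ^ (if j = k then 1 else 0)) = c k" for c :: "nat \<Rightarrow> complex"
  proof -
    have "(\<Prod>j=1..n-1. c j ^ (if j = k then 1 else 0)) = (\<Prod>j=1..n-1. if j = k then c j else 1)"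
      by (intro prod.cong) auto
    then show ?thesis using k by simp
  qed
  then show ?case using poly_funs.coord[OF coord] k
    by (intro exI[of _ f] exI[of _ "\<lambda>j. if j = k then 1 else 0"]) (auto simp: f normalized_def)
next
  case (add f g)
  from add.IH(1) obtain F d where F0: "F \<in> poly_funs (coords n)"
    "\<forall>c v. F (\<lambda>k x. c k * v k x) = (\<Prod>k=1..n-1. c k ^ d k) * F v"
    "\<forall>v. (\<forall>k\<in>{1..n-1}. lead v k \<noteq> 0) \<longrightarrow> F v = (\<Prod>k=1..n-1. lead v k ^ d k) * f (normalized v)"
    by (elim exE conjE)
  note F = F0(1) F0(2)[rule_format] F0(3)[THEN spec, THEN mp]
  from add.IH(2) obtain G e where G0: "G \<in> poly_funs (coords n)"
    "\<forall>c v. G (\<lambda>k x. c k * v k x) = (\<Prod>k=1..n-1. c k ^ e k) * G v"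
    "\<forall>v. (\<forall>k\<in>{1..n-1}. lead v k \<noteq> 0) \<longrightarrow> G v = (\<Prod>k=1..n-1. lead v k ^ e k) * g (normalized v)"
    by (elim exE conjE)
  note G = G0(1) G0(2)[rule_format] G0(3)[THEN spec, THEN mp]
  let ?H = "\<lambda>v. F v * (\<Prod>k=1..n-1. lead v k ^ e k) + G v * (\<Prod>k=1..n-1. lead v k ^ d k)"
  have L: "lead (\<lambda>k x. c k * v k x) k = c k * lead v k" for c v k by (simp add: lead_def)
  have H: "?H \<in> poly_funs (coords n)"
    by (intro poly_funs.add poly_funs.mult F(1) G(1) poly_funs_prod poly_funs_power poly_funs_lead) auto
  show ?case
  proof (intro exI[of _ ?H] exI[of _ "\<lambda>k. d k + e k"] conjI allI impI H)
    fix c v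
    show "?H (\<lambda>k x. c k * v k x) = (\<Prod>k=1..n-1. c k ^ (d k + e k)) * ?H v"
      unfolding F(2) G(2) L power_mult_distrib prod.distrib power_add distrib_left by (simp only: mult_ac)
  next
    fix v assume v: "\<forall>k\<in>{1..n-1}. lead v k \<noteq> 0"
    show "?H v = (\<Prod>k=1..n-1. lead v k ^ (d k + e k)) * (f (normalized v) + g (normalized v))"
      unfolding F(3)[OF v] G(3)[OF v] prod.distrib power_add distrib_left by (simp only: mult_ac)
  qed
next
  case (mult f g)
  from mult.IH(1) obtain F d where F0: "F \<in> poly_funs (coords n)"
    "\<forall>c v. F (\<lambda>k x. c k * v k x) = (\<Prod>k=1..n-1. c k ^ d k) * F v"
    "\<forall>v. (\<forall>k\<in>{1..n-1}. lead v k \<noteq> 0) \<longrightarrow> F v = (\<Prod>k=1..n-1. lead v k ^ d k) * f (normalized v)"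
    by (elim exE conjE)
  note F = F0(1) F0(2)[rule_format] F0(3)[THEN spec, THEN mp]
  from mult.IH(2) obtain G e where G0: "G \<in> poly_funs (coords n)"
    "\<forall>c v. G (\<lambda>k x. c k * v k x) = (\<Prod>k=1..n-1. c k ^ e k) * G v"
    "\<forall>v. (\<forall>k\<in>{1..n-1}. lead v k \<noteq> 0) \<longrightarrow> G v = (\<Prod>k=1..n-1. lead v k ^ e k) * g (normalized v)"
    by (elim exE conjE)
  note G = G0(1) G0(2)[rule_format] G0(3)[THEN spec, THEN mp]
  show ?case
  proof (intro exI[of _ "\<lambda>v. F v * G v"] exI[of _ "\<lambda>k. d k + e k"] conjI allI impI poly_funs.mult F(1) G(1))
    fix c v
    show "F (\<lambda>k x. c k * v k x) * G (\<lambda>k x. c k * v k x) = (\<Prod>k=1..n-1. c k ^ (d k + e k)) * (F v * G v)"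
      unfolding F(2) G(2) prod.distrib power_add by (simp only: mult_ac)
  next
    fix v assume v: "\<forall>k\<in>{1..n-1}. lead v k \<noteq> 0"
    show "F v * G v = (\<Prod>k=1..n-1. lead v k ^ (d k + e k)) * (f (normalized v) * g (normalized v))"
      unfolding F(3)[OF v] G(3)[OF v] prod.distrib power_add by (simp only: mult_ac)
  qed
qed

text \<open>The homogenized polynomial vanishes on nondegenerate quadrics, hence on their closure,
  and inside the chart it can be divided by the leading coordinates again.\<close>

lemma chart_identity:
  assumes f: "f \<in> poly_funs (coords n)"
    and vanish: "\<And>A. A \<in> GL n \<Longrightarrow> transpose_mat A = A \<Longrightarrow>
      (\<And>k. k \<in> {1..n-1} \<Longrightarrow> compound n k A ({..<k}, {..<k}) \<noteq> 0) \<Longrightarrow>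
      f (normalized (\<lambda>k. compound n k A)) = 0"
    and B: "pt n B \<in> complete_quadrics n" "\<And>k. k \<in> {1..n-1} \<Longrightarrow> lead B k \<noteq> 0"
  shows "f (normalized B) = 0"
proof -
  obtain F d where F: "F \<in> multihom_polys n"
    "\<And>v. (\<forall>k\<in>{1..n-1}. lead v k \<noteq> 0) \<Longrightarrow> F v = (\<Prod>k=1..n-1. lead v k ^ d k) * f (normalized v)"
    using homogenization[OF f] unfolding multihom_polys_alt by blast
  \<comment> \<open>The additional factor makes the product vanish at nondegenerate quadrics outside
    the chart too, where \<open>F\<close> is not controlled.\<close>
  let ?G = "\<lambda>v. (\<Prod>k=1..n-1. lead v k ^ 1) * F v"
  have G: "?G \<in> multihom_polys n" by (rule multihom_mult[OF multihom_lead_monomial F(1)])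
  have "?G B = 0"
  proof (rule pt_in_closureD[OF nondegenerate_quadrics_ambient B(1)[unfolded complete_quadrics_def] G])
    fix D assume "pt n D \<in> nondegenerate_quadrics n"
    then obtain A where A: "A \<in> GL n" "transpose_mat A = A" "pt n (\<lambda>k. compound n k A) = pt n D"
      unfolding nondegenerate_quadrics_eq by auto
    show "?G D = 0"
    proof (cases "\<forall>k\<in>{1..n-1}. lead D k \<noteq> 0")
      case True
      have c: "\<exists>c. c \<noteq> 0 \<and> D k = (\<lambda>x. c * compound n k A x)" if "k \<in> {1..n-1}" for k
        using A(3) that unfolding pt_eq_iff by blast
      have nz: "compound n k A ({..<k}, {..<k}) \<noteq> 0" if "k \<in> {1..n-1}" for k
        using c[OF that] bspec[OF True that] by (auto simp: lead_def)
      have "normalized D k = normalized (\<lambda>k. compound n k A) k" if "k \<in> {1..n-1}" for k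
        using c[OF that] by (auto simp: normalized_def lead_def)
      then have "f (normalized D) = f (normalized (\<lambda>k. compound n k A))"
        by (intro poly_funs_cong[OF f]) (auto simp: coords_def)
      then show ?thesis using vanish[OF A(1,2) nz] F(2)[OF True] by simp
    next
      case False
      then have "(\<Prod>k=1..n-1. lead D k ^ 1) = 0" by (intro prod_zero) auto
      then show ?thesis by simp
    qed
  qed
  moreover have "(\<Prod>k=1..n-1. lead B k ^ 1) \<noteq> 0" "(\<Prod>k=1..n-1. lead B k ^ d k) \<noteq> 0"
    using B(2) by (auto simp: prod_zero_iff)
  ultimately show ?thesis using F(2) B(2) by auto
qed

lemma compound_unitriangular:
  assumes R: "R \<in> carrier_mat n n" "unitriangular R" and k: "k \<le> n"
  shows "compound n k R (S, {..<k}) = (if S = {..<k} then 1 else 0)"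
proof (cases "S = {..<k}")
  case True
  have "unitriangular (mat k k (\<lambda>(i, j). R $$ (i, j)))"
    using R k by (auto simp: unitriangular_def)
  then show ?thesis using True R k det_unitriangular[of "mat k k (\<lambda>(i, j). R $$ (i, j))" k]
    by (simp add: compound_leading)
next
  case False
  have "compound n k R (S, {..<k}) = 0"
  proof (rule ccontr)
    assume "compound n k R (S, {..<k}) \<noteq> 0"
    then obtain p where S: "S \<in> k_subsets n k" and p: "bij_betw p S {..<k}"
      "\<And>i. i \<in> S \<Longrightarrow> R $$ (i, p i) \<noteq> 0"
      using compound_nonzeroE[OF R(1)] by metis
    have "S \<subseteq> {..<k}"
    proof
      fix i assume i: "i \<in> S"
      then have "i < n" "p i < k" using k_subsetsD(1)[OF S] p(1) by (auto simp: bij_betw_def)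
      moreover have "\<not> p i < i" using p(2)[OF i] R \<open>i < n\<close> unfolding unitriangular_def by auto
      ultimately show "i \<in> {..<k}" by simp
    qed
    then have "S = {..<k}" using k_subsetsD[OF S] by (intro card_subset_eq) auto
    then show False using False by simp
  qed
  then show ?thesis using False by simp
qed

lemma pick_insert_last:
  assumes "i \<le> j" "a \<le> i"
  shows "pick (insert j {..<i}) a = (if a < i then a else j)"
proof (cases "a < i")
  case True
  then have "{x \<in> insert j {..<i}. x < a} = {..<a}" using assms by auto
  then show ?thesis using pick_card_in_set[of a "insert j {..<i}"] True by simp
next
  case False
  have "{x \<in> insert j {..<i}. x < j} = {..<i}" using assms by auto
  then show ?thesis using pick_card_in_set[of j "insert j {..<i}"] False assms by simp
qed

lemma insert_k_subsets: "i \<le> j \<Longrightarrow> j < n \<Longrightarrow> insert j {..<i} \<in> k_subsets n (Suc i)"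
  by (auto simp: k_subsets_def)

text \<open>The columns \<open>0, ..., i - 1\<close> and \<open>j\<close> in the first
  \<open>i + 1\<close> rows form a triangular matrix with diagonal
  \<open>1, ..., 1, R (i, j)\<close>. This is how entries of \<open>R\<close> become visible in the
  compounds.\<close>

lemma compound_unitriangular_entry:
  assumes R: "R \<in> carrier_mat n n" "unitriangular R" and ij: "i < j" "j < n"
  shows "compound n (Suc i) R ({..<Suc i}, insert j {..<i}) = R $$ (i, j)"
proof -
  let ?M = "mat (Suc i) (Suc i) (\<lambda>(a, b). R $$ (a, if b < i then b else j))"
  have "mat (Suc i) (Suc i) (\<lambda>(a, b). R $$ (pick {..<Suc i} a, pick (insert j {..<i}) b)) = ?M"
    using ij by (intro eq_matI) (auto simp: pick_lessThan pick_insert_last simp del: pick.simps)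
  then have "compound n (Suc i) R ({..<Suc i}, insert j {..<i}) = det ?M"
    using R ij insert_k_subsets[of i j n] by (simp add: compound_eq_det del: pick.simps)
  also have "\<dots> = prod_list (diag_mat ?M)"
    by (rule det_upper_triangular[of _ "Suc i"]) (use R ij in \<open>auto simp: unitriangular_def\<close>)
  also have "\<dots> = (\<Prod>a<Suc i. R $$ (a, if a < i then a else j))"
    by (simp add: diag_mat_def prod.list_conv_set_nth atLeast0LessThan del: upt_Suc prod.lessThan_Suc)
  also have "\<dots> = R $$ (i, j)" using R ij by (simp add: unitriangular_def)
  finally show ?thesis .
qed

text \<open>Every \<open>d i\<close> is \<open>d 0\<close> times the ratios
  \<open>d m / d (m - 1)\<close> with \<open>1 \<le> m \<le> i\<close>, so the ratio number
  \<open>m\<close> occurs once for each element of \<open>S\<close> that is at least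
  \<open>m\<close>.\<close>

lemma prod_chain:
  fixes d :: "nat \<Rightarrow> complex"
  assumes d: "\<And>i. i < n \<Longrightarrow> d i \<noteq> 0" and S: "S \<subseteq> {..<n}"
  shows "prod d S = d 0 ^ card S * (\<Prod>m=1..n-1. (d m / d (m - 1)) ^ card {i \<in> S. m \<le> i})"
proof -
  have fin: "finite S" using S finite_subset by blast
  have tele: "d i = d 0 * (\<Prod>m=1..i. d m / d (m - 1))" if "i < n" for i
    using that
  proof (induction i)
    case (Suc i)
    then show ?case using d[of i] by simp
  qed simp
  have "d i = d 0 * (\<Prod>m=1..n-1. if m \<le> i then d m / d (m - 1) else 1)" if i: "i \<in> S" for i
  proof -
    have "i < n" using S i by auto
    then have "{1..n-1} \<inter> {m. m \<le> i} = {1..i}" by auto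
    then show ?thesis using tele[of i] S i by (auto simp: prod.If_cases)
  qed
  then have "prod d S = (\<Prod>i\<in>S. d 0 * (\<Prod>m=1..n-1. if m \<le> i then d m / d (m - 1) else 1))"
    by (intro prod.cong) auto
  also have "\<dots> = d 0 ^ card S * (\<Prod>m=1..n-1. \<Prod>i\<in>S. if m \<le> i then d m / d (m - 1) else 1)"
    by (simp add: prod.distrib prod.swap[of _ S])
  also have "(\<Prod>m=1..n-1. \<Prod>i\<in>S. if m \<le> i then d m / d (m - 1) else 1)
      = (\<Prod>m=1..n-1. (d m / d (m - 1)) ^ card {i \<in> S. m \<le> i})"
    using fin by (intro prod.cong) (auto simp: prod.If_cases Int_def)
  finally show ?thesis .
qed

text \<open>The coordinates \<open>t\<close> are the ratios of consecutive entries of the diagonal matrix in the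
  decomposition \<open>R\<^sup>T D R\<close> of a quadric.\<close>

definition diag_frame :: "nat \<Rightarrow> (nat \<Rightarrow> complex) \<Rightarrow> nat \<Rightarrow> set_mat" where
  "diag_frame n t k = (\<lambda>(S, T). if S = T \<and> S \<in> k_subsets n k
     then \<Prod>m=1..n-1. t m ^ (card {i \<in> S. m \<le> i} - card {i \<in> {..<k}. m \<le> i}) else 0)"

text \<open>After normalization, the leading row of a compound of \<open>R\<^sup>T D R\<close> is
  the leading row of the compound of \<open>R\<close>, and single entries of \<open>R\<close> can be
  read off there. The formula is polynomial in the coordinates, so it makes sense at degenerate
  points.\<close>

definition chart_R :: "nat \<Rightarrow> (nat \<Rightarrow> set_mat) \<Rightarrow> complex mat" where
  "chart_R n v = mat n n (\<lambda>(i, j). if j < i then 0 else if i = j then 1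
     else v (Suc i) ({..<Suc i}, insert j {..<i}))"

text \<open>Undoing \<open>R\<close> leaves the compounds of \<open>D\<close>. The chosen index set
  arises from \<open>{..<m}\<close> by exchanging \<open>m - 1\<close> for \<open>m\<close>, which
  yields the ratio of two consecutive entries of \<open>D\<close>. The adjugate serves as a
  polynomial inverse.\<close>

definition chart_t :: "nat \<Rightarrow> (nat \<Rightarrow> set_mat) \<Rightarrow> nat \<Rightarrow> complex" where
  "chart_t n v m = congr n m (adj_mat (chart_R n v)) (v m) (insert m {..<m-1}, insert m {..<m-1})"

lemma chart_R_carrier [simp]: "chart_R n v \<in> carrier_mat n n"
  by (simp add: chart_R_def)

lemma chart_R_unitriangular: "unitriangular (chart_R n v)"
  by (auto simp: chart_R_def unitriangular_def)

lemma adj_unitriangular: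
  assumes "R \<in> carrier_mat n n" "unitriangular R"
  shows "adj_mat R \<in> GL n" "adj_mat R * R = 1\<^sub>m n" "R * adj_mat R = 1\<^sub>m n"
proof -
  have 1: "adj_mat R \<in> carrier_mat n n" "adj_mat R * R = 1\<^sub>m n" "R * adj_mat R = 1\<^sub>m n"
    using adj_mat[OF assms(1)] det_unitriangular[OF assms] by auto
  then have "det (adj_mat R) * det R = 1" using det_mult[OF 1(1) assms(1)] by simp
  then show "adj_mat R \<in> GL n" using 1 by (auto simp: GL_def)
  show "adj_mat R * R = 1\<^sub>m n" "R * adj_mat R = 1\<^sub>m n" using 1 by auto
qed

lemma poly_funs_adj:
  assumes "\<And>v. M v \<in> carrier_mat n n"
    and "\<And>i j. i < n \<Longrightarrow> j < n \<Longrightarrow> (\<lambda>v. M v $$ (i, j)) \<in> poly_funs C"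
    and ij: "i < n" "j < n"
  shows "(\<lambda>v. adj_mat (M v) $$ (i, j)) \<in> poly_funs C"
proof -
  have dims: "dim_row (M v) = n" "dim_col (M v) = n" for v using assms(1)[of v] by auto
  have "(\<lambda>v. adj_mat (M v) $$ (i, j)) = (\<lambda>v. (-1) ^ (j + i) * det (mat_delete (M v) j i))"
    using ij by (auto simp: adj_mat_def cofactor_def dims)
  moreover have "(\<lambda>v. det (mat_delete (M v) j i)) \<in> poly_funs C"
  proof (rule poly_funs_det)
    show "mat_delete (M v) j i \<in> carrier_mat (n - 1) (n - 1)" for v
      by (rule mat_delete_carrier[OF assms(1)])
    show "(\<lambda>v. mat_delete (M v) j i $$ (a, b)) \<in> poly_funs C" if "a < n - 1" "b < n - 1" for a b
      using that by (auto simp: mat_delete_def dims intro!: assms(2))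
  qed
  ultimately show ?thesis by (auto intro: poly_funs.mult poly_funs.const)
qed

lemma chart_poly:
  shows poly_funs_chart_R: "i < n \<Longrightarrow> j < n \<Longrightarrow> (\<lambda>v. chart_R n v $$ (i, j)) \<in> poly_funs (coords n)"
    and poly_funs_chart_congr: "k \<in> {1..n-1} \<Longrightarrow>
      (\<lambda>v. congr n k (adj_mat (chart_R n v)) (v k) (S, T)) \<in> poly_funs (coords n)"
    and poly_funs_chart_t: "k \<in> {1..n-1} \<Longrightarrow> (\<lambda>v. chart_t n v k) \<in> poly_funs (coords n)"
proof -
  show R: "(\<lambda>v. chart_R n v $$ (i, j)) \<in> poly_funs (coords n)" if "i < n" "j < n" for i j
  proof (cases "i < j")
    case True
    then show ?thesis using that coordsI[of "Suc i" n "{..<Suc i}" "insert j {..<i}"] insert_k_subsets[of i j n]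
      by (simp add: chart_R_def)
  next
    case False
    then show ?thesis using that poly_funs.const[of 0] poly_funs.const[of 1]
      by (cases "i = j") (simp_all add: chart_R_def)
  qed
  show 2: "(\<lambda>v. congr n k (adj_mat (chart_R n v)) (v k) (S, T)) \<in> poly_funs (coords n)"
    if "k \<in> {1..n-1}" for k S T
    by (intro poly_funs_congr poly_funs_adj chart_R_carrier R coordsI that adj_mat(1)) auto
  show "(\<lambda>v. chart_t n v k) \<in> poly_funs (coords n)" if "k \<in> {1..n-1}"
    unfolding chart_t_def by (rule 2[OF that])
qed

text \<open>For a nondegenerate quadric the chart functions return the data of its decomposition.
  Both sides of the conclusion are polynomial in the affine coordinates, as the extension to
  degenerate points requires.\<close>

lemma chart_nondegenerate:
  assumes A: "A \<in> GL n" "transpose_mat A = A"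
    and lead: "\<And>k. k \<in> {1..n-1} \<Longrightarrow> compound n k A ({..<k}, {..<k}) \<noteq> 0"
    and k: "k \<in> {1..n-1}"
  defines "v \<equiv> normalized (\<lambda>k. compound n k A)"
  shows "congr n k (adj_mat (chart_R n v)) (v k) = diag_frame n (chart_t n v) k"
proof -
  have Ac: "A \<in> carrier_mat n n" using A by (auto simp: GL_def)
  have "det (mat k k (\<lambda>(i, j). A $$ (i, j))) \<noteq> 0" if "k < n" for k
    using that lead[of k] compound_leading[OF Ac, of k] by (cases k) auto
  moreover have "A $$ (i, j) = A $$ (j, i)" if "i < n" "j < n" for i j
    using A(2) Ac that by (metis carrier_matD index_transpose_mat(1))
  ultimately obtain R d where R: "R \<in> carrier_mat n n" "unitriangular R"
    and ARD: "A = transpose_mat R * diag n d * R"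
    using LDL_decomposition[OF Ac] by blast
  have RT: "transpose_mat R \<in> carrier_mat n n" using R by simp
  have "det A = det (diag n d)"
    unfolding ARD using det_mult[OF mult_carrier_mat[OF RT diag_carrier] R(1)]
      det_mult[OF RT diag_carrier] det_transpose[OF R(1)] det_unitriangular[OF R] by simp
  then have d: "d i \<noteq> 0" if "i < n" for i using A(1) that by (auto simp: GL_def det_diag)
  have comp: "compound n k A = congr n k R (compound n k (diag n d))" for k
    unfolding ARD by (rule congr_compound[OF R(1) diag_carrier, symmetric])
  \<comment> \<open>Triangularity of \<open>R\<close> leaves only the leading set as
    \<open>S'\<close>, and since the compound of a diagonal matrix is diagonal, \<open>T'\<close> is
    the same set.\<close>
  have row: "compound n k A ({..<k}, T) = prod d {..<k} * compound n k R ({..<k}, T)" if kn: "k \<le> n" for k T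
  proof -
    have "compound n k A ({..<k}, T) = (\<Sum>S'\<in>k_subsets n k. if S' = {..<k}
        then \<Sum>T'\<in>k_subsets n k. if T' = {..<k} then prod d {..<k} * compound n k R ({..<k}, T) else 0 else 0)"
      unfolding comp congr_def prod.case
      by (intro sum.cong refl)
        (auto simp: compound_unitriangular[OF R kn] diag_def compound_diagonal kn,
          simp add: kn if_distrib[of "\<lambda>x. x * _"] cong: if_cong)
    then show ?thesis by (simp add: kn)
  qed
  have lead_eq: "compound n k A ({..<k}, {..<k}) = prod d {..<k}" if "k \<le> n" for k
    using row[OF that] compound_unitriangular[OF R that] by simp
  have vk: "v k = (\<lambda>x. (1 / prod d {..<k}) * compound n k A x)" if "k \<le> n" for k
    by (auto simp: v_def normalized_def lead_def lead_eq[OF that])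
  have pnz: "prod d {..<k} \<noteq> 0" if "k \<le> n" for k using d that by (auto simp: prod_zero_iff)
  have "chart_R n v = R"
  proof (rule eq_matI)
    fix i j assume "i < dim_row R" "j < dim_col R"
    then have ij: "i < n" "j < n" using R by auto
    show "chart_R n v $$ (i, j) = R $$ (i, j)"
    proof (cases "i < j")
      case True
      have "v (Suc i) ({..<Suc i}, insert j {..<i}) = R $$ (i, j)"
        using pnz[of "Suc i"] True ij row[of "Suc i"] compound_unitriangular_entry[OF R True ij(2)]
        by (simp add: vk[of "Suc i"] del: prod.lessThan_Suc)
      then show ?thesis using True ij by (simp add: chart_R_def)
    next
      case False
      then show ?thesis using ij R by (auto simp: chart_R_def unitriangular_def)
    qed
  qed (use R in \<open>auto simp: chart_R_def\<close>)
  note adj = adj_unitriangular[OF R]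
  have coordinate: "congr n k (adj_mat (chart_R n v)) (v k) (S, T)
      = (if S = T \<and> S \<in> k_subsets n k then prod d S / prod d {..<k} else 0)" if kn: "k \<le> n" for k S T
  proof -
    have "congr n k (adj_mat (chart_R n v)) (v k) = (\<lambda>x. (1 / prod d {..<k}) *
        congr n k (adj_mat R) (congr n k R (compound n k (diag n d))) x)"
      unfolding vk[OF kn] congr_scale comp \<open>chart_R n v = R\<close> ..
    also have "\<dots> = (\<lambda>x. (1 / prod d {..<k}) * compound n k (diag n d) x)"
      using congr_inverse[OF R(1) GL_carrier[OF adj(1)] adj(3) supported_compound] by simp
    finally show ?thesis by (auto simp: diag_def compound_diagonal)
  qed
  have t: "chart_t n v m = d m / d (m - 1)" if m: "m \<in> {1..n-1}" for m
  proof -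
    obtain l where l: "m = Suc l" using m by (cases m) auto
    have "chart_t n v m = prod d (insert m {..<l}) / prod d {..<m}"
      using m coordinate[of m] insert_k_subsets[of l m n] by (auto simp: chart_t_def l)
    also have "\<dots> = d m / d l" using pnz[of l] m by (simp add: l)
    finally show ?thesis by (simp add: l)
  qed
  have "prod d S / prod d {..<k} = (\<Prod>m=1..n-1. chart_t n v m ^ (card {i \<in> S. m \<le> i} - card {i \<in> {..<k}. m \<le> i}))"
    if S: "S \<in> k_subsets n k" for S
  proof -
    have kn: "k \<le> n" using k by auto
    have r: "d m / d (m - 1) \<noteq> 0" if "m \<in> {1..n-1}" for m 
    proof -
      have "m < n" "m - 1 < n" using that by auto
      then show ?thesis using d by simp
    qed
    have "prod d S / prod d {..<k} = (\<Prod>m=1..n-1. (d m / d (m - 1)) ^ card {i \<in> S. m \<le> i})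
        / (\<Prod>m=1..n-1. (d m / d (m - 1)) ^ card {i \<in> {..<k}. m \<le> i})"
      using prod_chain[of n d S] prod_chain[of n d "{..<k}"] d d[of 0] k k_subsetsD[OF S] kn by simp
    also have "\<dots> = (\<Prod>m=1..n-1. (d m / d (m - 1)) ^ card {i \<in> S. m \<le> i}
        / (d m / d (m - 1)) ^ card {i \<in> {..<k}. m \<le> i})"
      by (simp add: prod_dividef)
    also have "\<dots> = (\<Prod>m=1..n-1. chart_t n v m ^ (card {i \<in> S. m \<le> i} - card {i \<in> {..<k}. m \<le> i}))"
    proof (rule prod.cong[OF refl])
      fix m assume m: "m \<in> {1..n-1}"
      show "(d m / d (m - 1)) ^ card {i \<in> S. m \<le> i} / (d m / d (m - 1)) ^ card {i \<in> {..<k}. m \<le> i}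
          = chart_t n v m ^ (card {i \<in> S. m \<le> i} - card {i \<in> {..<k}. m \<le> i})"
        unfolding t[OF m] by (rule power_diff[OF r[OF m] card_above(1)[OF S], symmetric])
    qed
    finally show ?thesis .
  qed
  note ratio = this
  have kn: "k \<le> n" using k by auto
  show ?thesis
  proof
    fix x :: "nat set \<times> nat set"
    obtain S T where x: "x = (S, T)" by fastforce
    show "congr n k (adj_mat (chart_R n v)) (v k) x = diag_frame n (chart_t n v) k x"
      unfolding x diag_frame_def prod.case coordinate[OF kn]
      by (rule if_cong[OF refl]) (use ratio in blast, rule refl)
  qed
qed

text \<open>Nonzero ratios are absorbed by scaling the coordinates; vanishing ones become the
  boundaries between blocks.\<close>

lemma diag_frame_base_point:
  "\<exists>g\<in>GL n. \<exists>K\<subseteq>{1..n-1}. pt n (diag_frame n t) = trp n g (base_point n K)"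
proof -
  define K where "K = {m \<in> {1..n-1}. t m \<noteq> 0}"
  \<comment> \<open>The square of \<open>\<gamma> i\<close> is the product of the nonzero ratios up
    to \<open>i\<close>, so scaling by \<open>\<gamma>\<close> turns a sum of squares into the
    diagonal form with these ratios.\<close>
  define \<gamma> where "\<gamma> i = csqrt (\<Prod>m\<in>K. if m \<le> i then t m else 1)" for i
  have K: "finite K" "K \<subseteq> {1..n-1}" by (auto simp: K_def)
  have "\<gamma> i \<noteq> 0" for i using K by (auto simp: \<gamma>_def K_def prod_zero_iff)
  then have g: "diag n \<gamma> \<in> GL n" by (rule diag_GL)
  have sq: "prod \<gamma> S * prod \<gamma> S = (\<Prod>m\<in>K. t m ^ card {i \<in> S. m \<le> i})" if S: "finite S" for S
  proof -
    have "prod \<gamma> S * prod \<gamma> S = (\<Prod>i\<in>S. (\<gamma> i)\<^sup>2)" by (simp add: prod.distrib power2_eq_square)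
    also have "\<dots> = (\<Prod>m\<in>K. \<Prod>i\<in>S. if m \<le> i then t m else 1)"
      by (simp add: \<gamma>_def prod.swap[of _ S])
    also have "\<dots> = (\<Prod>m\<in>K. t m ^ card {i \<in> S. m \<le> i})"
      using S by (intro prod.cong) (auto simp: prod.If_cases Int_def)
    finally show ?thesis .
  qed
  have "trp n (diag n \<gamma>) (base_point n K) = pt n (diag_frame n t)"
    unfolding base_point_def trp_pt pt_eq_iff
  proof
    fix k assume k: "k \<in> {1..n-1}"
    let ?c = "\<Prod>m\<in>K. t m ^ card {i \<in> {..<k}. m \<le> i}"
    have "?c \<noteq> 0" using K by (auto simp: K_def prod_zero_iff)
    have "diag_frame n t k (S, T) = (1 / ?c) * congr n k (diag n \<gamma>) (base n K k) (S, T)" for S T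
    proof (cases "S = T \<and> S \<in> k_subsets n k")
      case True
      then have S: "S \<in> k_subsets n k" by blast
      let ?e = "\<lambda>m. card {i \<in> S. m \<le> i} - card {i \<in> {..<k}. m \<le> i}"
      have "congr n k (diag n \<gamma>) (base n K k) (S, S) =
          (if adapted n K S then \<Prod>m\<in>K. t m ^ card {i \<in> S. m \<le> i} else 0)"
        using congr_diag[OF frame_supported[OF frame_base k]] sq[OF k_subsetsD(3)[OF S]] S
        by (simp add: base_def)
      moreover have "(\<Prod>m=1..n-1. t m ^ ?e m) = (if adapted n K S then \<Prod>m\<in>K. t m ^ ?e m else 0)"
      proof (cases "adapted n K S")
        case ad: True
        have "?e m = 0" if "m \<in> {1..n-1} - K" for m
          using card_above(2)[OF S, of m] ad that by (auto simp: adapted_def)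
        then show ?thesis using ad K(2) by (simp, intro prod.mono_neutral_right) auto
      next
        case False
        then obtain m where m: "m \<in> {1..n-1} - K" "\<not> (S \<subseteq> {..<m} \<or> {..<m} \<subseteq> S)"
          unfolding adapted_def by blast
        then have "?e m > 0" using card_above[OF S, of m] by linarith
        moreover have "t m = 0" using m(1) by (auto simp: K_def)
        ultimately have "(\<Prod>m=1..n-1. t m ^ ?e m) = 0"
          using m(1) by (intro prod_zero) (auto intro!: bexI[of _ m])
        then show ?thesis using False by simp
      qed
      moreover have "(\<Prod>m\<in>K. t m ^ ?e m) = (1 / ?c) * (\<Prod>m\<in>K. t m ^ card {i \<in> S. m \<le> i})"
      proof -
        have "(\<Prod>m\<in>K. t m ^ ?e m) = (\<Prod>m\<in>K. t m ^ card {i \<in> S. m \<le> i} / t m ^ card {i \<in> {..<k}. m \<le> i})"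
          by (intro prod.cong refl power_diff card_above(1)[OF S]) (auto simp: K_def)
        then show ?thesis by (simp add: prod_dividef)
      qed
      moreover have "T = S" using True by blast
      ultimately show ?thesis using S by (simp add: diag_frame_def)
    next
      case False
      then show ?thesis using congr_diag[OF frame_supported[OF frame_base k], of \<gamma> K S T]
        by (auto simp: diag_frame_def base_def)
    qed
    then show "\<exists>c. c \<noteq> 0 \<and> diag_frame n t k = (\<lambda>x. c * congr n k (diag n \<gamma>) (base n K k) x)"
      using \<open>?c \<noteq> 0\<close> by (intro exI[of _ "1 / ?c"]) auto
  qed
  then show ?thesis using g K(2) by metis
qed

text \<open>A translation moves the point into the chart, and the inverse of its triangular part
  then leaves a diagonal point. That this happens at degenerate points too is the extended chart
  identity.\<close>

theorem complete_quadric_normal_form: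
  assumes "p \<in> complete_quadrics n"
  obtains g K where "g \<in> GL n" "K \<subseteq> {1..n-1}" "p = trp n g (base_point n K)"
proof -
  obtain B where B: "p = pt n B" "frame n B"
    using assms complete_quadrics_ambient by (auto simp: ambient_eq)
  obtain h where h: "h \<in> GL n" "\<forall>k\<in>{1..n-1}. congr n k h (B k) ({..<k}, {..<k}) \<noteq> 0"
    using leading_coordinates_nonzero[OF B(2)] assms B(1) by blast
  define D where "D k = congr n k h (B k)" for k
  have D: "pt n D = trp n h p" "frame n D" "pt n D \<in> complete_quadrics n"
  proof -
    show 1: "pt n D = trp n h p" by (simp add: B(1) trp_pt D_def[abs_def])
    show "frame n D" unfolding D_def[abs_def] by (rule frame_congr[OF h(1) B(2)])
    show "pt n D \<in> complete_quadrics n"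
      unfolding 1 using complete_quadrics_GL_stable h(1) assms by (simp add: GL_stable_def)
  qed
  have lead: "lead D k \<noteq> 0" if "k \<in> {1..n-1}" for k using h(2) that by (simp add: lead_def D_def)
  let ?v = "normalized D"
  let ?W = "adj_mat (chart_R n ?v)"
  have chart: "congr n k ?W (?v k) (S, T) - diag_frame n (chart_t n ?v) k (S, T) = 0" 
    if k: "k \<in> {1..n-1}" for k S T
  proof (rule chart_identity[OF _ _ D(3) lead])
    show "(\<lambda>v. congr n k (adj_mat (chart_R n v)) (v k) (S, T) - diag_frame n (chart_t n v) k (S, T))
        \<in> poly_funs (coords n)"
      unfolding diag_frame_def prod.case
      by (intro poly_funs_diff poly_funs_chart_congr k poly_funs_if poly_funs_prod poly_funs_power
          poly_funs_chart_t poly_funs.const) auto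
  qed (use chart_nondegenerate k in auto)
  have "pt n D = pt n ?v"
    unfolding pt_eq_iff
  proof
    fix k assume "k \<in> {1..n-1}"
    then show "\<exists>c. c \<noteq> 0 \<and> ?v k = (\<lambda>x. c * D k x)"
      using lead by (intro exI[of _ "1 / lead D k"]) (auto simp: normalized_def)
  qed
  then have "trp n ?W (pt n D) = pt n (diag_frame n (chart_t n ?v))"
    using chart by (auto simp: trp_pt intro!: pt_cong)
  then obtain g K where g: "g \<in> GL n" "K \<subseteq> {1..n-1}"
    "trp n ?W (trp n h p) = trp n g (base_point n K)"
    using diag_frame_base_point[of n "chart_t n ?v"] D(1) by metis
  have W: "?W \<in> GL n" using adj_unitriangular[OF chart_R_carrier chart_R_unitriangular] by simp
  have hW: "h * ?W \<in> GL n" using h(1) W by (rule GL_mult)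
  obtain u where u: "u \<in> GL n" "(h * ?W) * u = 1\<^sub>m n" using GL_inverse[OF hW] by metis
  have pa: "p \<in> ambient n" using assms complete_quadrics_ambient by blast
  have "p = trp n u (trp n (h * ?W) p)" using trp_cancel[OF hW u pa] by simp
  also have "trp n (h * ?W) p = trp n g (base_point n K)"
    using g(3) trp_trp[OF GL_carrier[OF h(1)] GL_carrier[OF W] pa] by simp
  also have "trp n u \<dots> = trp n (g * u) (base_point n K)"
    by (rule trp_trp[OF GL_carrier[OF g(1)] GL_carrier[OF u(1)] base_point_ambient])
  finally show thesis using that[OF GL_mult[OF g(1) u(1)] g(2)] by blast
qed

section \<open>Strata\<close>

lemma rank_sum_le:
  assumes "finite L"
  shows "vec_space.rank n (mat n n (\<lambda>(i, j). \<Sum>l\<in>L. a l i * b l j :: complex)) \<le> card L"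
  using assms
proof (induction L rule: finite_induct)
  case empty
  have "mat n n (\<lambda>_. 0 :: complex) = 0\<^sub>m n n" by (intro eq_matI) auto
  then show ?case using vec_space.rank_0I[of n n] by simp
next
  case (insert l L)
  let ?A = "mat n n (\<lambda>(i, j). a l i * b l j)" and ?B = "mat n n (\<lambda>(i, j). \<Sum>l\<in>L. a l i * b l j)"
  have "mat n n (\<lambda>(i, j). \<Sum>l\<in>insert l L. a l i * b l j) = ?A + ?B"
    using insert.hyps by (intro eq_matI) auto
  moreover have "vec_space.rank n (?A + ?B) \<le> vec_space.rank n ?A + vec_space.rank n ?B"
    by (rule vec_space.rank_subadditive) auto
  moreover have "vec_space.rank n ?A \<le> 1"
    by (rule vec_space.rank_le_1_product_entries[of _ n n "a l" "b l"]) auto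
  ultimately show ?case using insert by simp
qed

lemma prod_single_power:
  fixes c :: "nat \<Rightarrow> complex"
  assumes "k \<in> {1..n-1}"
  shows "(\<Prod>j=1..n-1. c j ^ (if j = k then e else 0)) = c k ^ e"
proof -
  have "(\<Prod>j=1..n-1. c j ^ (if j = k then e else 0)) = (\<Prod>j=1..n-1. if j = k then c j ^ e else 1)"
    by (intro prod.cong) auto
  then show ?thesis using assms by simp
qed

lemma singleton_k_subsets [simp]: "{i} \<in> k_subsets n 1 \<longleftrightarrow> i < n" "{i} \<in> k_subsets n (Suc 0) \<longleftrightarrow> i < n"
  by (auto simp: k_subsets_def)

lemma pick_singleton: "pick {i} 0 = i"
  using pick_in_set_le[of 0 "{i}"] by simp

lemma compound_singleton:
  "A \<in> carrier_mat n n \<Longrightarrow> i < n \<Longrightarrow> j < n \<Longrightarrow> compound n 1 A ({i}, {j}) = A $$ (i, j)"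
  by (subst compound_eq_det) (auto simp: det_single pick_singleton simp del: pick.simps)

lemma k_subsets_1: "k_subsets n 1 = (\<lambda>i. {i}) ` {..<n}"
  by (auto simp: k_subsets_def card_1_singleton_iff)

lemma congr_base:
  assumes "k \<le> n"
  shows "congr n k g (base n K k) (S, T)
    = (\<Sum>Z | Z \<in> k_subsets n k \<and> adapted n K Z. compound n k g (Z, S) * compound n k g (Z, T))"
proof -
  have "congr n k g (base n K k) (S, T) = (\<Sum>Z\<in>k_subsets n k. \<Sum>Z'\<in>k_subsets n k.
      if Z' = Z then if adapted n K Z then compound n k g (Z, S) * compound n k g (Z, T) else 0 else 0)"
    unfolding congr_def base_def prod.case by (intro sum.cong refl) auto
  also have "\<dots> = (\<Sum>Z\<in>k_subsets n k. if adapted n K Z then compound n k g (Z, S) * compound n k g (Z, T) else 0)"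
    by (intro sum.cong) auto
  also have "\<dots> = (\<Sum>Z | Z \<in> k_subsets n k \<and> adapted n K Z. compound n k g (Z, S) * compound n k g (Z, T))"
    by (rule sum.inter_filter[symmetric]) simp
  finally show ?thesis .
qed

text \<open>The matrix is \<open>g\<^sup>T D g\<close> with one nonzero diagonal entry of
  \<open>D\<close> for each adapted singleton. A sum of matrices of rank one bounds the rank from
  above; a nonzero minor of \<open>D\<close>, carried through the invertible congruence, bounds it
  from below.\<close>

lemma first_rank_translate:
  assumes g: "g \<in> GL n" and n: "2 \<le> n"
  shows "first_rank n (trp n g (base_point n K)) r \<longleftrightarrow> card {l. l < n \<and> adapted n K {l}} = r"
proof -
  let ?L = "{l. l < n \<and> adapted n K {l}}"
  let ?B = "congr n 1 g (base n K 1)"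
  have gc: "g \<in> carrier_mat n n" using g by (rule GL_carrier)
  have B: "?B ({i}, {j}) = (\<Sum>l\<in>?L. g $$ (l, i) * g $$ (l, j))" if ij: "i < n" "j < n" for i j
  proof -
    have "{Z. Z \<in> k_subsets n 1 \<and> adapted n K Z} = (\<lambda>l. {l}) ` ?L" unfolding k_subsets_1 by auto
    then show ?thesis using n ij compound_singleton[OF gc]
      by (simp add: congr_base sum.reindex)
  qed
  have rank: "vec_space.rank n (mat n n (\<lambda>(i, j). c * ?B ({i}, {j}))) = card ?L" if c: "c \<noteq> 0" for c
  proof (rule antisym)
    let ?M = "mat n n (\<lambda>(i, j). c * ?B ({i}, {j}))"
    have "?M = mat n n (\<lambda>(i, j). \<Sum>l\<in>?L. (c * g $$ (l, i)) * g $$ (l, j))"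
      using B by (intro eq_matI) (auto simp: sum_distrib_left mult.assoc)
    then show "vec_space.rank n ?M \<le> card ?L"
      using rank_sum_le[of ?L n "\<lambda>l i. c * g $$ (l, i)" "\<lambda>l j. g $$ (l, j)"] by simp
    let ?D = "diag n (\<lambda>l. if adapted n K {l} then c else 0)"
    have "?M = transpose_mat g * ?D * g"
    proof (rule eq_matI)
      fix i j assume "i < dim_row (transpose_mat g * ?D * g)" "j < dim_col (transpose_mat g * ?D * g)"
      then have ij: "i < n" "j < n" using gc by auto
      have "(transpose_mat g * ?D * g) $$ (i, j) = (\<Sum>l<n. if adapted n K {l} then c * (g $$ (l, i) * g $$ (l, j)) else 0)"
        unfolding index_congruent_diag[OF gc ij] by (intro sum.cong) auto
      also have "\<dots> = (\<Sum>l\<in>{l \<in> {..<n}. adapted n K {l}}. c * (g $$ (l, i) * g $$ (l, j)))"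
        by (rule sum.inter_filter[symmetric]) simp
      also have "{l \<in> {..<n}. adapted n K {l}} = ?L" by auto
      finally show "?M $$ (i, j) = (transpose_mat g * ?D * g) $$ (i, j)"
        using ij B by (simp add: sum_distrib_left)
    qed (use gc in auto)
    then have comp: "compound n (card ?L) ?M = congr n (card ?L) g (compound n (card ?L) ?D)"
      using congr_compound[OF gc diag_carrier] by simp
    have "?L \<in> k_subsets n (card ?L)" by (auto simp: k_subsets_def)
    then have "compound n (card ?L) ?D (?L, ?L) \<noteq> 0"
      using c by (auto simp: diag_def compound_diagonal prod_zero_iff)
    then have "compound n (card ?L) ?M \<noteq> (\<lambda>_. 0)"
      unfolding comp by (intro congr_nonzero[OF g supported_compound]) auto
    then obtain S T where nz: "compound n (card ?L) ?M (S, T) \<noteq> 0" by fastforce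
    then have ST: "S \<in> k_subsets n (card ?L)" "T \<in> k_subsets n (card ?L)"
      using compound_outside by blast+
    then have "det (submatrix ?M S T) \<noteq> 0" using nz by (simp add: compound_def)
    then have "card {j. j < n \<and> j \<in> T} \<le> vec_space.rank n ?M"
      by (intro vec_space.rank_gt_minor[of _ n n S T]) auto
    moreover have "{j. j < n \<and> j \<in> T} = T" using k_subsetsD(1)[OF ST(2)] by auto
    ultimately show "card ?L \<le> vec_space.rank n ?M" using k_subsetsD(2)[OF ST(2)] by simp
  qed
  have "trp n g (base_point n K) 1 = proj_class ?B"
  proof -
    have "1 \<in> {1..n-1}" using n by auto
    then show ?thesis unfolding base_point_def trp_pt unfolding pt_def by (rule restrict_apply')
  qed
  then have "first_rank n (trp n g (base_point n K)) r \<longleftrightarrow>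
      (\<exists>c. c \<noteq> 0 \<and> vec_space.rank n (mat n n (\<lambda>(i, j). c * ?B ({i}, {j}))) = r)"
    unfolding first_rank_def proj_class_def by auto
  also have "\<dots> \<longleftrightarrow> card ?L = r"
  proof -
    define \<rho> where "\<rho> c = vec_space.rank n (mat n n (\<lambda>(i, j). c * ?B ({i}, {j})))" for c
    have \<rho>: "\<rho> c = card ?L" if "c \<noteq> 0" for c unfolding \<rho>_def by (rule rank[OF that])
    have "\<rho> 1 = card ?L" by (rule \<rho>) simp
    then show ?thesis unfolding \<rho>_def[symmetric] using \<rho> by (metis one_neq_zero)
  qed
  finally show ?thesis .
qed

lemma adapted_singleton: "adapted n K {l} \<longleftrightarrow> (\<forall>m\<in>{1..n-1} - K. l < m)"
proof -
  have "{l} \<subseteq> {..<m} \<or> {..<m} \<subseteq> {l} \<longleftrightarrow> l < m" if "m \<in> {1..n-1} - K" for m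
  proof -
    have "0 \<in> {..<m}" using that by auto
    then have "l < m" if "{..<m} \<subseteq> {l}" using that by fastforce
    then show ?thesis by blast
  qed
  then show ?thesis unfolding adapted_def by blast
qed

text \<open>The adapted singletons form an initial segment that ends at the first boundary, so a
  rank strictly between \<open>0\<close> and \<open>n\<close> is itself a boundary.\<close>

lemma first_rank_not_mem:
  assumes "card {l. l < n \<and> adapted n K {l}} = m" "m \<in> {1..n-1}"
  shows "m \<notin> K"
proof -
  let ?L = "{l. l < n \<and> adapted n K {l}}"
  have down: "l' \<in> ?L" if "l \<in> ?L" "l' \<le> l" for l l'
    using that le_less_trans unfolding adapted_singleton by blast
  have sub1: "{..l} \<subseteq> ?L" if "l \<in> ?L" for l using down that by auto
  have "?L \<subseteq> {..<m}"
  proof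
    fix l assume "l \<in> ?L"
    then have "card {..l} \<le> card ?L" by (intro card_mono sub1) auto
    then show "l \<in> {..<m}" using assms(1) by simp
  qed
  then have L: "?L = {..<m}" using assms(1) by (intro card_subset_eq) auto
  then have "m - 1 \<in> ?L" "m \<notin> ?L" using assms(2) by auto
  then obtain m' where m': "m' \<in> {1..n-1} - K" "\<not> m < m'" "m - 1 < m'"
    using assms(2) by (auto simp: adapted_singleton)
  then have "m' = m" by simp
  then show ?thesis using m'(1) by simp
qed

lemma first_rank_complement:
  assumes "m \<in> {1..n-1}"
  shows "card {l. l < n \<and> adapted n ({1..n-1} - {m}) {l}} = m"
proof -
  have "{l. l < n \<and> adapted n ({1..n-1} - {m}) {l}} = {..<m}"
    using assms by (auto simp: adapted_singleton)
  then show ?thesis by simp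
qed

lemma adapted_not_mem:
  assumes "m \<in> {1..n-1}" "m \<notin> K" "S \<in> k_subsets n m"
  shows "adapted n K S \<longleftrightarrow> S = {..<m}"
proof
  assume "adapted n K S"
  then have "S \<subseteq> {..<m} \<or> {..<m} \<subseteq> S" using assms(1,2) by (auto simp: adapted_def)
  then show "S = {..<m}" using card_subset_eq[of "{..<m}" S] card_subset_eq[of S "{..<m}"] k_subsetsD[OF assms(3)]
    by auto
qed simp

text \<open>At a boundary only the leading set is adapted, so this component has rank one: it is the
  square of the vector of maximal minors of the first \<open>m\<close> rows of \<open>g\<close>, the
  Pluecker vector of their span.\<close>

lemma congr_base_not_mem:
  assumes "m \<in> {1..n-1}" "m \<notin> K"
  shows "congr n m g (base n K m) (S, T) = compound n m g ({..<m}, S) * compound n m g ({..<m}, T)"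
proof -
  have "{Z. Z \<in> k_subsets n m \<and> adapted n K Z} = {{..<m}}"
    using adapted_not_mem[OF assms] assms(1) by auto
  then show ?thesis using assms(1) by (subst congr_base) auto
qed

lemma complete_quadrics_translates:
  "trp n g (base_point n K) \<in> complete_quadrics n" if "g \<in> GL n"
  using complete_quadrics_GL_stable base_point_complete_quadrics that by (auto simp: GL_stable_def)

text \<open>If \<open>n - i\<close> is a boundary, the point is a degeneration of the standard point
  with this boundary alone, whose first component has rank \<open>n - i\<close>. If it is not, the
  component of degree \<open>n - i\<close> has rank above one, whereas its rank is one on the whole
  divisor.\<close>

lemma boundary_divisor_iff:
  assumes n: "2 \<le> n" and g: "g \<in> GL n" and K: "K \<subseteq> {1..n-1}" and i: "i \<in> {1..n-1}"
  shows "trp n g (base_point n K) \<in> boundary_divisor n i \<longleftrightarrow> n - i \<notin> K"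
proof -
  let ?m = "n - i"
  let ?Z = "{p \<in> complete_quadrics n. first_rank n p ?m}"
  have m: "?m \<in> {1..n-1}" using i by auto
  have Z: "?Z \<subseteq> ambient n" using complete_quadrics_ambient by blast
  have stableZ: "GL_stable n ?Z"
    unfolding GL_stable_def
  proof (intro ballI)
    fix h p assume h: "h \<in> GL n" and p: "p \<in> ?Z"
    then obtain g K where gK: "g \<in> GL n" "p = trp n g (base_point n K)"
      using complete_quadric_normal_form by blast
    then have "trp n h p = trp n (g * h) (base_point n K)"
      using trp_trp[OF GL_carrier GL_carrier base_point_ambient] h by simp
    then show "trp n h p \<in> ?Z"
      using p gK(2) first_rank_translate[OF gK(1) n] first_rank_translate[OF GL_mult[OF gK(1) h] n]
        complete_quadrics_translates[OF GL_mult[OF gK(1) h]] by simp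
  qed
  have stable: "GL_stable n (boundary_divisor n i)"
    unfolding boundary_divisor_def by (rule closure_GL_stable[OF Z stableZ])
  have "base_point n K \<in> boundary_divisor n i \<longleftrightarrow> ?m \<notin> K"
  proof
    assume "?m \<notin> K"
    have one: "1\<^sub>m n \<in> GL n" by (simp add: GL_def)
    have "first_rank n (base_point n ({1..n-1} - {?m})) ?m"
      using first_rank_translate[OF one n, of "{1..n-1} - {?m}" ?m]
      unfolding trp_one[OF base_point_ambient] first_rank_complement[OF m] by (simp only: refl)
    then have "base_point n ({1..n-1} - {?m}) \<in> ?Z"
      by (intro CollectI conjI base_point_complete_quadrics)
    then have "base_point n ({1..n-1} - {?m}) \<in> boundary_divisor n i"
      unfolding boundary_divisor_def by (rule subsetD[OF zariski_closure_superset])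
    moreover have "zariski_closed n (boundary_divisor n i)"
      unfolding boundary_divisor_def by (rule zariski_closure_closed[OF Z])
    ultimately show "base_point n K \<in> boundary_divisor n i"
      using base_point_degenerate[OF _ stable, of K "{1..n-1} - {?m}"] K \<open>?m \<notin> K\<close>
      by (simp add: subset_Diff_insert)
  next
    assume in_boundary: "base_point n K \<in> boundary_divisor n i"
    show "?m \<notin> K"
    proof
      assume "?m \<in> K"
      let ?S = "{..<?m}" and ?T = "insert ?m {..<?m - 1}"
      have ST: "?S \<in> k_subsets n ?m" "?T \<in> k_subsets n ?m"
      proof -
        show "?S \<in> k_subsets n ?m" by simp
        have "Suc (?m - 1) = ?m" "?m < n" using m by auto
        then show "?T \<in> k_subsets n ?m" using insert_k_subsets[of "?m - 1" ?m n] by simp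
      qed
      \<comment> \<open>A minor of size two of the component of degree \<open>n - i\<close>: zero
        where that component has rank one, but nonzero at the standard point when both index sets
        are adapted.\<close>
      define f where "f v = v ?m (?S, ?S) * v ?m (?T, ?T) - v ?m (?S, ?T) * v ?m (?T, ?S)"
        for v :: "nat \<Rightarrow> set_mat"
      have "f \<in> poly_funs (coords n)"
        unfolding f_def by (intro poly_funs_diff poly_funs.mult coordsI m ST)
      moreover have "f (\<lambda>k x. c k * v k x) = (\<Prod>k=1..n-1. c k ^ (if k = ?m then 2 else 0)) * f v" for c v
        unfolding prod_single_power[OF m] f_def by (simp add: power2_eq_square algebra_simps)
      ultimately have f: "f \<in> multihom_polys n"
        unfolding multihom_polys_alt mem_Collect_eq
        by (intro conjI exI[of _ "\<lambda>k. if k = ?m then 2 else 0"]) auto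
      have "f (base n K) = 0"
      proof (rule pt_in_closureD[OF Z _ f])
        show "pt n (base n K) \<in> zariski_closure n ?Z"
          using in_boundary by (simp add: base_point_def boundary_divisor_def)
        fix D assume D: "pt n D \<in> ?Z"
        then obtain g K' where gK: "g \<in> GL n" "pt n D = trp n g (base_point n K')"
          using complete_quadric_normal_form by blast
        then have "?m \<notin> K'"
          using D first_rank_translate[OF gK(1) n] first_rank_not_mem[OF _ m] by auto
        moreover obtain c where "D ?m = (\<lambda>x. c * congr n ?m g (base n K' ?m) x)"
          using gK(2)[symmetric, unfolded base_point_def trp_pt pt_eq_iff] m by blast
        ultimately show "f D = 0" using congr_base_not_mem[OF m, of K' g] by (simp add: f_def algebra_simps)
      qed
      moreover have "adapted n K ?T"
        unfolding adapted_def
      proof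
        fix m' assume m': "m' \<in> {1..n-1} - K"
        then have "m' < ?m \<or> ?m < m'" using \<open>?m \<in> K\<close> by (metis DiffE linorder_neqE_nat)
        then show "?T \<subseteq> {..<m'} \<or> {..<m'} \<subseteq> ?T" by auto
      qed
      moreover have "?S \<noteq> ?T" by (metis insertI1 lessThan_iff less_irrefl)
      ultimately show False using ST by (simp add: f_def base_def)
    qed
  qed
  then show ?thesis using GL_stable_iff[OF stable g base_point_ambient] by blast
qed

text \<open>Divisors are numbered by the dimension of the kernel, boundaries by the rank.\<close>

definition reflected :: "nat \<Rightarrow> nat set \<Rightarrow> nat set" where
  "reflected n I = {m \<in> {1..n-1}. n - m \<in> I}"

lemma reflected_subset: "reflected n I \<subseteq> {1..n-1}"
  by (auto simp: reflected_def)

lemma mem_reflected: "I \<subseteq> {1..n-1} \<Longrightarrow> i \<in> {1..n-1} \<Longrightarrow> n - i \<in> reflected n I \<longleftrightarrow> i \<in> I"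
  by (auto simp: reflected_def)

lemma special_reflected:
  assumes I: "I \<subseteq> {1..n-1}"
  shows "special (reflected n I) \<longleftrightarrow> special I"
proof -
  have "\<exists>i. i \<in> reflected n I \<and> i + 1 \<in> reflected n I" if "i \<in> I" "i + 1 \<in> I" for i
  proof -
    have "n - (i + 1) \<in> reflected n I" "n - i \<in> reflected n I" using that I mem_reflected[OF I] by auto
    moreover have "n - (i + 1) + 1 = n - i" using that I by auto
    ultimately show ?thesis by metis
  qed
  moreover have "\<exists>i. i \<in> I \<and> i + 1 \<in> I" if "i \<in> reflected n I" "i + 1 \<in> reflected n I" for i
  proof -
    have "n - (i + 1) \<in> I" "n - i \<in> I" "i + 1 \<le> n - 1" using that by (auto simp: reflected_def)
    moreover from this have "n - (i + 1) + 1 = n - i" by auto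
    ultimately show ?thesis by metis
  qed
  ultimately show ?thesis unfolding special_def by blast
qed

lemma reflected_subset_iff:
  assumes I: "I \<subseteq> {1..n-1}" and K: "K \<subseteq> {1..n-1}"
  shows "(\<forall>i\<in>{1..n-1} - I. n - i \<notin> K) \<longleftrightarrow> K \<subseteq> reflected n I"
proof
  assume *: "\<forall>i\<in>{1..n-1} - I. n - i \<notin> K"
  show "K \<subseteq> reflected n I"
  proof
    fix m assume m: "m \<in> K"
    then have "m \<in> {1..n-1}" using K by blast
    then have "n - m \<in> {1..n-1}" "n - (n - m) = m" "m \<in> {1..n-1}" by auto
    moreover have "n - m \<in> I"
    proof (rule ccontr)
      assume "n - m \<notin> I"
      then have "n - (n - m) \<notin> K" using * calculation(1) by blast
      then show False using calculation(2) m by simp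
    qed
    ultimately show "m \<in> reflected n I" by (auto simp: reflected_def)
  qed
qed (use mem_reflected[OF I] in blast)

lemma stratum_closure_iff:
  assumes n: "2 \<le> n" and I: "I \<subseteq> {1..n-1}" and g: "g \<in> GL n" and K: "K \<subseteq> {1..n-1}"
  shows "trp n g (base_point n K) \<in> stratum_closure n I \<longleftrightarrow> K \<subseteq> reflected n I"
  using boundary_divisor_iff[OF n g K] complete_quadrics_translates[OF g] reflected_subset_iff[OF I K]
  by (auto simp: stratum_closure_def)

lemma stratum_iff:
  assumes n: "2 \<le> n" and I: "I \<subseteq> {1..n-1}" and g: "g \<in> GL n" and K: "K \<subseteq> {1..n-1}"
  shows "trp n g (base_point n K) \<in> stratum n I \<longleftrightarrow> K = reflected n I"
proof -
  have "trp n g (base_point n K) \<in> stratum n I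
      \<longleftrightarrow> K \<subseteq> reflected n I \<and> (\<forall>i\<in>I. n - i \<in> K)"
    using stratum_closure_iff[OF assms] boundary_divisor_iff[OF n g K] I unfolding stratum_def by blast
  moreover have "(\<forall>i\<in>I. n - i \<in> K) \<longleftrightarrow> reflected n I \<subseteq> K"
  proof
    assume *: "\<forall>i\<in>I. n - i \<in> K"
    show "reflected n I \<subseteq> K"
    proof
      fix m assume "m \<in> reflected n I"
      then have "n - m \<in> I" "n - (n - m) = m" by (auto simp: reflected_def)
      then show "m \<in> K" using * by metis
    qed
  qed (use mem_reflected[OF I] I in blast)
  ultimately show ?thesis by blast
qed

lemma stratum_closure_normal_form:
  assumes n: "2 \<le> n" and I: "I \<subseteq> {1..n-1}" and p: "p \<in> stratum_closure n I"
  obtains g K where "g \<in> GL n" "K \<subseteq> reflected n I" "p = trp n g (base_point n K)"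
proof -
  obtain g K where gK: "g \<in> GL n" "K \<subseteq> {1..n-1}" "p = trp n g (base_point n K)"
    using p complete_quadric_normal_form[of p n] unfolding stratum_closure_def by blast
  moreover have "K \<subseteq> reflected n I" using stratum_closure_iff[OF n I gK(1,2)] p gK(3) by simp
  ultimately show thesis using that by blast
qed

lemma stratum_normal_form:
  assumes n: "2 \<le> n" and I: "I \<subseteq> {1..n-1}" and p: "p \<in> stratum n I"
  obtains g where "g \<in> GL n" "p = trp n g (base_point n (reflected n I))"
proof -
  obtain g K where gK: "g \<in> GL n" "K \<subseteq> {1..n-1}" "p = trp n g (base_point n K)"
    using p complete_quadric_normal_form[of p n] unfolding stratum_def stratum_closure_def by blast
  moreover have "K = reflected n I" using stratum_iff[OF n I gK(1,2)] p gK(3) by simp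
  ultimately show thesis using that by blast
qed

section \<open>Fixed points of a regular unipotent matrix\<close>

lemma compound_unitriangular_diag:
  assumes R: "R \<in> carrier_mat n n" "unitriangular R" and S: "S \<in> k_subsets n k"
  shows "compound n k R (S, S) = 1"
proof -
  let ?M = "mat k k (\<lambda>(i, j). R $$ (pick S i, pick S j))"
  have "unitriangular ?M"
    unfolding unitriangular_def
  proof (intro allI impI conjI)
    fix i assume "i < dim_row ?M"
    then have i: "i < k" by simp
    then show "?M $$ (i, i) = 1" using R pick_k_subsets[OF S i] by (simp add: unitriangular_def del: pick.simps)
    fix j assume j: "j < i"
    then have "pick S j < pick S i" using pick_mono_le[of i S j] i k_subsetsD(2)[OF S] by simp
    then show "?M $$ (i, j) = 0" using R pick_k_subsets[OF S i] i j
      by (simp add: unitriangular_def del: pick.simps)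
  qed
  then show ?thesis using det_unitriangular[of ?M k] R S by (simp add: compound_eq_det del: pick.simps)
qed

text \<open>A lower unitriangular matrix is a single Jordan block exactly when its subdiagonal has
  no zero.\<close>

definition regular_lower :: "nat \<Rightarrow> complex mat \<Rightarrow> bool" where
  "regular_lower n h \<longleftrightarrow> h \<in> carrier_mat n n \<and> unitriangular (transpose_mat h)
     \<and> (\<forall>i. Suc i < n \<longrightarrow> h $$ (Suc i, i) \<noteq> 0)"

lemma regular_lowerD:
  assumes "regular_lower n h"
  shows "h \<in> carrier_mat n n" "transpose_mat h \<in> carrier_mat n n" "unitriangular (transpose_mat h)"
    "Suc i < n \<Longrightarrow> h $$ (Suc i, i) \<noteq> 0" "i < n \<Longrightarrow> h $$ (i, i) = 1"
    "i < n \<Longrightarrow> j < n \<Longrightarrow> i < j \<Longrightarrow> h $$ (i, j) = 0"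
proof -
  show h: "h \<in> carrier_mat n n" "transpose_mat h \<in> carrier_mat n n" "unitriangular (transpose_mat h)"
    using assms by (auto simp: regular_lower_def)
  show "Suc i < n \<Longrightarrow> h $$ (Suc i, i) \<noteq> 0" using assms by (auto simp: regular_lower_def)
  show "h $$ (i, i) = 1" if i: "i < n"
  proof -
    have "transpose_mat h $$ (i, i) = 1" using h i by (auto simp: unitriangular_def)
    then show ?thesis using h i by simp
  qed
  show "h $$ (i, j) = 0" if ij: "i < n" "j < n" "i < j"
  proof -
    have "transpose_mat h $$ (j, i) = 0" using h ij by (auto simp: unitriangular_def)
    then show ?thesis using h ij by simp
  qed
qed

text \<open>All components of \<open>base_point n {}\<close> are squares of leading coordinate
  vectors, and a lower unitriangular matrix leaves the leading row of each compound as it is for the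
  identity.\<close>

lemma lower_fixes_base_point:
  assumes h: "h \<in> carrier_mat n n" "unitriangular (transpose_mat h)"
  shows "trp n h (base_point n {}) = base_point n {}"
  unfolding base_point_def trp_pt
proof (rule pt_cong)
  fix k assume k: "k \<in> {1..n-1}"
  then have kn: "k \<le> n" by auto
  have "compound n k h ({..<k}, S) = (if S = {..<k} then 1 else 0)" for S
    using compound_unitriangular[of "transpose_mat h" n k S] compound_transpose[OF h(1), of k S "{..<k}"] h kn
    by simp
  then have "congr n k h (base n {} k) (S, T) = base n {} k (S, T)" for S T
    using congr_base_not_mem[of k n "{}" h S T] k adapted_not_mem[of k n "{}" S] kn
    by (auto simp: base_def)
  then show "congr n k h (base n {} k) = base n {} k" by fastforce
qed

text \<open>The component at a boundary is the square of a row of maximal minors. If the point is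
  fixed, only one maximal minor of the first \<open>m\<close> rows is nonzero, so these rows are
  supported on the first \<open>m\<close> columns.\<close>

lemma stabilizer_block:
  assumes R: "R \<in> carrier_mat n n" and fixed: "trp n R (base_point n K) = base_point n K"
    and m: "m \<in> {1..n-1}" "m \<notin> K" and ij: "i < m" "m \<le> j" "j < n"
  shows "R $$ (i, j) = 0"
proof (rule rows_supported_on_columns[OF R])
  obtain c where c: "c \<noteq> 0" "base n K m = (\<lambda>x. c * congr n m R (base n K m) x)"
    using fixed m(1) unfolding base_point_def trp_pt pt_eq_iff by blast
  have eq: "base n K m (S, S) = c * compound n m R ({..<m}, S) ^ 2" for S
    using fun_cong[OF c(2), of "(S, S)"] congr_base_not_mem[OF m, of R S S] by (simp add: power2_eq_square)
  show "{..<m} \<in> k_subsets n m" using m(1) by auto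
  then have "base n K m ({..<m}, {..<m}) = 1" by (simp add: base_def)
  then show "compound n m R ({..<m}, {..<m}) \<noteq> 0" using eq[of "{..<m}"] by auto
  show "compound n m R ({..<m}, S) = 0" if "S \<in> k_subsets n m" "S \<noteq> {..<m}" for S
    using eq[of S] c(1) that adapted_not_mem[OF m that(1)] by (simp add: base_def)
qed (use ij in auto)

text \<open>A row of \<open>g\<close> with last nonzero entry in position \<open>i \<ge> m\<close> yields, under the powers of
  \<open>h - 1\<close>, vectors with last nonzero entries in positions \<open>i, i - 1, \<dots>, i - m\<close>. They all lie in the
  span of the first \<open>m\<close> rows of \<open>g\<close>, which is impossible.\<close>

lemma invariant_rows:
  assumes g: "g \<in> carrier_mat n n" and R: "R \<in> carrier_mat n n" and h: "regular_lower n h"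
    and eq: "R * g = g * h" and m: "m \<le> n"
    and block: "\<And>i j. i < m \<Longrightarrow> m \<le> j \<Longrightarrow> j < n \<Longrightarrow> R $$ (i, j) = 0"
    and ij: "i0 < m" "m \<le> j0" "j0 < n"
  shows "g $$ (i0, j0) = 0"
proof (rule ccontr)
  assume nz: "g $$ (i0, j0) \<noteq> 0"
  note h' = regular_lowerD[OF h]
  \<comment> \<open>\<open>N\<close> and \<open>Q\<close> are the entries of \<open>h - 1\<close>
    and \<open>R - 1\<close>; the assumed relation becomes \<open>Q g = g N\<close>, and
    \<open>N\<close> is strictly lower triangular.\<close>
  define N where "N b c = h $$ (b, c) - (if b = c then 1 else 0)" for b c
  define Q where "Q a c = R $$ (a, c) - (if a = c then 1 else 0)" for a c
  define i where "i = Max {j. j < n \<and> g $$ (i0, j) \<noteq> 0}"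
  have fin: "finite {j. j < n \<and> g $$ (i0, j) \<noteq> 0}" by simp
  have "i \<in> {j. j < n \<and> g $$ (i0, j) \<noteq> 0}"
    unfolding i_def by (rule Max_in[OF fin]) (use nz ij in auto)
  then have i: "i < n" "g $$ (i0, i) \<noteq> 0" by auto
  have top: "g $$ (i0, c) = 0" if "i < c" "c < n" for c
  proof (rule ccontr)
    assume "g $$ (i0, c) \<noteq> 0"
    then have "c \<le> i" unfolding i_def using that by (intro Max_ge[OF fin]) auto
    then show False using that by simp
  qed
  have "j0 \<le> i" unfolding i_def by (rule Max_ge[OF fin]) (use nz ij in auto)
  then have mi: "m \<le> i" using ij by simp
  have QN: "(\<Sum>c<n. Q a c * g $$ (c, j)) = (\<Sum>b<n. g $$ (a, b) * N b j)" if aj: "a < n" "j < n" for a j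
  proof -
    have "(R * g) $$ (a, j) = (\<Sum>c<n. R $$ (a, c) * g $$ (c, j))"
      "(g * h) $$ (a, j) = (\<Sum>b<n. g $$ (a, b) * h $$ (b, j))"
      using aj R g h' by (auto simp: scalar_prod_def atLeast0LessThan intro!: sum.cong)
    moreover have "(\<Sum>c<n. Q a c * g $$ (c, j)) = (\<Sum>c<n. R $$ (a, c) * g $$ (c, j)) - g $$ (a, j)"
      using aj by (simp add: Q_def left_diff_distrib sum_subtractf if_distrib[of "\<lambda>x. x * _"] cong: if_cong)
    moreover have "(\<Sum>b<n. g $$ (a, b) * N b j) = (\<Sum>b<n. g $$ (a, b) * h $$ (b, j)) - g $$ (a, j)"
      using aj by (simp add: N_def right_diff_distrib sum_subtractf if_distrib[of "(*) _"] cong: if_cong)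
    ultimately show ?thesis using eq by simp
  qed
  have N0: "N b c = 0" if "b \<le> c" "b < n" "c < n" for b c
    using h'(5)[of b] h'(6)[of b c] that by (auto simp: N_def)
  \<comment> \<open>\<open>X l\<close> is row \<open>i0\<close> of \<open>g\<close> multiplied by
    the \<open>l\<close>-th power of \<open>N\<close>, and \<open>C l\<close> holds coefficients
    that express it through the rows of \<open>g\<close>.\<close>
  define X where "X l = ((\<lambda>x j. \<Sum>b<n. x b * N b j) ^^ l) (\<lambda>j. g $$ (i0, j))" for l
  define C where "C l = ((\<lambda>x j. \<Sum>a<n. x a * Q a j) ^^ l) (\<lambda>j. if j = i0 then 1 else 0)" for l
  have X: "X 0 j = g $$ (i0, j)" "X (Suc l) j = (\<Sum>b<n. X l b * N b j)" for l j by (simp_all add: X_def)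
  have C: "C 0 j = (if j = i0 then 1 else 0)" "C (Suc l) j = (\<Sum>a<n. C l a * Q a j)" for l j
    by (simp_all add: C_def)
  have XC: "X l j = (\<Sum>a<n. C l a * g $$ (a, j))" if "j < n" for l j
    using that
  proof (induction l arbitrary: j)
    case 0
    then show ?case using ij m by (simp add: X C if_distrib[of "\<lambda>x. x * _"] cong: if_cong)
  next
    case (Suc l)
    have "X (Suc l) j = (\<Sum>b<n. \<Sum>a<n. C l a * (g $$ (a, b) * N b j))"
      unfolding X using Suc.IH by (intro sum.cong refl) (simp add: sum_distrib_right mult.assoc)
    also have "\<dots> = (\<Sum>a<n. \<Sum>b<n. C l a * (g $$ (a, b) * N b j))" by (rule sum.swap)
    also have "\<dots> = (\<Sum>a<n. \<Sum>c<n. C l a * (Q a c * g $$ (c, j)))"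
      by (rule sum.cong[OF refl]) (use QN Suc.prems in \<open>simp add: sum_distrib_left[symmetric]\<close>)
    also have "\<dots> = (\<Sum>c<n. \<Sum>a<n. C l a * (Q a c * g $$ (c, j)))" by (rule sum.swap)
    also have "\<dots> = (\<Sum>c<n. C (Suc l) c * g $$ (c, j))"
      unfolding C by (intro sum.cong refl) (simp add: sum_distrib_right mult.assoc)
    finally show ?case .
  qed
  have C0: "C l j = 0" if "m \<le> j" "j < n" for l j
    using that
  proof (induction l arbitrary: j)
    case 0
    then show ?case using ij by (simp add: C)
  next
    case (Suc l)
    have "C l a * Q a j = 0" if "a < n" for a
      using Suc.IH[of a] block[of a j] Suc.prems that by (cases "a < m") (auto simp: Q_def)
    then show ?case unfolding C by (intro sum.neutral) blast
  qed
  have X0: "X l (i - l) \<noteq> 0 \<and> (\<forall>c. i - l < c \<longrightarrow> c < n \<longrightarrow> X l c = 0)" if "l \<le> i" for l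
    using that
  proof (induction l)
    case 0
    then show ?case using i top by (simp add: X)
  next
    case (Suc l)
    then have IH: "X l (i - l) \<noteq> 0" "\<And>c. i - l < c \<Longrightarrow> c < n \<Longrightarrow> X l c = 0" by auto
    let ?j = "i - Suc l"
    have j: "Suc ?j = i - l" "?j < n" using Suc.prems i by auto
    have term0: "X l b * N b c = 0" if "?j \<le> c" "c < n" "b < n" "\<not> (c = ?j \<and> b = i - l)" for b c
    proof (cases "b \<le> c")
      case True
      then show ?thesis using N0 that by simp
    next
      case False
      then have "i - l < b" using that j by linarith
      then show ?thesis using IH(2) that by simp
    qed
    have "X (Suc l) ?j = (\<Sum>b<n. if b = i - l then X l b * N b ?j else 0)"
      unfolding X
    proof (rule sum.cong[OF refl])
      fix b assume "b \<in> {..<n}"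
      then show "X l b * N b ?j = (if b = i - l then X l b * N b ?j else 0)"
        using term0[of ?j b] j by (cases "b = i - l") auto
    qed
    then have "X (Suc l) ?j = X l (i - l) * N (i - l) ?j" using i by simp
    moreover have "N (i - l) ?j \<noteq> 0" using h'(4)[of ?j] j i by (simp add: N_def)
    moreover have "X (Suc l) c = 0" if "?j < c" "c < n" for c
      unfolding X by (intro sum.neutral ballI term0) (use that in auto)
    ultimately show ?case using IH(1) by auto
  qed
  \<comment> \<open>Columns are counted backwards from \<open>i\<close>, so that the positions of
    the last nonzero entries make \<open>M\<close> triangular with nonzero diagonal. But
    \<open>M\<close> also factors through only \<open>m\<close> rows of \<open>g\<close>, which
    makes it singular.\<close>
  define M where "M = mat (Suc m) (Suc m) (\<lambda>(l, c). X l (i - c))"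
  define C' where "C' = mat (Suc m) (Suc m) (\<lambda>(l, a). if a < m then C l a else 0)"
  define G where "G = mat (Suc m) (Suc m) (\<lambda>(a, c). g $$ (a, i - c))"
  have MC: "M = C' * G"
  proof (rule eq_matI)
    fix l c assume "l < dim_row (C' * G)" "c < dim_col (C' * G)"
    then have lc: "l < Suc m" "c < Suc m" by (auto simp: C'_def G_def)
    have "M $$ (l, c) = (\<Sum>a<n. C l a * g $$ (a, i - c))"
      using lc i XC[of "i - c" l] by (simp add: M_def)
    also have "\<dots> = (\<Sum>a<m. C l a * g $$ (a, i - c))"
      by (rule sum.mono_neutral_right) (use m C0 in auto)
    also have "\<dots> = (C' * G) $$ (l, c)"
      using lc by (simp add: C'_def G_def scalar_prod_def atLeast0LessThan)
    finally show "M $$ (l, c) = (C' * G) $$ (l, c)" .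
  qed (auto simp: M_def C'_def G_def)
  have "det C' = (\<Sum>l<Suc m. C' $$ (l, m) * cofactor C' l m)"
    by (rule laplace_expansion_column) (auto simp: C'_def)
  also have "\<dots> = 0" by (intro sum.neutral) (auto simp: C'_def)
  finally have "det M = 0" using MC det_mult[of C' "Suc m" G] by (simp add: C'_def G_def)
  moreover have "det M \<noteq> 0"
  proof -
    have "X l (i - c) = 0" if "c < l" "l < Suc m" for l c
      using X0[of l] that mi i by auto
    then have "upper_triangular M" by (auto simp: M_def)
    moreover have "\<forall>l<Suc m. M $$ (l, l) \<noteq> 0" using X0 mi by (auto simp: M_def)
    ultimately show ?thesis
      using det_upper_triangular[of M "Suc m"] by (auto simp: M_def diag_mat_def prod_list_zero_iff)
  qed
  ultimately show False by contradiction
qed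

lemma block_lowerI:
  assumes g: "g \<in> carrier_mat n n"
    and zero: "\<And>m i j. m \<in> {1..n-1} - K \<Longrightarrow> i < m \<Longrightarrow> m \<le> j \<Longrightarrow> j < n \<Longrightarrow> g $$ (i, j) = 0"
  shows "block_lower n K g"
  unfolding weight_lower_def
proof (intro allI impI)
  fix i j assume ij: "i < dim_row g" "j < dim_col g" "block_weight n K i < block_weight n K j"
  have "\<not> {m \<in> {1..n-1} - K. m \<le> j} \<subseteq> {m \<in> {1..n-1} - K. m \<le> i}"
  proof
    assume "{m \<in> {1..n-1} - K. m \<le> j} \<subseteq> {m \<in> {1..n-1} - K. m \<le> i}"
    then have "block_weight n K j \<le> block_weight n K i"
      unfolding block_weight_def by (intro card_mono) auto
    then show False using ij(3) by simp
  qed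
  then obtain m where "m \<in> {1..n-1} - K" "m \<le> j" "\<not> m \<le> i" by blast
  then show "g $$ (i, j) = 0" using zero[of m i j] ij g by auto
qed

text \<open>Both neighbours of \<open>k\<close> are boundaries or ends of the range, so
  \<open>S\<close> lies between \<open>{..<k-1}\<close> and \<open>{..<k+1}\<close> and contains
  exactly one of the two elements in between.\<close>

lemma adapted_special:
  assumes K: "special K" and k: "k \<in> K" "k \<in> {1..n-1}" and S: "S \<in> k_subsets n k" "adapted n K S"
  shows "S = {..<k} \<or> S = insert k {..<k-1}"
proof -
  note S' = k_subsetsD[OF S(1)]
  have "k - 1 \<notin> K" "k + 1 \<notin> K"
    using K k unfolding special_def by (metis atLeastAtMost_iff le_add_diff_inverse2 add.commute) (use K k in \<open>auto simp: special_def\<close>)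
  have 1: "{..<k-1} \<subseteq> S"
  proof (cases "k = 1")
    case False
    then have "k - 1 \<in> {1..n-1} - K" using k \<open>k - 1 \<notin> K\<close> by auto
    then have "S \<subseteq> {..<k-1} \<or> {..<k-1} \<subseteq> S" using S(2) by (auto simp: adapted_def)
    moreover have "\<not> S \<subseteq> {..<k-1}" using card_mono[of "{..<k-1}" S] S'(2) k(2) by auto
    ultimately show ?thesis by blast
  qed simp
  have 2: "S \<subseteq> {..<k+1}"
  proof (cases "k + 1 = n")
    case False
    then have "k + 1 \<in> {1..n-1} - K" using k \<open>k + 1 \<notin> K\<close> by auto
    then have "S \<subseteq> {..<k+1} \<or> {..<k+1} \<subseteq> S" using S(2) by (auto simp: adapted_def)
    moreover have "\<not> {..<k+1} \<subseteq> S" using card_mono[of S "{..<k+1}"] S'(2,3) by auto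
    ultimately show ?thesis by blast
  qed (use S'(1) in simp)
  have "card (S - {..<k-1}) = 1" using card_Diff_subset[OF _ 1] S' k(2) by simp
  then obtain x where x: "S - {..<k-1} = {x}" by (auto simp: card_1_singleton_iff)
  from x have "x \<in> S" "x \<notin> {..<k-1}" by blast+
  then have "x = k - 1 \<or> x = k" using 2 by auto
  moreover have "S = insert x {..<k-1}" using 1 x by blast
  moreover have "insert (k - 1) {..<k-1} = {..<k}" using k(2) by auto
  ultimately show ?thesis by auto
qed

text \<open>Fixing the point forces \<open>g\<close> to respect the partial flag, so only adapted
  sets carry coordinates. In a degree belonging to \<open>K\<close> these form a symmetric matrix of
  size two, and a nontrivial unipotent matrix can preserve it up to a scalar only if nothing but the
  leading coordinate is left.\<close>

theorem regular_unipotent_fixed_point: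
  assumes K: "special K" "K \<subseteq> {1..n-1}" and g: "g \<in> GL n" and h: "regular_lower n h"
    and fixed: "trp n h (trp n g (base_point n K)) = trp n g (base_point n K)"
  shows "trp n g (base_point n K) = base_point n {}"
proof -
  note h' = regular_lowerD[OF h]
  have gc: "g \<in> carrier_mat n n" using g by (rule GL_carrier)
  obtain g' where g': "g' \<in> GL n" "g * g' = 1\<^sub>m n" "g' * g = 1\<^sub>m n" using GL_inverse[OF g] by metis
  have g'c: "g' \<in> carrier_mat n n" using g'(1) by (rule GL_carrier)
  define R where "R = g * h * g'"
  have Rc: "R \<in> carrier_mat n n" using gc h'(1) g'c by (simp add: R_def)
  have "R * g = g * h * (g' * g)" unfolding R_def
    by (rule assoc_mult_mat[OF mult_carrier_mat[OF gc h'(1)] g'c gc])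
  also have "\<dots> = g * h" using g'(3) gc h'(1) by simp
  finally have Rg: "R * g = g * h" .
  have "trp n R (base_point n K) = trp n g' (trp n h (trp n g (base_point n K)))"
    using trp_trp[OF gc h'(1) base_point_ambient, of K]
      trp_trp[OF mult_carrier_mat[OF gc h'(1)] g'c base_point_ambient, of K] by (simp add: R_def)
  also have "\<dots> = base_point n K" unfolding fixed by (rule trp_cancel[OF g g'(1,2) base_point_ambient])
  finally have R: "trp n R (base_point n K) = base_point n K" .
  have "g $$ (i, j) = 0" if "m \<in> {1..n-1} - K" "i < m" "m \<le> j" "j < n" for m i j
    by (rule invariant_rows[OF gc Rc h Rg, of m]) (use that stabilizer_block[OF Rc R] in auto)
  then have low: "block_lower n K g" using block_lowerI[OF gc] by blast
  define B where "B k = congr n k g (base n K k)" for k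
  have B_adapted: "B k (S, T) = 0" if "\<not> adapted n K S \<or> \<not> adapted n K T" for k S T
    unfolding B_def base_eq_limit_form congr_limit_form[OF gc low one_carrier_mat]
    using that by (auto simp: limit_form_def)
  have frB: "frame n B" unfolding B_def[abs_def] by (rule frame_congr[OF g frame_base])
  have suppB: "supported n k (B k)" for k by (simp add: B_def)
  have lead: "B k (S, T) = 0" if k: "k \<in> {1..n-1}" and ST: "S \<noteq> {..<k} \<or> T \<noteq> {..<k}" for k S T
  proof (cases "S \<in> k_subsets n k \<and> T \<in> k_subsets n k \<and> adapted n K S \<and> adapted n K T")
    case True
    show ?thesis
    proof (cases "k \<in> K")
      case False
      then show ?thesis using adapted_not_mem[OF k False] True ST by auto
    next
      case kK: True
      define I J where I_def: "I = {..<k}" and J_def: "J = insert k {..<k-1}"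
      have Sk: "Suc (k - 1) = k" and kn: "k < n" using k by auto
      have IJ: "I \<in> k_subsets n k" "J \<in> k_subsets n k"
        using insert_k_subsets[of "k - 1" k n] Sk kn by (auto simp: I_def J_def)
      have neq: "I \<noteq> J" unfolding I_def J_def by (metis insertI1 lessThan_iff less_irrefl)
      define \<nu> where "\<nu> = h $$ (k, k - 1)"
      have h_minors: "compound n k h (I, I) = 1" "compound n k h (J, J) = 1"
        "compound n k h (I, J) = 0" "compound n k h (J, I) = \<nu>"
        using compound_unitriangular_diag[OF h'(2,3) IJ(1)] compound_unitriangular_diag[OF h'(2,3) IJ(2)]
          compound_unitriangular[OF h'(2,3), of k J] neq kn
          compound_unitriangular_entry[OF h'(2,3), of "k - 1" k] Sk h'(1)
        by (auto simp: compound_transpose[OF h'(1)] I_def J_def \<nu>_def)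
      have \<nu>: "\<nu> \<noteq> 0" using h'(4)[of "k - 1"] Sk kn by (simp add: \<nu>_def)
      have only: "S \<in> {I, J}" if "S \<in> k_subsets n k" "adapted n K S" for S
        using adapted_special[OF K(1) kK k that] unfolding I_def J_def by blast
      have Bz: "B k (S', T') = 0" if "S' \<notin> {I, J} \<or> T' \<notin> {I, J}" for S' T'
        using that only B_adapted supportedD[OF suppB] by blast
      have hB: "congr n k h (B k) (S, T) = (\<Sum>S'\<in>{I, J}. \<Sum>T'\<in>{I, J}.
          compound n k h (S', S) * B k (S', T') * compound n k h (T', T))" for S T
      proof -
        have "congr n k h (B k) (S, T) = (\<Sum>S'\<in>{I, J}. \<Sum>T'\<in>k_subsets n k.
            compound n k h (S', S) * B k (S', T') * compound n k h (T', T))"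
          unfolding congr_def prod.case
        proof (rule sum.mono_neutral_right)
          show "\<forall>S'\<in>k_subsets n k - {I, J}. (\<Sum>T'\<in>k_subsets n k.
              compound n k h (S', S) * B k (S', T') * compound n k h (T', T)) = 0"
          proof (intro ballI sum.neutral)
            fix S' T' assume "S' \<in> k_subsets n k - {I, J}"
            then show "compound n k h (S', S) * B k (S', T') * compound n k h (T', T) = 0"
              using Bz[of S' T'] by (simp only: Diff_iff simp_thms mult_zero_right mult_zero_left)
          qed
        qed (use IJ in auto)
        also have "\<dots> = (\<Sum>S'\<in>{I, J}. \<Sum>T'\<in>{I, J}.
            compound n k h (S', S) * B k (S', T') * compound n k h (T', T))"
        proof (rule sum.cong[OF refl], rule sum.mono_neutral_right)
          fix S' assume "S' \<in> {I, J}"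
          show "\<forall>T'\<in>k_subsets n k - {I, J}.
              compound n k h (S', S) * B k (S', T') * compound n k h (T', T) = 0"
          proof
            fix T' assume "T' \<in> k_subsets n k - {I, J}"
            then show "compound n k h (S', S) * B k (S', T') * compound n k h (T', T) = 0"
              using Bz[of S' T'] by (simp only: Diff_iff simp_thms mult_zero_right mult_zero_left)
          qed
        qed (use IJ in auto)
        finally show ?thesis .
      qed
      obtain c where c: "congr n k h (B k) = (\<lambda>x. c * B k x)"
        using fixed[symmetric] k unfolding base_point_def trp_pt pt_eq_iff B_def by blast
      define x y z where "x = B k (I, I)" and "y = B k (I, J)" and "z = B k (J, J)"
      have sym: "B k (J, I) = y" using frB k by (auto simp: frame_def sym_mats_def y_def)
      \<comment> \<open>Invariance up to the factor \<open>c\<close>, entry by entry: a nonzero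
        \<open>z\<close>, or else a nonzero \<open>y\<close>, would give \<open>c = 1\<close> and
        then \<open>\<nu> = 0\<close>.\<close>
      have "z = c * z" "y + \<nu> * z = c * y" "x + 2 * \<nu> * y + \<nu> * \<nu> * z = c * x"
        using hB[of J J] hB[of I J] hB[of I I] neq
        unfolding c by (simp_all add: h_minors sym x_def[symmetric] y_def[symmetric] z_def[symmetric] algebra_simps)
      then have "z = 0 \<and> y = 0" using \<nu> by (cases "z = 0"; cases "y = 0") auto
      then show ?thesis using True ST[folded I_def] only[of S] only[of T] sym by (auto simp: y_def z_def)
    qed
  next
    case False
    then show ?thesis using B_adapted supportedD[OF suppB] by blast
  qed
  have "pt n (base n {}) = pt n B"
    unfolding pt_eq_iff
  proof
    fix k assume k: "k \<in> {1..n-1}"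
    let ?c = "B k ({..<k}, {..<k})"
    have eq: "B k = (\<lambda>x. ?c * base n {} k x)"
    proof
      fix x :: "nat set \<times> nat set"
      obtain S T where x: "x = (S, T)" by fastforce
      show "B k x = ?c * base n {} k x"
      proof (cases "S = {..<k} \<and> T = {..<k}")
        case True
        then show ?thesis using k by (auto simp: x base_def)
      next
        case False
        moreover from this have "base n {} k (S, T) = 0"
          using adapted_not_mem[OF k, of "{}" S] by (auto simp: base_def)
        ultimately show ?thesis using lead[OF k, of S T] x by auto
      qed
    qed
    moreover have "?c \<noteq> 0"
    proof
      assume "?c = 0"
      then have "B k = (\<lambda>_. 0)" using eq by simp
      then show False using frB k by (simp add: frame_def)
    qed
    ultimately show "\<exists>c. c \<noteq> 0 \<and> B k = (\<lambda>x. c * base n {} k x)" by blast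
  qed
  then show ?thesis by (simp add: base_point_def trp_pt B_def[abs_def])
qed

section \<open>The irreducible representation\<close>

text \<open>Column \<open>j\<close> holds the coefficients of the image of the monomial \<open>x\<^sup>j y\<^sup>n\<^sup>-\<^sup>1\<^sup>-\<^sup>j\<close>, at \<open>x = z\<close>, \<open>y = 1\<close>.
  In this order of the basis upper triangular matrices are sent to lower triangular ones.\<close>

definition irrep :: "nat \<Rightarrow> complex mat \<Rightarrow> complex mat" where
  "irrep n g = mat n n (\<lambda>(i, j).
     coeff ([:g $$ (1, 0), g $$ (0, 0):] ^ j * [:g $$ (1, 1), g $$ (0, 1):] ^ (n - 1 - j)) i)"

lemma coeff_linear_mult:
  "coeff ([:p, q:] * P) i = p * coeff P i + (if i = 0 then 0 else q * coeff P (i - 1))"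
  by (cases i) (simp_all add: coeff_pCons)

text \<open>The binary form of degree \<open>N\<close> with dehomogenization \<open>P\<close>,
  evaluated at the pair \<open>X\<close>, \<open>Y\<close>.\<close>

definition homogenize :: "nat \<Rightarrow> complex poly \<Rightarrow> complex poly \<Rightarrow> complex poly \<Rightarrow> complex poly" where
  "homogenize N P X Y = (\<Sum>l\<le>N. Polynomial.smult (coeff P l) (X ^ l * Y ^ (N - l)))"

lemma homogenize_linear_mult:
  assumes P: "degree P \<le> N"
  shows "homogenize (Suc N) ([:p, q:] * P) X Y = (Polynomial.smult q X + Polynomial.smult p Y) * homogenize N P X Y"
proof -
  have "homogenize (Suc N) ([:p, q:] * P) X Y
      = (\<Sum>l\<le>Suc N. Polynomial.smult (p * coeff P l) (X ^ l * Y ^ (Suc N - l)))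
      + (\<Sum>l\<le>Suc N. Polynomial.smult (if l = 0 then 0 else q * coeff P (l - 1)) (X ^ l * Y ^ (Suc N - l)))"
    unfolding homogenize_def coeff_linear_mult by (simp only: Polynomial.smult_add_left sum.distrib)
  also have "(\<Sum>l\<le>Suc N. Polynomial.smult (p * coeff P l) (X ^ l * Y ^ (Suc N - l)))
      = (\<Sum>l\<le>N. Polynomial.smult (p * coeff P l) (X ^ l * Y ^ (Suc N - l)))"
    using P coeff_eq_0[of P "Suc N"] by simp
  also have "\<dots> = Polynomial.smult p Y * homogenize N P X Y"
    unfolding homogenize_def sum_distrib_left
    by (intro sum.cong refl) (auto simp: Suc_diff_le algebra_simps)
  also have "(\<Sum>l\<le>Suc N. Polynomial.smult (if l = 0 then 0 else q * coeff P (l - 1)) (X ^ l * Y ^ (Suc N - l)))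
      = (\<Sum>l\<le>N. Polynomial.smult (q * coeff P l) (X ^ Suc l * Y ^ (N - l)))"
    by (subst sum.atMost_Suc_shift) simp
  also have "\<dots> = Polynomial.smult q X * homogenize N P X Y"
    unfolding homogenize_def sum_distrib_left by (intro sum.cong refl) (auto simp: algebra_simps)
  finally show ?thesis by (simp add: algebra_simps)
qed

lemma degree_linear_power: "degree ([:p, q:] ^ j * P) \<le> j + degree P"
  by (rule order.trans[OF degree_mult_le]) (use degree_power_le[of "[:p, q:]" j] in
      \<open>auto intro!: add_mono order.trans[OF degree_power_le]\<close>)

lemma homogenize_linear_power:
  assumes "degree P \<le> N"
  shows "homogenize (j + N) ([:p, q:] ^ j * P) X Y = (Polynomial.smult q X + Polynomial.smult p Y) ^ j * homogenize N P X Y"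
proof (induction j)
  case (Suc j)
  have "degree ([:p, q:] ^ j * P) \<le> j + N" using degree_linear_power[of p q j P] assms by linarith
  then have "homogenize (Suc (j + N)) ([:p, q:] * ([:p, q:] ^ j * P)) X Y
      = (Polynomial.smult q X + Polynomial.smult p Y) * homogenize (j + N) ([:p, q:] ^ j * P) X Y"
    by (rule homogenize_linear_mult)
  then show ?case by (simp only: Suc.IH power_Suc add_Suc mult.assoc)
qed simp

lemma homogenize_linear_product:
  assumes "j \<le> N"
  shows "homogenize N ([:p, q:] ^ j * [:r, s:] ^ (N - j)) X Y
    = (Polynomial.smult q X + Polynomial.smult p Y) ^ j * (Polynomial.smult s X + Polynomial.smult r Y) ^ (N - j)"
proof -
  have "homogenize (N - j + 0) ([:r, s:] ^ (N - j) * 1) X Y = (Polynomial.smult s X + Polynomial.smult r Y) ^ (N - j) * homogenize 0 1 X Y"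
    by (rule homogenize_linear_power) simp
  moreover have "homogenize (j + (N - j)) ([:p, q:] ^ j * [:r, s:] ^ (N - j)) X Y
      = (Polynomial.smult q X + Polynomial.smult p Y) ^ j * homogenize (N - j) ([:r, s:] ^ (N - j)) X Y"
    by (rule homogenize_linear_power) (use degree_linear_power[of r s "N - j" 1] in simp)
  ultimately show ?thesis using assms by (simp add: homogenize_def)
qed

lemma irrep_carrier [simp]: "irrep n g \<in> carrier_mat n n"
  by (simp add: irrep_def)

lemma irrep_dim [simp]: "dim_row (irrep n g) = n" "dim_col (irrep n g) = n"
  by (simp_all add: irrep_def)

text \<open>Column \<open>j\<close> for \<open>h\<close> represents a product of linear forms.
  Applying \<open>g\<close> substitutes the two linear forms of \<open>g\<close> into it, and
  substitution turns each factor into the corresponding linear form of \<open>g * h\<close>.\<close>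

lemma irrep_mult:
  assumes g: "g \<in> carrier_mat 2 2" and h: "h \<in> carrier_mat 2 2"
  shows "irrep n (g * h) = irrep n g * irrep n h"
proof (rule eq_matI)
  fix i j assume "i < dim_row (irrep n g * irrep n h)" "j < dim_col (irrep n g * irrep n h)"
  then have ij: "i < n" "j < n" by (auto simp: irrep_def)
  let ?N = "n - 1"
  let ?X = "[:g $$ (1, 0), g $$ (0, 0):]" and ?Y = "[:g $$ (1, 1), g $$ (0, 1):]"
  let ?P = "[:h $$ (1, 0), h $$ (0, 0):] ^ j * [:h $$ (1, 1), h $$ (0, 1):] ^ (?N - j)"
  have gh: "(g * h) $$ (a, b) = g $$ (a, 0) * h $$ (0, b) + g $$ (a, 1) * h $$ (1, b)" if "a < 2" "b < 2" for a b
    using g h that by (auto simp: scalar_prod_def numeral_2_eq_2)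
  have "homogenize ?N ?P ?X ?Y = (Polynomial.smult (h $$ (0, 0)) ?X + Polynomial.smult (h $$ (1, 0)) ?Y) ^ j
      * (Polynomial.smult (h $$ (0, 1)) ?X + Polynomial.smult (h $$ (1, 1)) ?Y) ^ (?N - j)"
    by (rule homogenize_linear_product) (use ij in auto)
  also have "Polynomial.smult (h $$ (0, 0)) ?X + Polynomial.smult (h $$ (1, 0)) ?Y = [:(g * h) $$ (1, 0), (g * h) $$ (0, 0):]"
    by (simp add: gh mult.commute)
  also have "Polynomial.smult (h $$ (0, 1)) ?X + Polynomial.smult (h $$ (1, 1)) ?Y = [:(g * h) $$ (1, 1), (g * h) $$ (0, 1):]"
    by (simp add: gh mult.commute)
  finally have "irrep n (g * h) $$ (i, j) = coeff (homogenize ?N ?P ?X ?Y) i"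
    using ij by (simp add: irrep_def)
  also have "\<dots> = (\<Sum>l\<le>?N. coeff (?X ^ l * ?Y ^ (?N - l)) i * coeff ?P l)"
    by (simp add: homogenize_def coeff_sum mult.commute)
  also have "{..?N} = {0..<n}" using ij by auto
  also have "(\<Sum>l\<in>{0..<n}. coeff (?X ^ l * ?Y ^ (?N - l)) i * coeff ?P l) = (irrep n g * irrep n h) $$ (i, j)"
    using ij by (simp add: irrep_def scalar_prod_def)
  finally show "irrep n (g * h) $$ (i, j) = (irrep n g * irrep n h) $$ (i, j)" .
qed (auto simp: irrep_def)

section \<open>Unipotent matrices of size two and their images\<close>

definition upper :: "complex \<Rightarrow> complex mat" where
  "upper b = mat_of_rows_list 2 [[1, b], [0, 1]]"

definition lower :: "complex \<Rightarrow> complex mat" where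
  "lower c = mat_of_rows_list 2 [[1, 0], [c, 1]]"

lemma upper_index [simp]:
  "upper b \<in> carrier_mat 2 2" "dim_row (upper b) = 2" "dim_col (upper b) = 2"
  "upper b $$ (0, 0) = 1" "upper b $$ (0, Suc 0) = b"
  "upper b $$ (Suc 0, 0) = 0" "upper b $$ (Suc 0, Suc 0) = 1"
  by (auto simp: upper_def mat_of_rows_list_def)

lemma lower_index [simp]:
  "lower c \<in> carrier_mat 2 2" "dim_row (lower b) = 2" "dim_col (lower b) = 2"
  "lower c $$ (0, 0) = 1" "lower c $$ (0, Suc 0) = 0"
  "lower c $$ (Suc 0, 0) = c" "lower c $$ (Suc 0, Suc 0) = 1"
  by (auto simp: lower_def mat_of_rows_list_def)

lemma unipotent_SL2_eq: "unipotent_SL2 = range upper"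
  by (auto simp: unipotent_SL2_def upper_def)

lemma det_2x2:
  fixes g :: "complex mat"
  assumes "g \<in> carrier_mat 2 2"
  shows "det g = g $$ (0, 0) * g $$ (1, 1) - g $$ (0, 1) * g $$ (1, 0)"
proof -
  have "cofactor g i 0 = (-1) ^ i * g $$ (1 - i, 1)" if "i < 2" for i
  proof -
    have "mat_delete g i 0 \<in> carrier_mat 1 1" using mat_delete_carrier[OF assms] by simp
    then have "det (mat_delete g i 0) = mat_delete g i 0 $$ (0, 0)" by (rule det_single)
    then show ?thesis using assms that by (auto simp: cofactor_def mat_delete_def less_2_cases_iff)
  qed
  then show ?thesis
    using laplace_expansion_column[OF assms, of 0] by (simp add: numeral_2_eq_2)
qed

lemma mat2_eqI:
  fixes g h :: "complex mat"
  assumes "g \<in> carrier_mat 2 2" "h \<in> carrier_mat 2 2"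
    "g $$ (0, 0) = h $$ (0, 0)" "g $$ (0, 1) = h $$ (0, 1)"
    "g $$ (1, 0) = h $$ (1, 0)" "g $$ (1, 1) = h $$ (1, 1)"
  shows "g = h"
  by (rule eq_matI) (use assms in \<open>auto simp: less_2_cases_iff\<close>)

lemma upper_SL: "upper b \<in> carrier (SL 2)"
  by (auto simp: SL_def det_2x2)

lemma mult2_index:
  fixes g h :: "complex mat"
  assumes "g \<in> carrier_mat 2 2" "h \<in> carrier_mat 2 2" "a < 2" "b < 2"
  shows "(g * h) $$ (a, b) = g $$ (a, 0) * h $$ (0, b) + g $$ (a, 1) * h $$ (1, b)"
  using assms by (auto simp: scalar_prod_def numeral_2_eq_2)

lemma upper_mult: "upper a * upper b = upper (a + b)"
  by (rule mat2_eqI) (auto simp: mult2_index intro: mult_carrier_mat simp del: index_mult_mat(1))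

lemma upper_0: "upper 0 = 1\<^sub>m 2"
  by (rule mat2_eqI) auto

lemma coeff_lower_power: "coeff ([:0, 1:] ^ j * P) i = (if j \<le> i then coeff P (i - j) else (0 :: complex))"
proof -
  have "[:0, 1:] ^ j = (monom 1 j :: complex poly)" by (simp add: monom_altdef)
  then show ?thesis by (simp only: coeff_monom_mult) simp
qed

lemma irrep_upper_index:
  assumes "i < n" "j < n"
  shows "irrep n (upper b) $$ (i, j) = (if j \<le> i then coeff ([:1, b:] ^ (n - 1 - j)) (i - j) else 0)"
  using assms by (simp add: irrep_def coeff_lower_power)

lemma coeff_0_linear_power: "coeff ([:p, q:] ^ m) 0 = p ^ m"
  by (induction m) (simp_all add: coeff_linear_mult)

lemma coeff_1_linear_power: "coeff ([:1, q:] ^ m) (Suc 0) = of_nat m * q"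
  by (induction m) (simp_all add: coeff_linear_mult coeff_0_linear_power algebra_simps)

lemma irrep_upper_unitriangular: "unitriangular (transpose_mat (irrep n (upper b)))"
  unfolding unitriangular_def
proof (intro allI impI conjI)
  fix i assume "i < dim_row (transpose_mat (irrep n (upper b)))"
  then have i: "i < n" by (simp add: irrep_def)
  then show "transpose_mat (irrep n (upper b)) $$ (i, i) = 1"
    by (simp add: irrep_upper_index coeff_0_linear_power)
  fix j assume "j < i"
  then show "transpose_mat (irrep n (upper b)) $$ (i, j) = 0" using i by (simp add: irrep_upper_index)
qed

lemma irrep_upper_regular:
  assumes "b \<noteq> 0"
  shows "regular_lower n (irrep n (upper b))"
  unfolding regular_lower_def
proof (intro conjI allI impI irrep_upper_unitriangular irrep_carrier)
  fix i assume i: "Suc i < n"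
  then have "irrep n (upper b) $$ (Suc i, i) = of_nat (n - 1 - i) * b"
    by (simp add: irrep_upper_index coeff_1_linear_power del: of_nat_diff)
  moreover have "n - 1 - i \<noteq> 0" using i by simp
  then have "of_nat (n - 1 - i) \<noteq> (0 :: complex)" by (simp only: of_nat_eq_0_iff not_False_eq_True)
  ultimately show "irrep n (upper b) $$ (Suc i, i) \<noteq> 0" using assms by (metis mult_eq_0_iff)
qed

lemma det_irrep_upper: "det (irrep n (upper b)) = 1"
proof -
  have "transpose_mat (irrep n (upper b)) \<in> carrier_mat n n" by simp
  then show ?thesis
    using det_unitriangular[OF _ irrep_upper_unitriangular] det_transpose[OF irrep_carrier] by metis
qed

lemma det_irrep_lower: "det (irrep n (lower c)) = 1"
proof (rule det_unitriangular[OF irrep_carrier])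
  have "irrep n (lower c) $$ (i, j) = coeff ([:c, 1:] ^ j) i" if "i < n" "j < n" for i j
    using that by (simp add: irrep_def one_pCons[symmetric])
  moreover have "coeff ([:c, 1:] ^ j) i = 0" if "j < i" for i j
    using degree_linear_power[of c 1 j 1] that by (intro coeff_eq_0) simp
  moreover have "coeff ([:c, 1:] ^ i) i = 1" for i
  proof (induction i)
    case (Suc i)
    then show ?case using calculation(2)[of i "Suc i"] by (simp add: coeff_linear_mult)
  qed simp
  ultimately show "unitriangular (irrep n (lower c))" by (auto simp: unitriangular_def irrep_def)
qed

text \<open>Upper and lower unipotent matrices have triangular images of determinant one, and they
  generate the group: an element with nonzero lower left entry is a product of three of them, and
  any other becomes such an element after multiplication by \<open>lower 1\<close>.\<close>

lemma det_irrep: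
  assumes g: "g \<in> carrier (SL 2)"
  shows "det (irrep n g) = 1"
proof -
  have mult: "det (irrep n (g * h)) = det (irrep n g) * det (irrep n h)"
    if "g \<in> carrier_mat 2 2" "h \<in> carrier_mat 2 2" for g h
    using irrep_mult[OF that] det_mult[OF irrep_carrier irrep_carrier] by simp
  have generic: "det (irrep n g) = 1"
    if g: "g \<in> carrier_mat 2 2" "det g = 1" and c: "g $$ (1, 0) \<noteq> 0" for g
  proof -
    \<comment> \<open>Read off from the diagonal of \<open>upper x * lower c * upper y\<close>,
      which consists of \<open>1 + x c\<close> and \<open>1 + c y\<close>.\<close>
    let ?x = "(g $$ (0, 0) - 1) / g $$ (1, 0)" and ?y = "(g $$ (1, 1) - 1) / g $$ (1, 0)"
    have d: "g $$ (0, 0) * g $$ (1, 1) = 1 + g $$ (0, 1) * g $$ (1, 0)" 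
      using g(2) det_2x2[OF g(1)] by (metis add.commute diff_add_cancel)
    have ul: "upper ?x * lower (g $$ (1, 0)) \<in> carrier_mat 2 2"
      by (rule mult_carrier_mat[of _ 2 2]) simp_all
    have "g = upper ?x * lower (g $$ (1, 0)) * upper ?y"
      by (rule mat2_eqI) (use g(1) c d ul in \<open>auto simp: mult2_index field_simps intro: mult_carrier_mat simp del: index_mult_mat(1)\<close>)
    then have "det (irrep n g) = det (irrep n (upper ?x * lower (g $$ (1, 0)))) * det (irrep n (upper ?y))"
      using mult[OF ul upper_index(1)] by metis
    then show ?thesis using mult[OF upper_index(1) lower_index(1)]
      by (simp add: det_irrep_upper det_irrep_lower)
  qed
  have g': "g \<in> carrier_mat 2 2" "det g = 1" using g by (auto simp: SL_def)
  show ?thesis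
  proof (cases "g $$ (1, 0) = 0")
    case True
    have "g * lower 1 \<in> carrier_mat 2 2" using g'(1) lower_index(1) by (rule mult_carrier_mat)
    moreover have "det (g * lower 1) = 1"
      using det_mult[OF g'(1) lower_index(1)] g'(2) by (simp add: det_2x2)
    moreover have "(g * lower 1) $$ (1, 0) \<noteq> 0"
      using g' True by (auto simp: mult2_index det_2x2 simp del: index_mult_mat(1))
    ultimately have "det (irrep n (g * lower 1)) = 1" by (rule generic)
    then show ?thesis using mult[OF g'(1) lower_index(1)] by (simp add: det_irrep_lower)
  qed (use generic g' in blast)
qed

lemma irrep_one: "irrep n (1\<^sub>m 2) = 1\<^sub>m n"
proof (rule eq_matI)
  fix i j assume "i < dim_row (1\<^sub>m n :: complex mat)" "j < dim_col (1\<^sub>m n :: complex mat)"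
  then show "irrep n (1\<^sub>m 2) $$ (i, j) = 1\<^sub>m n $$ (i, j)"
    using irrep_upper_index[of i n j 0] by (auto simp: upper_0 one_pCons[symmetric])
qed (auto simp: irrep_def)

lemma poly_funs_coeff_linear_power:
  assumes "p \<in> poly_funs C" "q \<in> poly_funs C" "\<And>i. (\<lambda>v. coeff (P v) i) \<in> poly_funs C"
  shows "(\<lambda>v. coeff ([:p v, q v:] ^ j * P v) i) \<in> poly_funs C"
proof (induction j arbitrary: i)
  case 0
  then show ?case using assms(3) by simp
next
  case (Suc j)
  have "(\<lambda>v. coeff ([:p v, q v:] ^ Suc j * P v) i) = (\<lambda>v. p v * coeff ([:p v, q v:] ^ j * P v) i
      + (if i = 0 then 0 else q v * coeff ([:p v, q v:] ^ j * P v) (i - 1)))"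
    by (simp only: power_Suc mult.assoc coeff_linear_mult)
  also have "\<dots> \<in> poly_funs C"
    by (intro poly_funs.add poly_funs.mult poly_funs_if poly_funs.const assms(1,2) Suc.IH)
  finally show ?case .
qed

lemma SL_simps:
  "carrier (SL n) = {g \<in> carrier_mat n n. det g = 1}" "g \<otimes>\<^bsub>SL n\<^esub> h = g * h" "\<one>\<^bsub>SL n\<^esub> = 1\<^sub>m n"
  by (simp_all add: SL_def)

lemma irrep_algebraic_hom: "irrep n \<in> algebraic_hom 2 n"
proof -
  have "irrep n \<in> hom (SL 2) (SL n)"
    by (rule homI) (use det_irrep irrep_mult in \<open>auto simp: SL_simps\<close>)
  moreover have "\<exists>f\<in>poly_funs {\<lambda>g. g $$ (k, l) | k l. k < 2 \<and> l < 2}.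
      \<forall>g\<in>carrier (SL 2). irrep n g $$ (i, j) = f g" if "i < n" "j < n" for i j
  proof -
    let ?C = "{\<lambda>g :: complex mat. g $$ (k, l) | k l. k < 2 \<and> l < 2}"
    have entry: "(\<lambda>g. g $$ (k, l)) \<in> poly_funs ?C" if "k < 2" "l < 2" for k l
      using that by (intro poly_funs.coord) auto
    have "(\<lambda>g. coeff ([:g $$ (1, 1), g $$ (0, 1):] ^ (n - 1 - j) * 1) i) \<in> poly_funs ?C" for i
      by (rule poly_funs_coeff_linear_power) (auto intro: entry poly_funs.const)
    then have "(\<lambda>g. coeff ([:g $$ (1, 0), g $$ (0, 0):] ^ j * [:g $$ (1, 1), g $$ (0, 1):] ^ (n - 1 - j)) i)
        \<in> poly_funs ?C"
      by (intro poly_funs_coeff_linear_power entry) auto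
    then show ?thesis using that by (rule_tac bexI) (auto simp: irrep_def)
  qed
  ultimately show ?thesis by (auto simp: algebraic_hom_def)
qed

text \<open>All monomials are fixed. The two pure powers force the matrix to be diagonal, and
  comparison with the monomial next to a pure power makes the two diagonal entries equal.\<close>

lemma irrep_kernel:
  assumes n: "2 \<le> n" and g: "g \<in> carrier (SL 2)" "irrep n g = 1\<^sub>m n"
  shows "g $$ (1, 0) = 0" "g $$ (0, 1) = 0" "g $$ (0, 0) ^ (n - 1) = 1"
    "g $$ (1, 1) = g $$ (0, 0)" "g $$ (0, 0) * g $$ (1, 1) = 1"
proof -
  let ?X = "[:g $$ (1, 0), g $$ (0, 0):]" and ?Y = "[:g $$ (1, 1), g $$ (0, 1):]"
  have col: "?X ^ j * ?Y ^ (n - 1 - j) = monom 1 j" if j: "j < n" for j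
  proof (rule poly_eqI)
    fix i
    show "coeff (?X ^ j * ?Y ^ (n - 1 - j)) i = coeff (monom 1 j) i"
    proof (cases "i < n")
      case True
      then have "irrep n g $$ (i, j) = 1\<^sub>m n $$ (i, j)" using g(2) by simp
      then show ?thesis using True j by (auto simp: irrep_def)
    next
      case False
      have "degree (?X ^ j * (?Y ^ (n - 1 - j) * 1)) \<le> j + (n - 1 - j + 0)"
        using degree_linear_power[of "g $$ (1, 0)" "g $$ (0, 0)" j "?Y ^ (n - 1 - j) * 1"]
          degree_linear_power[of "g $$ (1, 1)" "g $$ (0, 1)" "n - 1 - j" 1] by simp
      then have "degree (?X ^ j * ?Y ^ (n - 1 - j)) < i" using False j by simp
      then show ?thesis using False j by (simp add: coeff_eq_0)
    qed
  qed
  have g': "g \<in> carrier_mat 2 2" "det g = 1" using g by (auto simp: SL_simps)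
  have X: "?X ^ (n - 1) = monom 1 (n - 1)" using col[of "n - 1"] n by simp
  have "poly (?X ^ (n - 1)) 0 = 0" unfolding X using n by (simp add: poly_monom)
  then show c: "g $$ (1, 0) = 0" by simp
  have Y: "?Y ^ (n - 1) = 1" using col[of 0] n by (simp add: one_pCons)
  show b: "g $$ (0, 1) = 0"
  proof (rule ccontr)
    assume b: "g $$ (0, 1) \<noteq> 0"
    have "poly (?Y ^ (n - 1)) (- g $$ (1, 1) / g $$ (0, 1)) = 0" using b n by simp
    then show False unfolding Y by simp
  qed
  have "poly (?X ^ (n - 1)) 1 = 1" unfolding X by (simp add: poly_monom)
  then show a: "g $$ (0, 0) ^ (n - 1) = 1" using c by simp
  show ad: "g $$ (0, 0) * g $$ (1, 1) = 1" using g' b c by (simp add: det_2x2)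
  have "poly (?X ^ (n - 2) * ?Y ^ (n - 1 - (n - 2))) 1 = 1"
    using col[of "n - 2"] n by (simp add: poly_monom)
  moreover have "n - 1 - (n - 2) = 1" "n - 1 = Suc (n - 2)" using n by auto
  ultimately have "g $$ (0, 0) ^ (n - 2) * g $$ (1, 1) = 1" using b c by (simp add: mult.commute)
  then have "g $$ (0, 0) ^ (n - 1) * g $$ (1, 1) = g $$ (0, 0)"
    unfolding \<open>n - 1 = Suc (n - 2)\<close> by (simp add: mult.assoc)
  then show "g $$ (1, 1) = g $$ (0, 0)" using a by simp
qed

lemma irrep_finite_kernel:
  assumes n: "2 \<le> n"
  shows "finite (kernel (SL 2) (SL n) (irrep n))"
proof (rule finite_subset)
  let ?f = "\<lambda>a :: complex. mat 2 2 (\<lambda>(i, j). if i = j then a else 0)"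
  show "kernel (SL 2) (SL n) (irrep n) \<subseteq> ?f ` {a. a ^ (n - 1) = 1}"
  proof
    fix g assume "g \<in> kernel (SL 2) (SL n) (irrep n)"
    then have g: "g \<in> carrier (SL 2)" "irrep n g = 1\<^sub>m n" by (auto simp: kernel_def SL_simps)
    note k = irrep_kernel[OF n g]
    have "g = ?f (g $$ (0, 0))"
      by (rule mat2_eqI) (use g k in \<open>auto simp: SL_simps\<close>)
    then show "g \<in> ?f ` {a. a ^ (n - 1) = 1}" using k(3) by blast
  qed
  have "monom 1 (n - 1) - 1 \<noteq> (0 :: complex poly)"
  proof
    assume "monom 1 (n - 1) - 1 = (0 :: complex poly)"
    then have "poly (monom 1 (n - 1) - 1) 0 = (0 :: complex)" by simp
    then have "(0 :: complex) ^ (n - 1) = 1" by (simp add: poly_monom)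
    moreover have "(0 :: complex) ^ (n - 1) = 0" using n by (intro zero_power) simp
    ultimately show False by simp
  qed
  then have "finite {a. poly (monom 1 (n - 1) - 1) a = (0 :: complex)}" by (rule poly_roots_finite)
  then show "finite (?f ` {a. a ^ (n - 1) = 1})" by (simp add: poly_monom)
qed

text \<open>An element of the kernel is a scalar of square one, and \<open>-1\<close> acts as
  \<open>(-1)^(n - 1)\<close>, which differs from one for even \<open>n\<close>.\<close>

lemma irrep_inj:
  assumes n: "2 \<le> n" "even n"
  shows "inj_on (irrep n) (carrier (SL 2))"
proof -
  interpret group_hom "SL 2" "SL n" "irrep n"
    using irrep_algebraic_hom[of n] by (intro group_hom.intro group_hom_axioms.intro group_SL)
      (auto simp: algebraic_hom_def)
  have "g = 1\<^sub>m 2" if g: "g \<in> carrier (SL 2)" "irrep n g = 1\<^sub>m n" for g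
  proof -
    note k = irrep_kernel[OF n(1) g]
    have "g $$ (0, 0) * g $$ (0, 0) = 1" using k(4,5) by simp
    then have "g $$ (0, 0) = 1 \<or> g $$ (0, 0) = -1" by (simp add: square_eq_1_iff)
    moreover have "g $$ (0, 0) \<noteq> -1"
    proof
      assume "g $$ (0, 0) = -1"
      moreover have "odd (n - 1)" using n by simp
      ultimately show False using k(3) by simp
    qed
    ultimately show ?thesis using k g by (intro mat2_eqI) (auto simp: SL_simps)
  qed
  then have "kernel (SL 2) (SL n) (irrep n) = {\<one>\<^bsub>SL 2\<^esub>}"
    by (auto simp: kernel_def SL_simps irrep_one)
  then show ?thesis by (simp add: inj_iff_trivial_ker)
qed

lemma hom_inv_upper:
  assumes "\<phi> \<in> hom (SL 2) (SL n)"
  shows "inv\<^bsub>SL n\<^esub> (\<phi> (upper b)) = \<phi> (upper (- b))"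
proof -
  interpret group_hom "SL 2" "SL n" \<phi>
    using assms by (intro group_hom.intro group_hom_axioms.intro group_SL) auto
  have "upper (- b) \<otimes>\<^bsub>SL 2\<^esub> upper b = \<one>\<^bsub>SL 2\<^esub>" by (simp add: SL_simps upper_mult upper_0)
  then have "inv\<^bsub>SL 2\<^esub> (upper b) = upper (- b)" by (rule G.inv_equality[OF _ upper_SL upper_SL])
  then show ?thesis using hom_inv[OF upper_SL] by metis
qed

lemma special_unique_fixed_point:
  assumes n: "2 \<le> n" and I: "I \<subseteq> {1..n-1}" "special I"
  shows "one_unipotent_fixed_point n (irrep n) (stratum_closure n I)"
  unfolding one_unipotent_fixed_point_def
proof (rule ex1I)
  have hom: "irrep n \<in> hom (SL 2) (SL n)" using irrep_algebraic_hom by (auto simp: algebraic_hom_def)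
  have act: "act n (irrep n (upper b)) p = trp n (irrep n (upper (- b))) p" for b p
    by (simp add: act_eq_trp hom_inv_upper[OF hom])
  have one: "1\<^sub>m n \<in> GL n" by (simp add: GL_def)
  have "trp n (1\<^sub>m n) (base_point n {}) \<in> stratum_closure n I"
    by (subst stratum_closure_iff[OF n I(1) one]) auto
  then have "base_point n {} \<in> stratum_closure n I" by (simp add: trp_one base_point_ambient)
  moreover have "act n (irrep n (upper b)) (base_point n {}) = base_point n {}" for b
    unfolding act by (rule lower_fixes_base_point[OF irrep_carrier irrep_upper_unitriangular])
  ultimately show "base_point n {} \<in> stratum_closure n I \<and>
      (\<forall>u\<in>unipotent_SL2. act n (irrep n u) (base_point n {}) = base_point n {})"
    by (auto simp: unipotent_SL2_eq)
  fix p assume p: "p \<in> stratum_closure n I \<and> (\<forall>u\<in>unipotent_SL2. act n (irrep n u) p = p)"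
  obtain g K where gK: "g \<in> GL n" "K \<subseteq> reflected n I" "p = trp n g (base_point n K)"
    using stratum_closure_normal_form[OF n I(1)] p by metis
  have "special K" using gK(2) special_reflected[OF I(1)] I(2) unfolding special_def by blast
  moreover have "K \<subseteq> {1..n-1}" using gK(2) reflected_subset by blast
  \<comment> \<open>A single nontrivial element already determines the fixed point.\<close>
  moreover have "act n (irrep n (upper 1)) p = p" using p by (auto simp: unipotent_SL2_eq)
  then have "trp n (irrep n (upper (- 1))) p = p" by (simp only: act)
  ultimately show "p = base_point n {}"
    unfolding gK(3) by (intro regular_unipotent_fixed_point[OF _ _ gK(1) irrep_upper_regular]) auto
qed

section \<open>Unipotent one-parameter subgroups\<close>

text \<open>Identities obtained by induction for the powers of one element extend in this way to a
  whole one-parameter group.\<close>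

lemma univariate_eq_on_nat:
  assumes "f \<in> poly_funs {\<lambda>s. s}" "g \<in> poly_funs {\<lambda>s. s}" "\<And>k. f (of_nat k) = g (of_nat k)"
  shows "f s = g s"
proof -
  have "infinite (range (of_nat :: nat \<Rightarrow> complex))"
    using finite_imageD[of "of_nat :: nat \<Rightarrow> complex" UNIV] by (auto simp: inj_of_nat)
  moreover have "range of_nat \<subseteq> {s. f s - g s = 0}" using assms(3) by auto
  ultimately have "infinite {s. f s - g s = 0}" using infinite_super by blast
  then have "f s - g s = 0" using univariate_eq_0[OF poly_funs_diff[OF assms(1,2)]] by blast
  then show ?thesis by simp
qed

text \<open>A unit of the polynomial ring is constant. This excludes nontrivial characters on the
  diagonal of a one-parameter group with polynomial entries.\<close>

lemma polynomial_unit_constant: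
  assumes f: "f \<in> poly_funs {\<lambda>s. s}" and unit: "\<And>s. f s * f (- s) = 1"
  shows "f s = f 0"
proof -
  obtain p where p: "f = poly p" using poly_funs_univariate[OF f] by blast
  have "poly (p * pcompose p [:0, -1:]) = poly 1"
    using unit by (auto simp: p poly_pcompose fun_eq_iff)
  then have "p * pcompose p [:0, -1:] = 1" by (simp only: poly_eq_poly_eq_iff)
  then have "p dvd 1" by (metis dvd_triv_left)
  then have "degree p = 0" by (simp add: is_unit_iff_degree poly_dvd_1)
  then obtain c where "p = [:c:]" by (rule degree_eq_zeroE)
  then show ?thesis by (simp add: p)
qed

lemma index_mult_square:
  assumes "A \<in> carrier_mat n n" "B \<in> carrier_mat n n" "i < n" "j < n"
  shows "(A * B) $$ (i, j) = (\<Sum>k<n. A $$ (i, k) * B $$ (k, j))"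
  using assms by (simp add: scalar_prod_def atLeast0LessThan)

lemma mult_lower_index:
  assumes A: "A \<in> carrier_mat n n" "\<And>i j. i < j \<Longrightarrow> j < n \<Longrightarrow> A $$ (i, j) = (0 :: complex)"
    and B: "B \<in> carrier_mat n n" "\<And>i j. i < j \<Longrightarrow> j < n \<Longrightarrow> B $$ (i, j) = 0"
    and ij: "i < n" "j < n"
  shows "(A * B) $$ (i, j) = (\<Sum>k\<in>{j..i}. A $$ (i, k) * B $$ (k, j))"
proof -
  have "(A * B) $$ (i, j) = (\<Sum>k<n. A $$ (i, k) * B $$ (k, j))"
    using A(1) B(1) ij by (auto simp: scalar_prod_def atLeast0LessThan intro!: sum.cong)
  also have "\<dots> = (\<Sum>k\<in>{j..i}. A $$ (i, k) * B $$ (k, j))"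
  proof (rule sum.mono_neutral_right)
    show "\<forall>k\<in>{..<n} - {j..i}. A $$ (i, k) * B $$ (k, j) = 0"
    proof
      fix k assume "k \<in> {..<n} - {j..i}"
      then have "k < n" "k < j \<or> i < k" by auto
      then show "A $$ (i, k) * B $$ (k, j) = 0" using A(2)[of i k] B(2)[of k j] ij by auto
    qed
  qed (use ij in auto)
  finally show ?thesis .
qed

text \<open>What the image of the unipotent subgroup becomes in a triangularizing basis, with its
  additive parameter.\<close>

locale unipotent_subgroup =
  fixes n :: nat and R :: "complex \<Rightarrow> complex mat"
  assumes carrier: "R b \<in> carrier_mat n n"
    and lower: "i < j \<Longrightarrow> j < n \<Longrightarrow> R b $$ (i, j) = 0"
    and diag_1: "i < n \<Longrightarrow> R b $$ (i, i) = 1"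
    and add: "R (a + b) = R a * R b"
    and poly: "i < n \<Longrightarrow> j < n \<Longrightarrow> (\<lambda>b. R b $$ (i, j)) \<in> poly_funs {\<lambda>s. s}"
begin

lemma R_unitriangular: "unitriangular (transpose_mat (R b))"
  using carrier[of b] lower diag_1 by (auto simp: unitriangular_def)

lemma R_add_index:
  "i < n \<Longrightarrow> j < n \<Longrightarrow> R (a + b) $$ (i, j) = (\<Sum>k\<in>{j..i}. R a $$ (i, k) * R b $$ (k, j))"
  unfolding add by (rule mult_lower_index[OF carrier lower carrier lower])

lemma R_0: "R 0 = 1\<^sub>m n"
proof -
  have "det (R 0) = 1"
    using det_unitriangular[OF _ R_unitriangular[of 0], of n] det_transpose[OF carrier] carrier by simp
  then have "R 0 \<in> GL n" using carrier by (simp add: GL_def)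
  then obtain S where S: "S \<in> GL n" "R 0 * S = 1\<^sub>m n" using GL_inverse by metis
  have "R 0 * (R 0 * S) = R 0 * R 0 * S"
    by (rule assoc_mult_mat[OF carrier carrier GL_carrier[OF S(1)], symmetric])
  then show ?thesis using add[of 0 0] S(2) carrier[of 0] by simp
qed

lemma subdiagonal:
  assumes i: "Suc i < n"
  shows "R b $$ (Suc i, i) = b * R 1 $$ (Suc i, i)"
proof (rule univariate_eq_on_nat[where f = "\<lambda>b. R b $$ (Suc i, i)" and g = "\<lambda>b. b * R 1 $$ (Suc i, i)"])
  show "(\<lambda>b. R b $$ (Suc i, i)) \<in> poly_funs {\<lambda>s. s}" using i by (intro poly) auto
  show "(\<lambda>b. b * R 1 $$ (Suc i, i)) \<in> poly_funs {\<lambda>s. s}"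
    by (intro poly_funs.mult poly_funs_id poly_funs.const)
  have set: "{i..Suc i} = {i, Suc i}" by auto
  have plus: "R (a + b) $$ (Suc i, i) = R a $$ (Suc i, i) + R b $$ (Suc i, i)" for a b
    using R_add_index[of "Suc i" i a b] i by (simp add: set diag_1)
  show "R (of_nat k) $$ (Suc i, i) = of_nat k * R 1 $$ (Suc i, i)" for k
  proof (induction k)
    case (Suc k)
    then show ?case using plus[of 1 "of_nat k"] by (simp add: algebra_simps)
  qed (use i R_0 in simp)
qed

text \<open>The recursion for consecutive powers is solved by a binomial coefficient, whence the
  term \<open>b * b - b\<close>; doubling avoids denominators.\<close>

lemma second_subdiagonal:
  assumes i: "Suc (Suc i) < n"
  shows "2 * R b $$ (Suc (Suc i), i) = 2 * R 1 $$ (Suc (Suc i), i) * b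
    + R 1 $$ (Suc i, i) * R 1 $$ (Suc (Suc i), Suc i) * (b * b - b)"
proof (rule univariate_eq_on_nat[where f = "\<lambda>b. 2 * R b $$ (Suc (Suc i), i)" and g = "\<lambda>b.
    2 * R 1 $$ (Suc (Suc i), i) * b + R 1 $$ (Suc i, i) * R 1 $$ (Suc (Suc i), Suc i) * (b * b - b)"])
  let ?\<beta> = "R 1 $$ (Suc (Suc i), i)" and ?\<alpha> = "R 1 $$ (Suc i, i)" and ?\<gamma> = "R 1 $$ (Suc (Suc i), Suc i)"
  show "(\<lambda>b. 2 * R b $$ (Suc (Suc i), i)) \<in> poly_funs {\<lambda>s. s}"
    by (intro poly_funs.mult poly_funs.const poly) (use i in auto)
  show "(\<lambda>b. 2 * ?\<beta> * b + ?\<alpha> * ?\<gamma> * (b * b - b)) \<in> poly_funs {\<lambda>s. s}"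
    by (intro poly_funs.add poly_funs.mult poly_funs_diff poly_funs_id poly_funs.const)
  have set: "{i..Suc (Suc i)} = {i, Suc i, Suc (Suc i)}" by auto
  have plus: "R (a + b) $$ (Suc (Suc i), i) = R a $$ (Suc (Suc i), i)
      + R a $$ (Suc (Suc i), Suc i) * R b $$ (Suc i, i) + R b $$ (Suc (Suc i), i)" for a b
    using R_add_index[of "Suc (Suc i)" i a b] i by (simp add: set diag_1)
  show "2 * R (of_nat k) $$ (Suc (Suc i), i)
      = 2 * ?\<beta> * of_nat k + ?\<alpha> * ?\<gamma> * (of_nat k * of_nat k - of_nat k)" for k
  proof (induction k)
    case (Suc k)
    have "R (of_nat (Suc k)) $$ (Suc (Suc i), i)
        = ?\<beta> + ?\<gamma> * (of_nat k * ?\<alpha>) + R (of_nat k) $$ (Suc (Suc i), i)"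
      using plus[of 1 "of_nat k"] subdiagonal[of i "of_nat k"] i by simp
    then have "2 * R (of_nat (Suc k)) $$ (Suc (Suc i), i)
        = 2 * ?\<beta> + 2 * ?\<gamma> * (of_nat k * ?\<alpha>) + 2 * R (of_nat k) $$ (Suc (Suc i), i)"
      by (simp only: distrib_left mult.assoc)
    then show ?case unfolding Suc.IH by (simp add: algebra_simps)
  qed (use i R_0 in simp)
qed

end

text \<open>Only the element with parameter one is triangularized. Its powers are then lower
  triangular as well, polynomial dependence carries this over to all parameters, and each diagonal
  entry is a polynomial unit with value one at zero.\<close>

lemma triangularize_one_parameter:
  assumes \<phi>: "\<phi> \<in> algebraic_hom 2 n"
  obtains g R where "g \<in> GL n" "unipotent_subgroup n R" "\<And>b. g * \<phi> (upper b) = R b * g"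
proof -
  define H where "H b = \<phi> (upper b)" for b
  have hom: "\<phi> \<in> hom (SL 2) (SL n)" using \<phi> by (simp add: algebraic_hom_def)
  have H: "H b \<in> carrier_mat n n" for b
    using hom_in_carrier[OF hom upper_SL] by (simp add: H_def SL_simps)
  have H_add: "H (a + b) = H a * H b" for a b
    using hom_mult[OF hom upper_SL upper_SL, of a b] by (simp add: H_def SL_simps upper_mult)
  have "\<phi> (upper 0) = 1\<^sub>m n"
    using group_hom.hom_one[of "SL 2" "SL n" \<phi>] hom
    by (simp add: SL_simps upper_0 group_hom.intro group_hom_axioms.intro group_SL)
  then have H0: "H 0 = 1\<^sub>m n" by (simp add: H_def)
  have H_poly: "(\<lambda>b. H b $$ (i, j)) \<in> poly_funs {\<lambda>s. s}" if ij: "i < n" "j < n" for i j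
  proof -
    obtain f where f: "f \<in> poly_funs {\<lambda>g. g $$ (k, l) | k l. k < 2 \<and> l < 2}"
      "\<forall>g\<in>carrier (SL 2). \<phi> g $$ (i, j) = f g"
      using \<phi> ij unfolding algebraic_hom_def by blast
    have "(\<lambda>b. f (upper b)) \<in> poly_funs {\<lambda>s. s}"
    proof (rule poly_funs_compose[OF f(1)])
      fix c assume "c \<in> {\<lambda>g :: complex mat. g $$ (k, l) | k l. k < 2 \<and> l < 2}"
      then show "(\<lambda>b. c (upper b)) \<in> poly_funs {\<lambda>s. s}"
        by (auto simp: less_2_cases_iff intro: poly_funs.const poly_funs_id)
    qed
    then show ?thesis using f(2) upper_SL by (simp add: H_def)
  qed
  \<comment> \<open>The Schur form is upper triangular, so it is taken for the transpose in order to
    obtain a lower triangular matrix.\<close>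
  have HT: "transpose_mat (H 1) \<in> carrier_mat n n" using H by simp
  obtain as where "char_poly (transpose_mat (H 1)) = (\<Prod>a\<leftarrow>as. [:- a, 1:])"
    using char_poly_factorized[OF HT] by blast
  then obtain B where B: "B \<in> carrier_mat n n" "upper_triangular B" "similar_mat (transpose_mat (H 1)) B"
    using schur_decomposition_exists[OF HT] by blast
  then obtain P Q where PQ0: "similar_mat_wit (transpose_mat (H 1)) B P Q" by (auto simp: similar_mat_def)
  note PQ = similar_mat_witD2[OF HT PQ0]
  define g g' where "g = transpose_mat P" and "g' = transpose_mat Q"
  have gc: "g \<in> carrier_mat n n" "g' \<in> carrier_mat n n" using PQ by (auto simp: g_def g'_def)
  have gg: "g * g' = 1\<^sub>m n" "g' * g = 1\<^sub>m n"
    unfolding g_def g'_def transpose_mult[OF PQ(7,6), symmetric] transpose_mult[OF PQ(6,7), symmetric]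
      PQ(1,2) by (rule transpose_one)+
  have "det g * det g' = 1" using det_mult[OF gc] gg(1) by simp
  then have g: "g \<in> GL n" using gc by (auto simp: GL_def)
  define R where "R b = g * H b * g'" for b
  have gH: "g * H b \<in> carrier_mat n n" for b using gc(1) H by (rule mult_carrier_mat)
  have R: "R b \<in> carrier_mat n n" for b unfolding R_def using gH gc(2) by (rule mult_carrier_mat)
  have Rg: "R b * g = g * H b" for b
  proof -
    have "R b * g = g * H b * (g' * g)" unfolding R_def by (rule assoc_mult_mat[OF gH gc(2,1)])
    then show ?thesis unfolding gg(2) right_mult_one_mat[OF gH] .
  qed
  have add: "R (a + b) = R a * R b" for a b
  proof -
    have "R a * R b = R a * (g * H b) * g'" unfolding R_def[of b]
      by (rule assoc_mult_mat[OF R gH gc(2), symmetric])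
    also have "R a * (g * H b) = R a * g * H b" by (rule assoc_mult_mat[OF R gc(1) H, symmetric])
    also have "\<dots> = g * H a * H b" by (simp add: Rg)
    also have "\<dots> = g * (H a * H b)" by (rule assoc_mult_mat[OF gc(1) H H])
    finally show ?thesis by (simp add: R_def H_add)
  qed
  have poly: "(\<lambda>b. R b $$ (i, j)) \<in> poly_funs {\<lambda>s. s}" if ij: "i < n" "j < n" for i j
  proof -
    have "R b $$ (i, j) = (\<Sum>l<n. (\<Sum>k<n. g $$ (i, k) * H b $$ (k, l)) * g' $$ (l, j))" for b
    proof -
      have "R b $$ (i, j) = (\<Sum>l<n. (g * H b) $$ (i, l) * g' $$ (l, j))"
        unfolding R_def by (rule index_mult_square[OF gH gc(2) ij])
      also have "\<dots> = (\<Sum>l<n. (\<Sum>k<n. g $$ (i, k) * H b $$ (k, l)) * g' $$ (l, j))"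
        by (rule sum.cong[OF refl]) (simp only: index_mult_square[OF gc(1) H ij(1)] lessThan_iff)
      finally show ?thesis .
    qed
    then show ?thesis
      by (simp only:) (intro poly_funs_sum poly_funs.mult poly_funs.const H_poly ij; simp)
  qed
  have R1: "R 1 = transpose_mat B"
  proof -
    have PBT: "P * B \<in> carrier_mat n n" using PQ(6) B(1) by (rule mult_carrier_mat)
    have "H 1 = transpose_mat (P * B * Q)" using PQ(3) by (metis transpose_transpose)
    also have "\<dots> = g' * (transpose_mat B * g)"
      using transpose_mult[OF PBT PQ(7)] transpose_mult[OF PQ(6) B(1)] by (simp add: g_def g'_def)
    finally have "g * H 1 = transpose_mat B * g"
      using assoc_mult_mat[OF gc, of "transpose_mat B * g" n] gg(1) gc B(1) by simp
    then have "R 1 = transpose_mat B * (g * g')"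
      unfolding R_def using assoc_mult_mat[of "transpose_mat B" n n g n g' n] B(1) gc by simp
    then show ?thesis using gg(1) B(1) by simp
  qed
  have R0: "R 0 = 1\<^sub>m n" using gc gg(1) by (simp add: R_def H0)
  have lower_nat: "R (of_nat k) $$ (i, j) = 0" if "i < j" "j < n" for k i j
    using that
  proof (induction k arbitrary: i j)
    case 0
    then show ?case by (simp add: R0)
  next
    case (Suc k)
    have lower1: "R 1 $$ (i, j) = 0" if "i < j" "j < n" for i j
      using that B(1,2) by (auto simp: R1)
    have "R (of_nat (Suc k)) = R 1 * R (of_nat k)" using add[of 1 "of_nat k"] by simp
    then have "R (of_nat (Suc k)) $$ (i, j) = (\<Sum>l\<in>{j..i}. R 1 $$ (i, l) * R (of_nat k) $$ (l, j))"
      using mult_lower_index[OF R lower1 R Suc.IH, of i j] Suc.prems by simp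
    then show ?case using Suc.prems by simp
  qed
  have lower: "R b $$ (i, j) = 0" if ij: "i < j" "j < n" for b i j
    by (rule univariate_eq_on_nat[of "\<lambda>b. R b $$ (i, j)" "\<lambda>_. 0"])
      (use poly[of i j] ij lower_nat poly_funs.const in auto)
  have diag: "R b $$ (i, i) = 1" if i: "i < n" for b i
  proof -
    have "R b $$ (i, i) * R (- b) $$ (i, i) = 1" for b
    proof -
      have "R b * R (- b) = 1\<^sub>m n" using add[of b "- b"] R0 by (metis add.right_inverse)
      then show ?thesis using mult_lower_index[OF R lower R lower i i, of b "- b"] i by simp
    qed
    then have "R b $$ (i, i) = R 0 $$ (i, i)"
      using polynomial_unit_constant[of "\<lambda>b. R b $$ (i, i)" b] poly[OF i i] by blast
    then show ?thesis using R0 i by simp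
  qed
  have "unipotent_subgroup n R"
    by unfold_locales (use R lower diag add poly in auto)
  then show thesis using that[OF g] Rg by (metis H_def)
qed

text \<open>A lower triangular matrix whose subdiagonal entry in row \<open>i + 1\<close> vanishes stays lower
  triangular when the indices \<open>i\<close> and \<open>i + 1\<close> are exchanged.\<close>

context unipotent_subgroup
begin

lemma swapped_fixed_point:
  assumes i: "Suc i < n" and zero: "R 1 $$ (Suc i, i) = 0"
  shows "\<exists>s\<in>GL n. (\<forall>b. trp n (R b) (base_point n {}) = base_point n {})
    \<and> (\<forall>b. trp n (s * R b) (base_point n {}) = trp n s (base_point n {}))
    \<and> trp n s (base_point n {}) \<noteq> base_point n {}"
proof -
  define \<tau> where "\<tau> x = (if x = i then Suc i else if x = Suc i then i else x)" for x
  have \<tau>: "\<tau> (\<tau> x) = x" "\<tau> x < n \<longleftrightarrow> x < n" for x using i by (auto simp: \<tau>_def)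
  define s where "s = mat n n (\<lambda>(x, y). if y = \<tau> x then 1 else (0 :: complex))"
  have sc: "s \<in> carrier_mat n n" by (simp add: s_def)
  have left: "(s * A) $$ (x, y) = A $$ (\<tau> x, y)" if A: "A \<in> carrier_mat n n" and xy: "x < n" "y < n" for A x y
  proof -
    have "(s * A) $$ (x, y) = (\<Sum>k<n. (if k = \<tau> x then 1 else 0) * A $$ (k, y))"
      using A xy by (simp add: s_def scalar_prod_def atLeast0LessThan)
    also have "\<dots> = (\<Sum>k<n. if k = \<tau> x then A $$ (k, y) else 0)" by (intro sum.cong) auto
    finally show ?thesis using xy \<tau> by simp
  qed
  have right: "(A * s) $$ (x, y) = A $$ (x, \<tau> y)" if A: "A \<in> carrier_mat n n" and xy: "x < n" "y < n" for A x y
  proof -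
    have "(A * s) $$ (x, y) = (\<Sum>k<n. A $$ (x, k) * (if y = \<tau> k then 1 else 0))"
      using A xy by (simp add: s_def scalar_prod_def atLeast0LessThan)
    also have "\<dots> = (\<Sum>k<n. if k = \<tau> y then A $$ (x, k) else 0)"
      by (intro sum.cong refl) (use \<tau>(1) in auto)
    finally show ?thesis using xy \<tau> by simp
  qed
  have "s * s = 1\<^sub>m n"
    by (rule eq_matI) (use left[OF sc] sc \<tau> in \<open>auto simp: s_def simp del: index_mult_mat(1)\<close>)
  then have "det s * det s = 1" using det_mult[OF sc sc] by simp
  then have s: "s \<in> GL n" using sc by (auto simp: GL_def)
  have R_fix: "trp n (R b) (base_point n {}) = base_point n {}" for b
    by (rule lower_fixes_base_point[OF carrier R_unitriangular])
  have "trp n (s * R b) (base_point n {}) = trp n s (base_point n {})" for b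
  proof -
    \<comment> \<open>The conjugate of \<open>R b\<close> by the exchange. It is again lower
      unitriangular, so moving \<open>R b\<close> past \<open>s\<close> produces a matrix that fixes
      the standard flag.\<close>
    define R' where "R' = mat n n (\<lambda>(x, y). R b $$ (\<tau> x, \<tau> y))"
    have R': "R' \<in> carrier_mat n n" by (simp add: R'_def)
    have "s * R b = R' * s"
    proof (rule eq_matI)
      fix x y assume "x < dim_row (R' * s)" "y < dim_col (R' * s)"
      then have xy: "x < n" "y < n" using R' sc by auto
      show "(s * R b) $$ (x, y) = (R' * s) $$ (x, y)"
        using left[OF carrier xy] right[OF R' xy] xy \<tau> by (simp add: R'_def)
    qed (use sc R' carrier[of b] in auto)
    moreover have "unitriangular (transpose_mat R')"
      unfolding unitriangular_def
    proof (intro allI impI conjI)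
      fix x assume "x < dim_row (transpose_mat R')"
      then have x: "x < n" by (simp add: R'_def)
      then show "transpose_mat R' $$ (x, x) = 1" using \<tau> by (simp add: R'_def diag_1)
      fix y assume y: "y < x"
      have "R b $$ (\<tau> y, \<tau> x) = 0"
      proof (cases "\<tau> y < \<tau> x")
        case True
        then show ?thesis using lower \<tau>(2)[of x] x by blast
      next
        case False
        then have "y = i" "x = Suc i" using y by (auto simp: \<tau>_def split: if_splits)
        then show ?thesis using subdiagonal[OF i, of b] zero by (simp add: \<tau>_def)
      qed
      then show "transpose_mat R' $$ (x, y) = 0" using x y by (simp add: R'_def)
    qed
    ultimately have "trp n (s * R b) (base_point n {}) = trp n s (trp n R' (base_point n {}))"
      using trp_trp[OF R' sc base_point_ambient] by simp
    then show ?thesis using lower_fixes_base_point[OF R' \<open>unitriangular (transpose_mat R')\<close>] by simp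
  qed
  moreover have "trp n s (base_point n {}) \<noteq> base_point n {}"
  proof
    assume "trp n s (base_point n {}) = base_point n {}"
    \<comment> \<open>If the flag were unchanged, \<open>s\<close> would preserve the span of the
      first \<open>i + 1\<close> coordinate rows.\<close>
    then have "s $$ (i, Suc i) = 0" by (rule stabilizer_block[OF sc, of _ "Suc i"]) (use i in auto)
    then show False using i by (simp add: s_def \<tau>_def)
  qed
  ultimately show ?thesis using s R_fix by blast
qed

end

section \<open>An invariant conic on a block of size three\<close>

definition embed3 :: "nat \<Rightarrow> nat \<Rightarrow> (nat \<Rightarrow> nat \<Rightarrow> complex) \<Rightarrow> complex mat" where
  "embed3 n a M = mat n n (\<lambda>(i, j).
     if i \<in> {a..a+2} \<and> j \<in> {a..a+2} then M (i - a) (j - a) else if i = j then 1 else 0)"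

lemma embed3_carrier [simp]: "embed3 n a M \<in> carrier_mat n n"
  by (simp add: embed3_def)

lemma embed3_index:
  "i < n \<Longrightarrow> j < n \<Longrightarrow> embed3 n a M $$ (i, j)
    = (if i \<in> {a..a+2} \<and> j \<in> {a..a+2} then M (i - a) (j - a) else if i = j then 1 else 0)"
  unfolding embed3_def by (simp only: index_mat(1) prod.case)

lemma transpose_embed3: "transpose_mat (embed3 n a M) = embed3 n a (\<lambda>i j. M j i)"
  by (rule eq_matI) (auto simp: embed3_def)

lemma embed3_mult:
  assumes a: "a + 2 < n"
  shows "embed3 n a M * embed3 n a N
    = embed3 n a (\<lambda>i j. M i 0 * N 0 j + M i 1 * N 1 j + M i 2 * N 2 j)" (is "?L = ?R")
proof (rule eq_matI)
  fix i j assume "i < dim_row ?R" "j < dim_col ?R"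
  then have ij: "i < n" "j < n" by (auto simp: embed3_def)
  let ?B = "{a..a+2}" and ?X = "embed3 n a M" and ?Y = "embed3 n a N"
  note index = embed3_index[of _ n _ a]
  have L: "?L $$ (i, j) = (\<Sum>k<n. ?X $$ (i, k) * ?Y $$ (k, j))"
    by (rule index_mult_square) (use ij in auto)
  show "?L $$ (i, j) = ?R $$ (i, j)"
  proof (cases "i \<in> ?B")
    case True
    have "?L $$ (i, j) = (\<Sum>k\<in>?B. ?X $$ (i, k) * ?Y $$ (k, j))"
      unfolding L by (rule sum.mono_neutral_right) (use a ij True in \<open>auto simp: index\<close>)
    also have "?B = {a, a + 1, a + 2}" by auto
    finally have "?L $$ (i, j) = ?X $$ (i, a) * ?Y $$ (a, j) + ?X $$ (i, a + 1) * ?Y $$ (a + 1, j)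
        + ?X $$ (i, a + 2) * ?Y $$ (a + 2, j)" by simp
    moreover have "?X $$ (i, a) = M (i - a) 0" "?X $$ (i, a + 1) = M (i - a) 1" "?X $$ (i, a + 2) = M (i - a) 2"
      using ij True a by (simp_all add: index)
    moreover have "?Y $$ (a + l, j) = (if j \<in> ?B then N l (j - a) else 0)" if "l \<le> 2" for l
      using ij a that by (auto simp: index)
    from this[of 0] this[of 1] this[of 2]
    have "?Y $$ (a, j) = (if j \<in> ?B then N 0 (j - a) else 0)" "?Y $$ (a + 1, j) = (if j \<in> ?B then N 1 (j - a) else 0)"
      "?Y $$ (a + 2, j) = (if j \<in> ?B then N 2 (j - a) else 0)" by simp_all
    moreover have "?R $$ (i, j) = (if j \<in> ?B then M (i - a) 0 * N 0 (j - a) + M (i - a) 1 * N 1 (j - a)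
        + M (i - a) 2 * N 2 (j - a) else 0)"
      using ij True by (auto simp: index)
    ultimately show ?thesis by simp
  next
    case False
    have outside: "embed3 n a M $$ (i, k) = (if i = k then 1 else 0)" if "k < n" for M k
      by (simp only: index[OF ij(1) that] False simp_thms if_False)
    have "?L $$ (i, j) = (\<Sum>k<n. if k = i then ?Y $$ (k, j) else 0)"
      unfolding L by (rule sum.cong[OF refl]) (simp add: outside)
    also have "\<dots> = ?Y $$ (i, j)" using ij by simp
    finally show ?thesis by (simp only: outside[OF ij(2)])
  qed
qed (auto simp: embed3_def)

lemma embed3_cong:
  assumes "\<And>i j. i \<in> {0, 1, 2} \<Longrightarrow> j \<in> {0, 1, 2} \<Longrightarrow> M i j = N i j"
  shows "embed3 n a M = embed3 n a N"
proof -
  have "M (i - a) (j - a) = N (i - a) (j - a)" if "i \<in> {a..a+2}" "j \<in> {a..a+2}" for i j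
  proof (rule assms)
    have "i - a = 0 \<or> i - a = 1 \<or> i - a = 2" "j - a = 0 \<or> j - a = 1 \<or> j - a = 2"
      using that by (simp_all, linarith+)
    then show "i - a \<in> {0, 1, 2}" "j - a \<in> {0, 1, 2}" by simp_all
  qed
  then show ?thesis by (intro eq_matI) (auto simp: embed3_def)
qed

lemma embed3_one: "embed3 n a (\<lambda>i j. if i = j then 1 else 0) = 1\<^sub>m n"
proof (rule eq_matI)
  fix i j assume "i < dim_row (1\<^sub>m n :: complex mat)" "j < dim_col (1\<^sub>m n :: complex mat)"
  then have ij: "i < n" "j < n" by simp_all
  have "i - a = j - a \<longleftrightarrow> i = j" if "i \<in> {a..a+2} \<and> j \<in> {a..a+2}"
    using that by (intro eq_diff_iff) simp_all
  then show "embed3 n a (\<lambda>i j. if i = j then 1 else 0) $$ (i, j) = 1\<^sub>m n $$ (i, j)"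
    unfolding embed3_index[OF ij] index_one_mat(1)[OF ij] by presburger
qed (simp_all add: embed3_def)

lemma block_weight_less:
  assumes "block_weight n K i < block_weight n K j"
  shows "i < j"
proof (rule ccontr)
  assume "\<not> i < j"
  then have "block_weight n K j \<le> block_weight n K i"
    unfolding block_weight_def by (intro card_mono) auto
  then show False using assms by simp
qed

lemma block_weight_eq:
  assumes "i \<le> j" "j < n"
  shows "block_weight n K i = block_weight n K j \<longleftrightarrow> {i<..j} \<subseteq> K"
proof -
  let ?M = "\<lambda>i. {m \<in> {1..n-1} - K. m \<le> i}"
  have sub: "?M i \<subseteq> ?M j" using assms by auto
  have "block_weight n K i = block_weight n K j \<longleftrightarrow> ?M i = ?M j"
    unfolding block_weight_def using card_subset_eq[OF _ sub] by auto
  also have "\<dots> \<longleftrightarrow> {i<..j} \<subseteq> K"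
  proof
    assume eq: "?M i = ?M j"
    show "{i<..j} \<subseteq> K"
    proof
      fix m assume m: "m \<in> {i<..j}"
      show "m \<in> K"
      proof (rule ccontr)
        assume "m \<notin> K"
        then have "m \<in> ?M j" using m assms by auto
        then have "m \<in> ?M i" unfolding eq .
        then show False using m by simp
      qed
    qed
  next
    assume K: "{i<..j} \<subseteq> K"
    have "?M j \<subseteq> ?M i"
    proof
      fix m assume m: "m \<in> ?M j"
      then have "\<not> i < m" using K by auto
      then show "m \<in> ?M i" using m by simp
    qed
    then show "?M i = ?M j" using sub by (rule equalityI[rotated])
  qed
  finally show ?thesis .
qed

lemma block_weight_eq_pair:
  assumes "a + 2 < n" "i < n" "j < n"
  shows "block_weight n {a + 1, a + 2} i = block_weight n {a + 1, a + 2} j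
    \<longleftrightarrow> i = j \<or> (i \<in> {a..a+2} \<and> j \<in> {a..a+2})"
proof -
  have *: "{i<..j} \<subseteq> {a + 1, a + 2} \<longleftrightarrow> i = j \<or> (i \<in> {a..a+2} \<and> j \<in> {a..a+2})" if "i \<le> j" for i j
  proof
    assume sub: "{i<..j} \<subseteq> {a + 1, a + 2}"
    show "i = j \<or> (i \<in> {a..a+2} \<and> j \<in> {a..a+2})"
    proof (cases "i = j")
      case False
      then have "Suc i \<in> {i<..j}" "j \<in> {i<..j}" using that by auto
      then have "Suc i \<in> {a + 1, a + 2}" "j \<in> {a + 1, a + 2}" using sub by blast+
      then show ?thesis using that by auto
    qed simp
  next
    assume "i = j \<or> (i \<in> {a..a+2} \<and> j \<in> {a..a+2})"
    then show "{i<..j} \<subseteq> {a + 1, a + 2}" by auto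
  qed
  show ?thesis
  proof (cases "i \<le> j")
    case True
    then show ?thesis using block_weight_eq[OF True assms(3)] *[OF True] by simp
  next
    case False
    then show ?thesis using block_weight_eq[of j i n "{a + 1, a + 2}"] *[of j i] assms(2) by auto
  qed
qed

lemma lower_block_lower:
  assumes "h \<in> carrier_mat n n" "\<And>i j. i < j \<Longrightarrow> j < n \<Longrightarrow> h $$ (i, j) = 0"
  shows "block_lower n K h"
  using assms block_weight_less unfolding weight_lower_def by auto

lemma weight_part_index:
  "A \<in> carrier_mat n n \<Longrightarrow> i < n \<Longrightarrow> j < n \<Longrightarrow>
    weight_part w A $$ (i, j) = (if w i = w j then A $$ (i, j) else 0)"
  by (simp add: weight_part_def)

lemma embed3_block:
  assumes a: "a + 2 < n"
  shows "block_lower n {a + 1, a + 2} (embed3 n a M)"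
    and "block_part n {a + 1, a + 2} (embed3 n a M) = embed3 n a M"
proof -
  let ?w = "block_weight n {a + 1, a + 2}"
  have zero: "embed3 n a M $$ (i, j) = 0" if ij: "i < n" "j < n" and w: "?w i \<noteq> ?w j" for i j
  proof -
    have "\<not> (i \<in> {a..a+2} \<and> j \<in> {a..a+2})" "i \<noteq> j"
      using w block_weight_eq_pair[OF a ij] by blast+
    then show ?thesis by (simp only: embed3_index[OF ij] if_False)
  qed
  show "block_lower n {a + 1, a + 2} (embed3 n a M)"
    unfolding weight_lower_def using zero carrier_matD[OF embed3_carrier] by (metis nat_less_le)
  show "block_part n {a + 1, a + 2} (embed3 n a M) = embed3 n a M"
  proof (rule eq_matI)
    fix i j assume "i < dim_row (embed3 n a M)" "j < dim_col (embed3 n a M)"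
    then have ij: "i < n" "j < n" by (simp_all add: embed3_def)
    show "block_part n {a + 1, a + 2} (embed3 n a M) $$ (i, j) = embed3 n a M $$ (i, j)"
      using zero[OF ij] by (simp only: weight_part_index[OF embed3_carrier ij] if_split) auto
  qed (simp_all add: weight_part_def)
qed

text \<open>The symmetric matrix below is invariant under the diagonal block of \<open>R\<close> in the rows and columns
  \<open>a, a + 1, a + 2\<close>: the unipotent radical of a Borel subgroup of the orthogonal group of a
  nondegenerate conic is a regular unipotent subgroup. The entry \<open>\<epsilon>\<close> was found by solving the linear
  equations for invariance, and \<open>q3\<close> by completing squares.\<close>

context unipotent_subgroup
begin

lemma invariant_conic:
  assumes a: "a + 2 < n" and nz: "R 1 $$ (a + 1, a) \<noteq> 0" "R 1 $$ (a + 2, a + 1) \<noteq> 0"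
  shows "\<exists>q\<in>GL n. \<forall>b. trp n (q * R b) (base_point n {a + 1, a + 2}) = trp n q (base_point n {a + 1, a + 2})"
proof -
  let ?K = "{a + 1, a + 2}"
  define \<alpha> \<gamma> \<beta> where "\<alpha> = R 1 $$ (a + 1, a)" and "\<gamma> = R 1 $$ (a + 2, a + 1)" and "\<beta> = R 1 $$ (a + 2, a)"
  define \<epsilon> where "\<epsilon> = \<alpha> * \<gamma> / 2 - \<beta>"
  define \<sigma> where "\<sigma> = csqrt \<gamma>"
  have \<alpha>: "\<alpha> \<noteq> 0" and \<gamma>: "\<gamma> \<noteq> 0" using nz by (auto simp: \<alpha>_def \<gamma>_def)
  have \<sigma>: "\<sigma> * \<sigma> = \<gamma>" using power2_csqrt[of \<gamma>] by (simp only: power2_eq_square \<sigma>_def)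
  define E3 where "E3 i j = [[0, \<epsilon>, \<alpha>], [\<epsilon>, -\<gamma>, 0], [\<alpha>, 0, 0]] ! i ! j" for i j :: nat
  \<comment> \<open>The inverse of \<open>E3\<close>, given explicitly so that \<open>E3\<close> is
    seen to be nondegenerate.\<close>
  define F3 where "F3 i j = [[0, 0, 1 / \<alpha>], [0, -1 / \<gamma>, \<epsilon> / (\<alpha> * \<gamma>)],
    [1 / \<alpha>, \<epsilon> / (\<alpha> * \<gamma>), - \<epsilon> * \<epsilon> / (\<alpha> * \<alpha> * \<gamma>)]] ! i ! j" for i j :: nat
  define \<delta> where "\<delta> = \<epsilon> / \<gamma>"
  \<comment> \<open>In coordinates \<open>x, y, z\<close> the form is
    \<open>2 \<alpha> x z + 2 \<epsilon> x y - \<gamma> y^2\<close>. Splitting off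
    \<open>- \<gamma> (y - \<delta> x)^2\<close> leaves
    \<open>\<delta>^2 \<gamma> x^2 + 2 \<alpha> x z\<close>, and this equals
    \<open>(u x + \<alpha> z)^2 - (v x - \<alpha> z)^2\<close> because \<open>u + v = 1\<close> and
    \<open>u - v = \<delta>^2 \<gamma>\<close>.\<close>
  define u v where "u = (1 + \<delta> * \<delta> * \<gamma>) / 2" and "v = (1 - \<delta> * \<delta> * \<gamma>) / 2"
  have \<epsilon>\<delta>: "\<epsilon> = \<delta> * \<gamma>" using \<gamma> by (simp add: \<delta>_def)
  have uv: "u + v = 1" "u - v = \<delta> * \<delta> * \<gamma>" by (simp_all add: u_def v_def field_simps)
  define q3 where "q3 i j = [[u, 0, \<alpha>], [- (\<i> * \<sigma> * \<delta>), \<i> * \<sigma>, 0], [\<i> * v, 0, - (\<i> * \<alpha>)]] ! i ! j" for i j :: nat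
  have q3: "q3 0 0 = u" "q3 0 1 = 0" "q3 0 2 = \<alpha>" "q3 1 0 = - (\<i> * \<sigma> * \<delta>)" "q3 1 1 = \<i> * \<sigma>" "q3 1 2 = 0"
    "q3 2 0 = \<i> * v" "q3 2 1 = 0" "q3 2 2 = - (\<i> * \<alpha>)" by (simp_all add: q3_def)
  have E3: "E3 0 0 = 0" "E3 0 1 = \<epsilon>" "E3 0 2 = \<alpha>" "E3 1 0 = \<epsilon>" "E3 1 1 = -\<gamma>" "E3 1 2 = 0"
    "E3 2 0 = \<alpha>" "E3 2 1 = 0" "E3 2 2 = 0" by (simp_all add: E3_def)
  have F3: "F3 0 0 = 0" "F3 0 1 = 0" "F3 0 2 = 1 / \<alpha>" "F3 1 0 = 0" "F3 1 1 = -1 / \<gamma>" "F3 1 2 = \<epsilon> / (\<alpha> * \<gamma>)"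
    "F3 2 0 = 1 / \<alpha>" "F3 2 1 = \<epsilon> / (\<alpha> * \<gamma>)" "F3 2 2 = - \<epsilon> * \<epsilon> / (\<alpha> * \<alpha> * \<gamma>)"
    by (simp_all add: F3_def)
  define r where "r b i j = R b $$ (a + i, a + j)" for b and i j :: nat
  let ?E = "embed3 n a E3" and ?q = "embed3 n a q3"
  have qq: "transpose_mat ?q * ?q = ?E"
    unfolding transpose_embed3 embed3_mult[OF a]
  proof (rule embed3_cong)
    have ii: "\<i> * \<i> = -1" by simp
    fix i j :: nat assume "i \<in> {0, 1, 2}" "j \<in> {0, 1, 2}"
    then consider "i = 0" "j = 0" | "i = 0" "j = 1" | "i = 0" "j = 2" | "i = 1" "j = 0" | "i = 1" "j = 1"
      | "i = 1" "j = 2" | "i = 2" "j = 0" | "i = 2" "j = 1" | "i = 2" "j = 2" by blast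
    then show "q3 0 i * q3 0 j + q3 1 i * q3 1 j + q3 2 i * q3 2 j = E3 i j"
    proof cases
      case 1
      have "(u + v) * (u - v) = u * u - v * v" by (simp add: algebra_simps)
      then have "u * u = v * v + \<delta> * \<delta> * \<gamma>" unfolding uv by (simp add: algebra_simps)
      moreover have "- (\<i> * \<sigma> * \<delta>) * - (\<i> * \<sigma> * \<delta>) = \<i> * \<i> * (\<sigma> * \<sigma>) * (\<delta> * \<delta>)"
        "\<i> * v * (\<i> * v) = \<i> * \<i> * (v * v)" by (simp_all only: minus_mult_minus mult_ac)
      ultimately show ?thesis using 1 by (simp only: q3 E3 ii \<sigma>) (simp add: algebra_simps)
    next
      case 2
      have "- (\<i> * \<sigma> * \<delta>) * (\<i> * \<sigma>) = - (\<i> * \<i>) * (\<sigma> * \<sigma>) * \<delta>" by (simp only: mult_ac mult_minus_left mult_minus_right)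
      then show ?thesis using 2 by (simp only: q3 E3 ii \<sigma> \<epsilon>\<delta>) (simp add: algebra_simps)
    next
      case 3
      have "\<i> * v * - (\<i> * \<alpha>) = - (\<i> * \<i>) * (v * \<alpha>)" by (simp only: mult_ac mult_minus_left mult_minus_right)
      moreover have "u * \<alpha> + v * \<alpha> = \<alpha>" using uv(1) by (metis distrib_right mult_1)
      ultimately show ?thesis using 3 by (simp only: q3 E3 ii) simp
    next
      case 4
      have "\<i> * \<sigma> * - (\<i> * \<sigma> * \<delta>) = - (\<i> * \<i>) * (\<sigma> * \<sigma>) * \<delta>" by (simp only: mult_ac mult_minus_left mult_minus_right)
      then have "- (\<i> * \<sigma> * \<delta>) * (\<i> * \<sigma>) = - (\<i> * \<i>) * (\<sigma> * \<sigma>) * \<delta>" by (simp only: mult.commute)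
      then show ?thesis using 4 by (simp only: q3 E3 ii \<sigma> \<epsilon>\<delta>) (simp add: algebra_simps)
    next
      case 5
      have "\<i> * \<sigma> * (\<i> * \<sigma>) = \<i> * \<i> * (\<sigma> * \<sigma>)" by (simp only: mult_ac)
      then show ?thesis using 5 by (simp only: q3 E3 ii \<sigma>) simp
    next
      case 7
      have "- (\<i> * \<alpha>) * (\<i> * v) = - (\<i> * \<i>) * (v * \<alpha>)" by (simp only: mult_ac mult_minus_left mult_minus_right)
      moreover have "\<alpha> * u + v * \<alpha> = \<alpha>" using uv(1) by (metis distrib_right mult_1 mult.commute)
      ultimately show ?thesis using 7 by (simp only: q3 E3 ii) simp
    next
      case 9
      have "- (\<i> * \<alpha>) * - (\<i> * \<alpha>) = \<i> * \<i> * (\<alpha> * \<alpha>)" by (simp only: mult_ac minus_mult_minus)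
      then show ?thesis using 9 by (simp only: q3 E3 ii) simp
    qed (simp_all only: q3 E3, simp_all)
  qed
  have EF: "?E * embed3 n a F3 = 1\<^sub>m n"
    unfolding embed3_mult[OF a] embed3_one[symmetric, of n a]
  proof (rule embed3_cong)
    fix i j :: nat assume "i \<in> {0, 1, 2}" "j \<in> {0, 1, 2}"
    then consider "i = 0" "j = 0" | "i = 0" "j = 1" | "i = 0" "j = 2" | "i = 1" "j = 0" | "i = 1" "j = 1"
      | "i = 1" "j = 2" | "i = 2" "j = 0" | "i = 2" "j = 1" | "i = 2" "j = 2" by blast
    then show "E3 i 0 * F3 0 j + E3 i 1 * F3 1 j + E3 i 2 * F3 2 j = (if i = j then 1 else 0)"
      by cases (simp_all only: E3 F3, simp_all add: \<alpha> \<gamma>)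
  qed
  have "det ?E * det (embed3 n a F3) = 1"
    using det_mult[OF embed3_carrier embed3_carrier, of n a E3 a F3] EF by simp
  moreover have "det (transpose_mat ?q) * det ?q = det ?E"
    unfolding qq[symmetric] by (rule det_mult[symmetric, of _ n]) auto
  ultimately have q: "?q \<in> GL n" by (auto simp: GL_def)
  have part: "block_part n ?K (R b) = embed3 n a (r b)" for b
  proof (rule eq_matI)
    fix i j assume "i < dim_row (embed3 n a (r b))" "j < dim_col (embed3 n a (r b))"
    then have ij: "i < n" "j < n" by (auto simp: embed3_def)
    then show "block_part n ?K (R b) $$ (i, j) = embed3 n a (r b) $$ (i, j)"
    proof (cases "i \<in> {a..a+2} \<and> j \<in> {a..a+2}")
      case True
      then have "a + (i - a) = i" "a + (j - a) = j" by simp_all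
      then show ?thesis using True block_weight_eq_pair[OF a ij]
        by (simp only: weight_part_index[OF carrier ij] embed3_index[OF ij] r_def) simp
    next
      case False
      then show ?thesis using block_weight_eq_pair[OF a ij] diag_1[OF ij(1)]
        by (simp only: weight_part_index[OF carrier ij] embed3_index[OF ij] if_False)
          (cases "i = j", simp_all)
    qed
  qed (use carrier[of b] in \<open>auto simp: embed3_def weight_part_def\<close>)
  have inv: "transpose_mat (block_part n ?K (R b)) * ?E * block_part n ?K (R b) = ?E" for b
    unfolding part transpose_embed3 embed3_mult[OF a]
  proof (rule embed3_cong)
    have r: "r b 0 0 = 1" "r b 1 1 = 1" "r b 2 2 = 1" "r b 0 1 = 0" "r b 0 2 = 0" "r b 1 2 = 0"
      "r b 1 0 = b * \<alpha>" "r b 2 1 = b * \<gamma>"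
      using a diag_1 lower subdiagonal[of a b] subdiagonal[of "a + 1" b]
      by (simp_all add: r_def \<alpha>_def \<gamma>_def numeral_2_eq_2)
    have \<beta>b: "2 * r b 2 0 = 2 * \<beta> * b + \<alpha> * \<gamma> * (b * b - b)"
      using second_subdiagonal[of a b] a by (simp add: r_def \<alpha>_def \<beta>_def \<gamma>_def numeral_2_eq_2)
    have \<epsilon>2: "2 * \<epsilon> = \<alpha> * \<gamma> - 2 * \<beta>" by (simp add: \<epsilon>_def)
    fix i j :: nat assume "i \<in> {0, 1, 2}" "j \<in> {0, 1, 2}"
    then consider "i = 0" "j = 0" | "i = 0" "j = 1" | "i = 0" "j = 2" | "i = 1" "j = 0" | "i = 1" "j = 1"
      | "i = 1" "j = 2" | "i = 2" "j = 0" | "i = 2" "j = 1" | "i = 2" "j = 2" by blast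
    then show "(r b 0 i * E3 0 0 + r b 1 i * E3 1 0 + r b 2 i * E3 2 0) * r b 0 j
        + (r b 0 i * E3 0 1 + r b 1 i * E3 1 1 + r b 2 i * E3 2 1) * r b 1 j
        + (r b 0 i * E3 0 2 + r b 1 i * E3 1 2 + r b 2 i * E3 2 2) * r b 2 j = E3 i j"
    proof cases
      case 1
      \<comment> \<open>The corner is the one place where the second subdiagonal enters: the terms
        quadratic in \<open>b\<close> cancel, and the value of \<open>\<epsilon>\<close> removes the
        linear ones.\<close>
      have "b * \<alpha> * \<epsilon> + r b 2 0 * \<alpha> + (\<epsilon> + b * \<alpha> * - \<gamma>) * (b * \<alpha>) + \<alpha> * r b 2 0
          = \<alpha> * (b * (2 * \<epsilon>) + 2 * r b 2 0 - b * b * \<alpha> * \<gamma>)" by (simp add: algebra_simps)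
      also have "b * (2 * \<epsilon>) + 2 * r b 2 0 - b * b * \<alpha> * \<gamma> = 0"
        unfolding \<epsilon>2 \<beta>b by (simp add: algebra_simps)
      finally show ?thesis using 1 by (simp only: E3 r) simp
    qed (simp_all only: E3 r, simp_all)
  qed
  have lim: "pt n (limit_form n ?K ?E) = trp n ?q (base_point n ?K)"
    unfolding base_point_def trp_pt
  proof (rule pt_cong)
    fix k
    have "congr n k ?q (base n ?K k) = limit_form n ?K (transpose_mat ?q * 1\<^sub>m n * ?q) k"
      unfolding base_eq_limit_form
      using congr_limit_form[OF embed3_carrier embed3_block(1)[OF a, of q3] one_carrier_mat, where k = k]
        embed3_block(2)[OF a, of q3] by simp
    also have "transpose_mat ?q * 1\<^sub>m n = transpose_mat ?q" by (rule right_mult_one_mat[of _ n]) simp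
    finally show "limit_form n ?K ?E k = congr n k ?q (base n ?K k)" by (simp add: qq)
  qed
  have "trp n (?q * R b) (base_point n ?K) = trp n ?q (base_point n ?K)" for b
  proof -
    have "trp n (?q * R b) (base_point n ?K) = trp n (R b) (pt n (limit_form n ?K ?E))"
      unfolding lim by (rule trp_trp[OF embed3_carrier carrier base_point_ambient, symmetric])
    also have "\<dots> = pt n (limit_form n ?K ?E)"
      unfolding trp_pt
      by (simp only: congr_limit_form[OF carrier lower_block_lower[OF carrier lower] embed3_carrier] inv)
    finally show ?thesis unfolding lim .
  qed
  then show ?thesis using q by blast
qed

end

text \<open>The standard flag lies in every stratum closure and, in the triangularizing basis, is
  fixed by the unipotent subgroup. Any second fixed point in the same closure therefore refutes
  uniqueness.\<close>

theorem fixed_point_unique_imp_special: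
  assumes n: "2 \<le> n" and I: "I \<subseteq> {1..n-1}" and \<phi>: "\<phi> \<in> algebraic_hom 2 n"
    and unique: "one_unipotent_fixed_point n \<phi> (stratum_closure n I)"
  shows "special I"
proof (rule ccontr)
  assume "\<not> special I"
  then have "\<not> special (reflected n I)" by (simp add: special_reflected[OF I])
  then obtain m where m: "m \<in> reflected n I" "m + 1 \<in> reflected n I" by (auto simp: special_def)
  obtain g R where g: "g \<in> GL n" and R: "unipotent_subgroup n R" and gR: "\<And>b. g * \<phi> (upper b) = R b * g"
    using triangularize_one_parameter[OF \<phi>] by metis
  interpret unipotent_subgroup n R by (rule R)
  have hom: "\<phi> \<in> hom (SL 2) (SL n)" using \<phi> by (simp add: algebraic_hom_def)
  have \<phi>c: "\<phi> (upper b) \<in> carrier_mat n n" for b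
    using hom_in_carrier[OF hom upper_SL] by (simp add: SL_simps)
  have gc: "g \<in> carrier_mat n n" using g by (rule GL_carrier)
  let ?fixed = "\<lambda>p. \<forall>u\<in>unipotent_SL2. act n (\<phi> u) p = p"
  have fixed: "?fixed (trp n g (trp n s (base_point n K)))"
    if s: "s \<in> GL n" and inv: "\<And>b. trp n (s * R b) (base_point n K) = trp n s (base_point n K)" for s K
  proof -
    have sc: "s \<in> carrier_mat n n" using s by (rule GL_carrier)
    have amb: "trp n s (base_point n K) \<in> ambient n" by (rule trp_ambient[OF s base_point_ambient])
    have "trp n (\<phi> (upper b)) (trp n g (trp n s (base_point n K))) = trp n g (trp n s (base_point n K))" for b
    proof -
      have "trp n (\<phi> (upper b)) (trp n g (trp n s (base_point n K))) = trp n (R b * g) (trp n s (base_point n K))"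
        using trp_trp[OF gc \<phi>c amb] gR by simp
      also have "\<dots> = trp n g (trp n (R b) (trp n s (base_point n K)))"
        by (rule trp_trp[OF carrier gc amb, symmetric])
      also have "trp n (R b) (trp n s (base_point n K)) = trp n s (base_point n K)"
        using trp_trp[OF sc carrier base_point_ambient] inv by simp
      finally show ?thesis .
    qed
    then show ?thesis by (auto simp: unipotent_SL2_eq act_eq_trp hom_inv_upper[OF hom])
  qed
  have closure: "trp n g (trp n s (base_point n K)) \<in> stratum_closure n J \<longleftrightarrow> K \<subseteq> reflected n J"
    if "s \<in> GL n" "K \<subseteq> {1..n-1}" "J \<subseteq> {1..n-1}" for s K J
    using stratum_closure_iff[OF n that(3) GL_mult[OF that(1) g] that(2)]
      trp_trp[OF GL_carrier[OF that(1)] gc base_point_ambient, of K] by simp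
  have one: "1\<^sub>m n \<in> GL n" by (simp add: GL_def)
  have one_base: "trp n (1\<^sub>m n) (base_point n K) = base_point n K" for K
    by (rule trp_one[OF base_point_ambient])
  have base_fixed: "trp n (R b) (base_point n {}) = base_point n {}" for b
    by (rule lower_fixes_base_point[OF carrier R_unitriangular])
  have p: "trp n g (base_point n {}) \<in> stratum_closure n I" "?fixed (trp n g (base_point n {}))"
    using closure[OF one _ I, of "{}"] fixed[OF one, of "{}"]
    by (simp_all add: base_fixed one_base left_mult_one_mat[OF carrier])
  have unique': "q = trp n g (base_point n {})" if "q \<in> stratum_closure n I" "?fixed q" for q
    using unique p that unfolding one_unipotent_fixed_point_def by blast
  show False
  proof (cases "\<exists>i. Suc i < n \<and> R 1 $$ (Suc i, i) = 0")
    case True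
    then obtain s where s: "s \<in> GL n"
      "\<And>b. trp n (s * R b) (base_point n {}) = trp n s (base_point n {})"
      "trp n s (base_point n {}) \<noteq> base_point n {}" using swapped_fixed_point by blast
    have "trp n g (trp n s (base_point n {})) = trp n g (base_point n {})"
      by (rule unique') (use closure[OF s(1) _ I, of "{}"] fixed[OF s(1,2)] in simp_all)
    moreover obtain g' where "g' \<in> GL n" "g * g' = 1\<^sub>m n" using GL_inverse[OF g] by metis
    ultimately have "trp n s (base_point n {}) = base_point n {}"
      using trp_cancel[OF g] trp_ambient[OF s(1) base_point_ambient] base_point_ambient by metis
    then show False using s(3) by contradiction
  next
    case False
    \<comment> \<open>The elements \<open>m\<close> and \<open>m + 1\<close> of \<open>K\<close>
      join the three indices \<open>m - 1\<close>, \<open>m\<close>, \<open>m + 1\<close> into one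
      block, which starts at \<open>m - 1\<close>.\<close>
    define a where "a = m - 1"
    have am: "m = a + 1" "m + 1 = a + 2" "a + 2 < n" using m by (auto simp: a_def reflected_def)
    then have "R 1 $$ (a + 1, a) \<noteq> 0" "R 1 $$ (a + 2, a + 1) \<noteq> 0" using False by auto
    then obtain q where q: "q \<in> GL n"
      "\<And>b. trp n (q * R b) (base_point n {a + 1, a + 2}) = trp n q (base_point n {a + 1, a + 2})"
      using invariant_conic[OF am(3)] by blast
    have K: "{a + 1, a + 2} \<subseteq> {1..n-1}" using am(3) by auto
    have "trp n g (trp n q (base_point n {a + 1, a + 2})) = trp n g (base_point n {})"
      by (rule unique') (use closure[OF q(1) K I] fixed[OF q] m am in simp_all)
    \<comment> \<open>The closed orbit separates the two points: it contains the flag, but not the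
      point with a conic.\<close>
    moreover have "trp n g (trp n q (base_point n {a + 1, a + 2})) \<notin> stratum_closure n {}"
      using closure[OF q(1) K, of "{}"] by (simp add: reflected_def)
    moreover have "trp n g (base_point n {}) \<in> stratum_closure n {}"
      using closure[OF one, of "{}" "{}"] one_base by simp
    ultimately show False by metis
  qed
qed

section \<open>Torus fixed points\<close>

lemma diag_mult_inverse:
  assumes "\<And>i. i < n \<Longrightarrow> d i \<noteq> 0"
  shows "diag n (\<lambda>i. 1 / d i) * diag n d = 1\<^sub>m n"
proof (rule eq_matI)
  fix i j assume "i < dim_row (1\<^sub>m n :: complex mat)" "j < dim_col (1\<^sub>m n :: complex mat)"
  then have ij: "i < n" "j < n" by simp_all
  have "(diag n (\<lambda>i. 1 / d i) * diag n d) $$ (i, j) = (\<Sum>k<n. if k = i then if i = j then 1 else 0 else 0)"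
    unfolding index_mult_square[OF diag_carrier diag_carrier ij]
    by (rule sum.cong[OF refl]) (use ij assms in \<open>auto simp: diag_def\<close>)
  then show "(diag n (\<lambda>i. 1 / d i) * diag n d) $$ (i, j) = 1\<^sub>m n $$ (i, j)" using ij by simp
qed (auto simp: diag_def)

lemma diag_torus:
  assumes "prod d {..<n} = 1"
  shows "diag n d \<in> diagonal_torus n" "inv\<^bsub>SL n\<^esub> (diag n d) = diag n (\<lambda>i. 1 / d i)"
proof -
  have nz: "d i \<noteq> 0" if "i < n" for i using assms that by (metis finite_lessThan lessThan_iff prod_zero zero_neq_one)
  have SL: "diag n d \<in> carrier (SL n)" using assms by (simp add: SL_simps det_diag)
  then show "diag n d \<in> diagonal_torus n"
    by (auto simp: diagonal_torus_def diagonal_mat_def diag_def)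
  have "prod (\<lambda>i. 1 / d i) {..<n} = 1" using assms by (simp add: prod_dividef)
  then have SL': "diag n (\<lambda>i. 1 / d i) \<in> carrier (SL n)" by (simp add: SL_simps det_diag)
  show "inv\<^bsub>SL n\<^esub> (diag n d) = diag n (\<lambda>i. 1 / d i)"
    by (rule group.inv_equality[OF group_SL _ SL SL']) (use diag_mult_inverse[OF nz] in \<open>simp add: SL_simps\<close>)
qed

lemma torus_diag:
  assumes "t \<in> diagonal_torus n"
  obtains d where "t = diag n d" "prod d {..<n} = 1"
proof -
  have t: "t \<in> carrier_mat n n" "det t = 1" "diagonal_mat t"
    using assms by (auto simp: diagonal_torus_def SL_simps)
  let ?d = "\<lambda>i. t $$ (i, i)"
  have "t = diag n ?d" by (rule eq_matI) (use t in \<open>auto simp: diag_def diagonal_mat_def\<close>)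
  moreover from this have "prod ?d {..<n} = 1" using t(2) det_diag[of n ?d] by simp
  ultimately show thesis using that by blast
qed

lemma torus_fixed_iff:
  "(\<forall>t\<in>diagonal_torus n. act n t p = p) \<longleftrightarrow> (\<forall>d. prod d {..<n} = 1 \<longrightarrow> trp n (diag n d) p = p)"
proof (intro iffI allI ballI impI)
  fix d :: "nat \<Rightarrow> complex" assume fixed: "\<forall>t\<in>diagonal_torus n. act n t p = p" and d: "prod d {..<n} = 1"
  have d': "prod (\<lambda>i. 1 / d i) {..<n} = 1" using d by (simp add: prod_dividef)
  have "act n (diag n (\<lambda>i. 1 / d i)) p = p" using fixed diag_torus(1)[OF d'] by blast
  then show "trp n (diag n d) p = p" by (simp add: act_eq_trp diag_torus(2)[OF d'])
next
  fix t assume fixed: "\<forall>d. prod d {..<n} = 1 \<longrightarrow> trp n (diag n d) p = p" and t: "t \<in> diagonal_torus n"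
  obtain d where d: "t = diag n d" "prod d {..<n} = 1" using torus_diag[OF t] by metis
  have "prod (\<lambda>i. 1 / d i) {..<n} = 1" using d(2) by (simp add: prod_dividef)
  then show "act n t p = p" using fixed by (simp add: act_eq_trp d(1) diag_torus(2)[OF d(2)])
qed

text \<open>For special \<open>K\<close> the blocks have size one or two. The rows of \<open>pair_mat n K\<close> in a block of size two
  are chosen such that the quadric \<open>q\<^sup>T q\<close> is twice the product of the two coordinates.\<close>

definition partner :: "nat set \<Rightarrow> nat \<Rightarrow> nat" where
  "partner K i = (if Suc i \<in> K then Suc i else if i \<in> K then i - 1 else i)"

definition pair_mat :: "nat \<Rightarrow> nat set \<Rightarrow> complex mat" where
  "pair_mat n K = mat n n (\<lambda>(i, j). if Suc i \<in> K then if j = i \<or> j = Suc i then 1 else 0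
     else if i \<in> K then if Suc j = i then \<i> else if j = i then - \<i> else 0
     else if i = j then 1 else 0)"

definition pair_form :: "nat \<Rightarrow> nat set \<Rightarrow> complex mat" where
  "pair_form n K = mat n n (\<lambda>(i, j). if j = partner K i then if j = i then 1 else 2 else 0)"

context
  fixes n :: nat and K :: "nat set"
  assumes K: "special K" "K \<subseteq> {1..n-1}"
begin

lemma pair_mat_carrier: "pair_mat n K \<in> carrier_mat n n"
  by (simp add: pair_mat_def)

lemma pair_form_carrier: "pair_form n K \<in> carrier_mat n n"
  by (simp add: pair_form_def)

lemma partner_cases:
  assumes "i < n"
  obtains "Suc i \<in> K" "Suc i < n" "i \<notin> K" "Suc (Suc i) \<notin> K" "partner K i = Suc i" "partner K (Suc i) = i"
  | j where "i = Suc j" "i \<in> K" "j \<notin> K" "Suc i \<notin> K" "partner K i = j" "partner K j = i"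
  | "i \<notin> K" "Suc i \<notin> K" "partner K i = i"
proof -
  have sp: "\<not> (x \<in> K \<and> Suc x \<in> K)" for x using K(1) by (auto simp: special_def)
  show thesis
  proof (cases "Suc i \<in> K")
    case True
    moreover have "Suc i < n" using True K(2) by force
    ultimately show ?thesis using that(1) sp[of i] sp[of "Suc i"] by (simp add: partner_def)
  next
    case False
    show ?thesis
    proof (cases "i \<in> K")
      case True
      then obtain j where "i = Suc j" using K(2) by (cases i) auto
      then show ?thesis using that(2) True False sp[of j] by (simp add: partner_def)
    qed (use False that(3) in \<open>simp add: partner_def\<close>)
  qed
qed

lemma partner_partner: "i < n \<Longrightarrow> partner K (partner K i) = i" "i < n \<Longrightarrow> partner K i < n"
  by (rule partner_cases[of i]; simp)+

text \<open>On a block of size two this is the identity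
  \<open>(x + y)^2 + (\<i> (x - y))^2 = 4 x y\<close>, so the form pairs each index with its
  partner.\<close>

lemma pair_form_eq: "transpose_mat (pair_mat n K) * pair_mat n K = pair_form n K"
proof (rule eq_matI)
  let ?q = "pair_mat n K"
  fix i j assume "i < dim_row (pair_form n K)" "j < dim_col (pair_form n K)"
  then have ij: "i < n" "j < n" by (simp_all add: pair_form_def)
  have q: "?q $$ (l, j) = (if Suc l \<in> K then if j = l \<or> j = Suc l then 1 else 0
     else if l \<in> K then if Suc j = l then \<i> else if j = l then - \<i> else 0
     else if l = j then 1 else 0)" if "l < n" "j < n" for l j
    using that by (simp add: pair_mat_def)
  have "(transpose_mat ?q * ?q) $$ (i, j) = (\<Sum>l<n. transpose_mat ?q $$ (i, l) * ?q $$ (l, j))"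
    by (rule index_mult_square) (use pair_mat_carrier ij in auto)
  also have "\<dots> = (\<Sum>l<n. ?q $$ (l, i) * ?q $$ (l, j))"
    by (rule sum.cong[OF refl]) (use pair_mat_carrier ij in auto)
  also have "\<dots> = (\<Sum>l\<in>{i, partner K i}. ?q $$ (l, i) * ?q $$ (l, j))"
  proof (rule sum.mono_neutral_right)
    show "{i, partner K i} \<subseteq> {..<n}" using ij partner_partner(2) by auto
    show "\<forall>l\<in>{..<n} - {i, partner K i}. ?q $$ (l, i) * ?q $$ (l, j) = 0"
    proof
      fix l assume l: "l \<in> {..<n} - {i, partner K i}"
      then have "?q $$ (l, i) = 0" using q[of l i] ij K(1)
        by (auto simp: partner_def special_def split: if_splits)
      then show "?q $$ (l, i) * ?q $$ (l, j) = 0" by simp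
    qed
  qed simp
  also have "\<dots> = pair_form n K $$ (i, j)"
    using ij(1)
  proof (cases rule: partner_cases)
    case 1
    then show ?thesis using q[OF _ ij(1)] q[OF _ ij(2)] ij by (auto simp: pair_form_def)
  next
    case (2 l)
    then show ?thesis using q[OF _ ij(1)] q[OF _ ij(2)] ij by (auto simp: pair_form_def)
  next
    case 3
    then show ?thesis using q[OF _ ij(1)] q[OF _ ij(2)] ij by (auto simp: pair_form_def)
  qed
  finally show "(transpose_mat ?q * ?q) $$ (i, j) = pair_form n K $$ (i, j)" .
qed (simp_all add: pair_mat_def pair_form_def)

text \<open>The square of the form is diagonal because the partner map is an involution, which shows
  that its determinant is nonzero.\<close>

lemma pair_mat_GL: "pair_mat n K \<in> GL n"
proof -
  let ?E = "pair_form n K" and ?q = "pair_mat n K"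
  have "?E * ?E = diag n (\<lambda>i. if partner K i = i then 1 else 4)"
  proof (rule eq_matI)
    fix i j assume "i < dim_row (diag n (\<lambda>i. if partner K i = i then 1 else 4))"
      "j < dim_col (diag n (\<lambda>i. if partner K i = i then 1 else 4))"
    then have ij: "i < n" "j < n" by (simp_all add: diag_def)
    have E: "?E $$ (i, j) = (if j = partner K i then if j = i then 1 else 2 else 0)" if "i < n" "j < n" for i j
      using that by (simp add: pair_form_def)
    have "(?E * ?E) $$ (i, j) = (\<Sum>l<n. if l = partner K i then ?E $$ (i, l) * ?E $$ (l, j) else 0)"
      unfolding index_mult_square[OF pair_form_carrier pair_form_carrier ij]
      by (rule sum.cong[OF refl]) (use ij in \<open>auto simp: E\<close>)
    also have "\<dots> = ?E $$ (i, partner K i) * ?E $$ (partner K i, j)" using partner_partner(2)[OF ij(1)] by simp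
    also have "\<dots> = (if i = j then if partner K i = i then 1 else 4 else 0)"
      using partner_partner[OF ij(1)] ij by (auto simp: E)
    finally show "(?E * ?E) $$ (i, j) = diag n (\<lambda>i. if partner K i = i then 1 else 4) $$ (i, j)"
      using ij by (simp add: diag_def)
  qed (simp_all add: pair_form_def diag_def)
  then have "det ?E * det ?E = det (diag n (\<lambda>i. if partner K i = i then 1 else 4))"
    using det_mult[OF pair_form_carrier pair_form_carrier] by simp
  also have "\<dots> \<noteq> 0" by (simp add: det_diag prod_zero_iff)
  finally have "det ?E \<noteq> 0" by auto
  moreover have "det (transpose_mat ?q) * det ?q = det ?E"
    unfolding pair_form_eq[symmetric] by (rule det_mult[symmetric, of _ n]) (use pair_mat_carrier in auto)
  ultimately show ?thesis using pair_mat_carrier by (auto simp: GL_def)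
qed

lemma pair_mat_block:
  "block_lower n K (pair_mat n K)" "block_part n K (pair_mat n K) = pair_mat n K"
proof -
  have zero: "pair_mat n K $$ (i, j) = 0" if ij: "i < n" "j < n"
    and w: "block_weight n K i \<noteq> block_weight n K j" for i j
  proof (rule ccontr)
    assume "pair_mat n K $$ (i, j) \<noteq> 0"
    then have "i = j \<or> (j = Suc i \<and> j \<in> K) \<or> (i = Suc j \<and> i \<in> K)"
      using ij by (auto simp: pair_mat_def split: if_splits)
    moreover have "{x<..Suc x} = {Suc x}" for x :: nat by auto
    ultimately show False
      using w block_weight_eq[of i j n K] block_weight_eq[of j i n K] ij by auto
  qed
  show "block_lower n K (pair_mat n K)"
    unfolding weight_lower_def using zero carrier_matD[OF pair_mat_carrier] by (metis nat_less_le)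
  show "block_part n K (pair_mat n K) = pair_mat n K"
  proof (rule eq_matI)
    fix i j assume "i < dim_row (pair_mat n K)" "j < dim_col (pair_mat n K)"
    then have ij: "i < n" "j < n" by (simp_all add: pair_mat_def)
    show "block_part n K (pair_mat n K) $$ (i, j) = pair_mat n K $$ (i, j)"
      using zero[OF ij] by (simp add: weight_part_index[OF pair_mat_carrier ij])
  qed (simp_all add: weight_part_def)
qed

lemma compound_pair_form_nonzero:
  assumes "compound n k (pair_form n K) (S, T) \<noteq> 0"
  shows "T = partner K ` S"
proof -
  obtain p where p: "S \<in> k_subsets n k" "T \<in> k_subsets n k" "bij_betw p S T"
    "\<And>i. i \<in> S \<Longrightarrow> pair_form n K $$ (i, p i) \<noteq> 0"
    using compound_nonzeroE[OF pair_form_carrier assms] by metis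
  have "p i = partner K i" if i: "i \<in> S" for i
  proof -
    have "i < n" "p i < n" using i p(3) k_subsetsD(1)[OF p(1)] k_subsetsD(1)[OF p(2)] by (auto simp: bij_betw_def)
    then show ?thesis using p(4)[OF i] by (auto simp: pair_form_def split: if_splits)
  qed
  then have "p ` S = partner K ` S" by (intro image_cong) auto
  then show ?thesis using p(3) by (simp add: bij_betw_def)
qed

text \<open>In each degree all nonzero coordinates are scaled by the same character: outside
  \<open>K\<close> only the leading set occurs, and in \<open>K\<close> the leading set is paired
  with the set obtained from it by exchanging \<open>k - 1\<close> for \<open>k\<close>.\<close>

lemma torus_fixed_point:
  assumes d: "prod d {..<n} = (1 :: complex)"
  shows "trp n (diag n d) (trp n (pair_mat n K) (base_point n K)) = trp n (pair_mat n K) (base_point n K)"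
proof -
  let ?q = "pair_mat n K" and ?L = "limit_form n K (pair_form n K)"
  have nz: "prod d S \<noteq> 0" if "S \<in> k_subsets n k" for S k
  proof -
    have "d i \<noteq> 0" if "i < n" for i using d that by (metis finite_lessThan lessThan_iff prod_zero zero_neq_one)
    then show ?thesis using k_subsetsD(1,3)[OF that] by (auto simp: prod_zero_iff)
  qed
  have lim: "trp n ?q (base_point n K) = pt n ?L"
    unfolding base_point_def trp_pt
  proof (rule pt_cong)
    fix k
    have "congr n k ?q (base n K k) = limit_form n K (transpose_mat ?q * 1\<^sub>m n * ?q) k"
      unfolding base_eq_limit_form
      using congr_limit_form[OF pair_mat_carrier pair_mat_block(1) one_carrier_mat, where k = k]
        pair_mat_block(2) by simp
    also have "transpose_mat ?q * 1\<^sub>m n = transpose_mat ?q"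
      by (rule right_mult_one_mat[of _ n]) (use pair_mat_carrier in simp)
    finally show "congr n k ?q (base n K k) = ?L k" by (simp add: pair_form_eq)
  qed
  show ?thesis
    unfolding lim trp_pt pt_eq_iff
  proof
    fix k assume k: "k \<in> {1..n-1}"
    let ?I = "{..<k}" and ?J = "insert k {..<k-1}"
    have Sk: "Suc (k - 1) = k" and kn: "k < n" using k by auto
    have IJ: "?I \<in> k_subsets n k" "?J \<in> k_subsets n k"
      using insert_k_subsets[of "k - 1" k n] Sk kn by auto
    define c where "c = prod d ?I * prod d (if k \<in> K then ?J else ?I)"
    have c: "c \<noteq> 0" using nz[OF IJ(1)] nz[OF IJ(2)] by (auto simp: c_def)
    have factor: "prod d S * prod d T = c" if L: "?L k (S, T) \<noteq> 0" for S T
    proof -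
      have ad: "adapted n K S" "adapted n K T" and cp: "compound n k (pair_form n K) (S, T) \<noteq> 0"
        using L by (auto simp: limit_form_def split: if_splits)
      have ST: "S \<in> k_subsets n k" "T \<in> k_subsets n k" using cp compound_outside by blast+
      show ?thesis
      proof (cases "k \<in> K")
        case False
        then show ?thesis using adapted_not_mem[OF k False] ST ad by (simp add: c_def)
      next
        case True
        have T: "T = partner K ` S" by (rule compound_pair_form_nonzero[OF cp])
        have pk: "partner K (k - 1) = k" "partner K k = k - 1"
          using True Sk K(1) by (auto simp: partner_def special_def)
        have neq: "k - 1 \<notin> ?J" "k \<notin> ?I" using Sk by auto
        have S: "S = ?I \<or> S = ?J" and T': "T = ?I \<or> T = ?J"
          using adapted_special[OF K(1) True k] ST ad by blast+
        have "k \<in> T" if "S = ?I" unfolding T that using pk(1) Sk by (intro image_eqI[of _ _ "k - 1"]) auto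
        moreover have "k - 1 \<in> T" if "S = ?J" unfolding T that using pk(2) by (intro image_eqI[of _ _ k]) auto
        ultimately have "(S = ?I \<and> T = ?J) \<or> (S = ?J \<and> T = ?I)" using S T' neq by metis
        then show ?thesis using True by (auto simp: c_def)
      qed
    qed
    have "supported n k (?L k)"
      by (auto simp: supported_def limit_form_def compound_outside)
    then have "congr n k (diag n d) (?L k) (S, T) = c * ?L k (S, T)" for S T
      using congr_diag[of n k "?L k" d S T] factor[of S T] by (cases "?L k (S, T) = 0") (auto simp: mult_ac)
    then have "?L k (S, T) = 1 / c * congr n k (diag n d) (?L k) (S, T)" for S T using c by simp
    then show "\<exists>c. c \<noteq> 0 \<and> ?L k = (\<lambda>x. c * congr n k (diag n d) (?L k) x)"
      using c by (intro exI[of _ "1 / c"]) auto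
  qed
qed

end

text \<open>The coordinate at \<open>(S, T)\<close> is scaled by the monomial in which the exponent
  of an index is the number of the two sets containing it. On the torus of determinant one exponents
  are visible only up to a common shift, and the fixed total degree \<open>2 * k\<close> excludes a
  shift.\<close>

lemma torus_weights:
  assumes B: "supported n k B" and k: "k \<in> {1..n-1}"
    and fixed: "\<And>d. prod d {..<n} = 1 \<Longrightarrow> \<exists>c. congr n k (diag n d) B = (\<lambda>x. c * B x)"
    and nz: "B (S, T) \<noteq> 0" "B (S', T') \<noteq> 0" and x: "x < n"
  shows "of_bool (x \<in> S) + of_bool (x \<in> T) = (of_bool (x \<in> S') + of_bool (x \<in> T') :: nat)"
proof -
  define f f' where "f x = (of_bool (x \<in> S) + of_bool (x \<in> T) :: nat)"
    and "f' x = (of_bool (x \<in> S') + of_bool (x \<in> T') :: nat)" for x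
  have ST: "S \<in> k_subsets n k" "T \<in> k_subsets n k" "S' \<in> k_subsets n k" "T' \<in> k_subsets n k"
    using nz supportedD[OF B] by blast+
  have sum_card: "(\<Sum>x<n. of_bool (x \<in> S)) = k" if "S \<in> k_subsets n k" for S
    using k_subsetsD[OF that] by (simp add: Int_absorb1)
  have sums: "sum f {..<n} = 2 * k" "sum f' {..<n} = 2 * k"
    unfolding f_def f'_def using ST by (simp_all only: sum.distrib sum_card)
  have diff: "f x + f' y = f' x + f y" if y: "y < n" for y
  proof (cases "x = y")
    case False
    \<comment> \<open>Scaling by \<open>2\<close> at \<open>x\<close> and by \<open>1 / 2\<close> at
      \<open>y\<close> keeps the determinant, and the resulting power of two compares the
      differences of exponents.\<close>
    define d :: "nat \<Rightarrow> complex" where "d i = (if i = x then 2 else 1) * (if i = y then 1 / 2 else 1)" for i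
    have d: "prod d S = 2 ^ of_bool (x \<in> S) * (1 / 2) ^ of_bool (y \<in> S)" if "finite S" for S
      using that by (simp add: d_def prod.distrib)
    have "prod d {..<n} = 1" using x y by (simp add: d)
    then obtain c where c: "congr n k (diag n d) B = (\<lambda>x. c * B x)" using fixed by blast
    have prod_c: "prod d S * prod d T = c" if "B (S, T) \<noteq> 0" for S T
      using congr_diag[OF B, of d S T] that unfolding c by (simp add: mult_ac)
    have "prod d S * prod d T = 2 ^ f x / 2 ^ f y" "prod d S' * prod d T' = 2 ^ f' x / 2 ^ f' y"
      using ST by (simp_all add: d k_subsetsD(3) f_def f'_def power_add power_one_over field_simps)
    then have "(2 :: complex) ^ f x / 2 ^ f y = 2 ^ f' x / 2 ^ f' y"
      using prod_c[OF nz(1)] prod_c[OF nz(2)] by simp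
    then have "(2 :: complex) ^ (f x + f' y) = 2 ^ (f' x + f y)" by (simp add: field_simps power_add)
    then have "of_nat (2 ^ (f x + f' y)) = (of_nat (2 ^ (f' x + f y)) :: complex)"
      by (simp only: of_nat_power of_nat_numeral)
    then have "(2 :: nat) ^ (f x + f' y) = 2 ^ (f' x + f y)" by (simp only: of_nat_eq_iff)
    then show ?thesis by simp
  qed simp
  \<comment> \<open>The two exponent vectors have the same total, so summation over \<open>y\<close>
    isolates \<open>n\<close> times the entries at \<open>x\<close>.\<close>
  have "(\<Sum>y<n. f x + f' y) = (\<Sum>y<n. f' x + f y)" by (rule sum.cong[OF refl]) (use diff in simp)
  then have "n * f x = n * f' x" using sums by (simp add: sum.distrib)
  then show ?thesis using x by (simp add: f_def f'_def)
qed

text \<open>Equal weights leave in degree \<open>m\<close> only one unordered pair of index sets,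
  hence a symmetric form of rank at most two, whereas a block of size at least three forces rank at
  least three.\<close>

theorem torus_fixed_point_imp_special:
  assumes K: "K \<subseteq> {1..n-1}" and g: "g \<in> GL n"
    and fixed: "\<And>d. prod d {..<n} = 1 \<Longrightarrow> trp n (diag n d) (trp n g (base_point n K)) = trp n g (base_point n K)"
  shows "special K"
proof (rule ccontr)
  assume "\<not> special K"
  then have ex: "\<exists>m. m \<in> K \<and> m + 1 \<in> K" by (simp add: special_def)
  \<comment> \<open>With the least choice, \<open>m - 1\<close> is a boundary or zero, so a block
    begins there.\<close>
  define m where "m = (LEAST m. m \<in> K \<and> m + 1 \<in> K)"
  have m: "m \<in> K" "m + 1 \<in> K" using LeastI_ex[OF ex] by (auto simp: m_def)
  define a where "a = m - 1"
  have am: "m = Suc a" using m(1) K by (force simp: a_def)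
  have an: "a + 2 < n" using m(2) K am by force
  have aK: "a \<notin> K"
  proof
    assume "a \<in> K"
    then have "m \<le> a" unfolding m_def using m(1) am by (intro Least_le) simp
    then show False using am by simp
  qed
  have gc: "g \<in> carrier_mat n n" using g by (rule GL_carrier)
  define B where "B k = congr n k g (base n K k)" for k
  have frB: "frame n B" unfolding B_def[abs_def] by (rule frame_congr[OF g frame_base])
  have suppB: "supported n k (B k)" for k by (simp add: B_def)
  have weights: "of_bool (x \<in> S) + of_bool (x \<in> T) = (of_bool (x \<in> S') + of_bool (x \<in> T') :: nat)"
    if k: "k \<in> {1..n-1}" and nz: "B k (S, T) \<noteq> 0" "B k (S', T') \<noteq> 0" "x < n" for k S T S' T' x
  proof (rule torus_weights[OF suppB k _ nz])
    fix d :: "nat \<Rightarrow> complex" assume "prod d {..<n} = 1"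
    then have "trp n (diag n d) (trp n g (base_point n K)) = trp n g (base_point n K)" by (rule fixed)
    then have "pt n B = pt n (\<lambda>k. congr n k (diag n d) (B k))"
      unfolding base_point_def trp_pt B_def by simp
    then show "\<exists>c. congr n k (diag n d) (B k) = (\<lambda>x. c * B k x)" using k unfolding pt_eq_iff by blast
  qed
  \<comment> \<open>The component at the boundary \<open>a\<close> is the square of a row of maximal
    minors, and equality of weights leaves only one of these minors nonzero. For
    \<open>a = 0\<close> the set is empty.\<close>
  obtain A where A: "A \<in> k_subsets n a" "compound n a g ({..<a}, A) \<noteq> 0"
    "\<And>S. S \<in> k_subsets n a \<Longrightarrow> S \<noteq> A \<Longrightarrow> compound n a g ({..<a}, S) = 0"
  proof (cases "a = 0")
    case True
    have "k_subsets n 0 = {{}}" by (auto simp: k_subsets_def finite_subset[of _ "{..<n}"])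
    moreover have "compound n 0 g ({..<0}, {}) = 1" using compound_leading[OF gc, of 0] by simp
    ultimately show ?thesis using that[of "{}"] True by simp
  next
    case False
    then have a1: "a \<in> {1..n-1}" using an by auto
    have Ba: "B a (S, T) = compound n a g ({..<a}, S) * compound n a g ({..<a}, T)" for S T
      unfolding B_def by (rule congr_base_not_mem[OF a1 aK])
    have "B a \<noteq> (\<lambda>_. 0)" using frB a1 by (simp add: frame_def)
    then obtain A T where "B a (A, T) \<noteq> 0" by fastforce
    then have wA: "compound n a g ({..<a}, A) \<noteq> 0" by (auto simp: Ba)
    have "A \<in> k_subsets n a" using wA compound_outside by blast
    moreover have "S = A" if S: "S \<in> k_subsets n a" "compound n a g ({..<a}, S) \<noteq> 0" for S
    proof -
      have "x \<in> S \<longleftrightarrow> x \<in> A" if "x < n" for x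
        using weights[OF a1 _ _ that, of S S A A] S(2) wA by (auto simp: Ba of_bool_def split: if_splits)
      then show ?thesis using k_subsetsD(1)[OF S(1)] k_subsetsD(1)[OF \<open>A \<in> k_subsets n a\<close>] by blast
    qed
    ultimately show ?thesis using that wA by blast
  qed
  have cA: "card A = a" "finite A" "A \<subseteq> {..<n}" using k_subsetsD[OF A(1)] by auto
  have g0: "g $$ (i, j) = 0" if "i < a" "j < n" "j \<notin> A" for i j
    by (rule rows_supported_on_columns[OF gc A(1,2,3)]) (use that in auto)
  have m1: "m \<in> {1..n-1}" using m(1) K by blast
  \<comment> \<open>The first \<open>a\<close> rows of \<open>g\<close> are supported on the columns
    \<open>A\<close>, and an adapted \<open>Z\<close> of size \<open>m\<close> contains all these
    rows; a nonzero minor must then use all of \<open>A\<close>.\<close>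
  have contains: "A \<subseteq> S" if Z: "adapted n K Z" and nz: "compound n m g (Z, S) \<noteq> 0" for Z S
  proof -
    obtain p where p: "Z \<in> k_subsets n m" "S \<in> k_subsets n m" "bij_betw p Z S"
      "\<And>i. i \<in> Z \<Longrightarrow> g $$ (i, p i) \<noteq> 0" using compound_nonzeroE[OF gc nz] by metis
    have aZ: "{..<a} \<subseteq> Z"
    proof (cases "a = 0")
      case False
      then have "a \<in> {1..n-1} - K" using an aK by auto
      then have "Z \<subseteq> {..<a} \<or> {..<a} \<subseteq> Z" using Z by (auto simp: adapted_def)
      moreover have "\<not> Z \<subseteq> {..<a}" using card_mono[of "{..<a}" Z] k_subsetsD(2)[OF p(1)] am by auto
      ultimately show ?thesis by blast
    qed simp
    have "p ` {..<a} \<subseteq> A"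
    proof
      fix j assume "j \<in> p ` {..<a}"
      then obtain i where i: "i < a" "j = p i" by auto
      then have "i \<in> Z" using aZ by auto
      then have "g $$ (i, j) \<noteq> 0" "j < n"
        using p(3,4) i k_subsetsD(1)[OF p(2)] by (auto simp: bij_betw_def)
      then show "j \<in> A" using g0[OF i(1)] by blast
    qed
    moreover have "card (p ` {..<a}) = a"
      using p(3) aZ by (subst card_image) (auto simp: bij_betw_def intro: inj_on_subset)
    ultimately have "p ` {..<a} = A" using cA by (intro card_subset_eq) auto
    then show ?thesis using aZ p(3) by (auto simp: bij_betw_def)
  qed
  have BmA: "S \<in> k_subsets n m \<and> A \<subseteq> S \<and> T \<in> k_subsets n m \<and> A \<subseteq> T" if nz: "B m (S, T) \<noteq> 0" for S T
  proof -
    have mn: "m \<le> n" using m1 by auto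
    have "\<exists>Z. adapted n K Z \<and> compound n m g (Z, S) * compound n m g (Z, T) \<noteq> 0"
    proof (rule ccontr)
      assume "\<not> ?thesis"
      then have "B m (S, T) = 0" unfolding B_def congr_base[OF mn] by (intro sum.neutral) auto
      then show False using nz by simp
    qed
    then have "A \<subseteq> S" "A \<subseteq> T" using contains by auto
    then show ?thesis using nz supportedD[OF suppB] by blast
  qed
  have extra: "\<exists>i. i \<notin> A \<and> i < n \<and> S = insert i A" if "S \<in> k_subsets n m" "A \<subseteq> S" for S
  proof -
    have "card (S - A) = 1" using k_subsetsD[OF that(1)] that(2) cA am by (simp add: card_Diff_subset)
    then obtain i where i: "S - A = {i}" by (auto simp: card_1_singleton_iff)
    then have "i \<notin> A" "i \<in> S" "S = insert i A" using that(2) by blast+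
    then show ?thesis using k_subsetsD(1)[OF that(1)] by blast
  qed
  have "B m \<noteq> (\<lambda>_. 0)" using frB m1 by (simp add: frame_def)
  then obtain X Y where XY: "B m (X, Y) \<noteq> 0" by fastforce
  \<comment> \<open>Every index set in question is \<open>A\<close> with one element added, so the
    weights determine the unordered pair of added elements.\<close>
  have only: "(S = X \<and> T = Y) \<or> (S = Y \<and> T = X)" if nz: "B m (S, T) \<noteq> 0" for S T
  proof -
    obtain i j i' j' where ij: "i \<notin> A" "i < n" "S = insert i A" "j \<notin> A" "j < n" "T = insert j A"
      and ij': "i' \<notin> A" "i' < n" "X = insert i' A" "j' \<notin> A" "j' < n" "Y = insert j' A"
      using extra BmA[OF nz] BmA[OF XY] by metis
    have w: "of_bool (x = i) + of_bool (x = j) = (of_bool (x = i') + of_bool (x = j') :: nat)"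
      if "x < n" "x \<notin> A" for x
      using weights[OF m1 nz XY that(1)] that(2) by (simp add: ij ij')
    have "(i = i' \<and> j = j') \<or> (i = j' \<and> j = i')"
    proof (cases "i = i'")
      case True
      have "j = j'" using w[OF ij(5,4)] True by (cases "j = j'") simp_all
      then show ?thesis using True by blast
    next
      case False
      have 1: "i = j'" using w[OF ij(2,1)] False by (cases "i = j'") simp_all
      have "j = i'" using w[OF ij(5,4)] 1 by (cases "j = i'") simp_all
      then show ?thesis using 1 by blast
    qed
    then show ?thesis by (auto simp: ij ij')
  qed
  have symB: "B m (Y, X) = B m (X, Y)" using frB m1 by (auto simp: frame_def sym_mats_def)
  \<comment> \<open>Halved when the two sets coincide, so that one symmetric formula with two terms
    covers both cases.\<close>
  define \<beta> where "\<beta> = (if X = Y then B m (X, Y) / 2 else B m (X, Y))"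
  have Bm: "B m (S, T) = \<beta> * (of_bool (S = X) * of_bool (T = Y) + of_bool (S = Y) * of_bool (T = X))" for S T
  proof -
    consider "S = X" "T = Y" | "S = Y" "T = X" "X \<noteq> Y" | "\<not> (S = X \<and> T = Y)" "\<not> (S = Y \<and> T = X)" by blast
    then show ?thesis
    proof cases
      case 1
      then show ?thesis by (cases "X = Y") (simp_all add: \<beta>_def)
    next
      case 2
      then show ?thesis using symB by (simp add: \<beta>_def)
    next
      case 3
      then have "B m (S, T) = 0" using only by blast
      moreover have "of_bool (S = X) * of_bool (T = Y) = (0 :: complex)"
        "of_bool (S = Y) * of_bool (T = X) = (0 :: complex)" using 3 by simp_all
      ultimately show ?thesis by (simp only: add_0 mult_zero_right)
    qed
  qed
  obtain h where h: "h \<in> GL n" "g * h = 1\<^sub>m n" using GL_inverse[OF g] by metis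
  let ?x = "\<lambda>Z. compound n m h (X, Z)" and ?y = "\<lambda>Z. compound n m h (Y, Z)"
  have XYk: "X \<in> k_subsets n m" "Y \<in> k_subsets n m" using BmA[OF XY] by auto
  have base: "base n K m (Z, Z') = \<beta> * (?x Z * ?y Z' + ?y Z * ?x Z')" for Z Z'
  proof -
    have "base n K m = congr n m h (B m)"
      unfolding B_def using congr_inverse[OF gc GL_carrier[OF h(1)] h(2) frame_supported[OF frame_base m1]] by simp
    then have "base n K m (Z, Z') = (\<Sum>S\<in>k_subsets n m. \<Sum>T\<in>k_subsets n m. compound n m h (S, Z)
        * (\<beta> * (of_bool (S = X) * of_bool (T = Y) + of_bool (S = Y) * of_bool (T = X))) * compound n m h (T, Z'))"
      by (simp only: congr_def prod.case Bm)
    also have "\<dots> = (\<Sum>S\<in>k_subsets n m. \<Sum>T\<in>k_subsets n m.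
        \<beta> * ((if S = X then compound n m h (S, Z) else 0) * (if T = Y then compound n m h (T, Z') else 0))
        + \<beta> * ((if S = Y then compound n m h (S, Z) else 0) * (if T = X then compound n m h (T, Z') else 0)))"
      by (rule sum.cong[OF refl], rule sum.cong[OF refl]) (simp add: of_bool_def algebra_simps)
    also have "\<dots> = \<beta> * (\<Sum>S\<in>k_subsets n m. \<Sum>T\<in>k_subsets n m.
        (if S = X then compound n m h (S, Z) else 0) * (if T = Y then compound n m h (T, Z') else 0))
        + \<beta> * (\<Sum>S\<in>k_subsets n m. \<Sum>T\<in>k_subsets n m.
        (if S = Y then compound n m h (S, Z) else 0) * (if T = X then compound n m h (T, Z') else 0))"
      by (simp only: sum.distrib sum_distrib_left)
    also have "\<dots> = \<beta> * (?x Z * ?y Z') + \<beta> * (?y Z * ?x Z')"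
      unfolding sum_product[symmetric] using XYk by simp
    finally show ?thesis by (simp add: distrib_left)
  qed
  \<comment> \<open>Three adapted sets, one for each of the first three indices of the block; on
    them the standard form is the identity.\<close>
  define Z where "Z l = insert (a + l) {..<a}" for l
  have Zk: "Z l \<in> k_subsets n m" if "l \<le> 2" for l
    unfolding Z_def am using an that by (intro insert_k_subsets) auto
  have adZ: "adapted n K (Z l)" if "l \<le> 2" for l
    unfolding adapted_def
  proof
    fix m' assume m': "m' \<in> {1..n-1} - K"
    then have "m' \<noteq> Suc a" "m' \<noteq> Suc (Suc a)" using m am by auto
    then have "m' \<le> a \<or> a + 2 < m'" by linarith
    then show "Z l \<subseteq> {..<m'} \<or> {..<m'} \<subseteq> Z l" using that by (auto simp: Z_def)
  qed
  have Z_neq: "Z l \<noteq> Z l'" if "l \<noteq> l'" for l l'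
  proof
    assume "Z l = Z l'"
    then have "a + l \<in> Z l'" by (metis Z_def insertI1)
    then show False using that by (simp add: Z_def)
  qed
  have diag: "\<beta> * (?x (Z l) * ?y (Z l) + ?y (Z l) * ?x (Z l)) = 1" if "l \<le> 2" for l
    using base[of "Z l" "Z l"] Zk[OF that] adZ[OF that] by (simp add: base_def)
  have off: "?x (Z l) * ?y (Z l') + ?y (Z l) * ?x (Z l') = 0" if "l \<noteq> l'" "l \<le> 2" "l' \<le> 2" for l l'
  proof -
    have "\<beta> \<noteq> 0" using diag[of 0] by auto
    then show ?thesis using base[of "Z l" "Z l'"] Z_neq[OF that(1)] by (simp add: base_def)
  qed
  define x y where "x l = ?x (Z l)" and "y l = ?y (Z l)" for l
  have nz: "x l \<noteq> 0" "y l \<noteq> 0" if "l \<le> 2" for l using diag[OF that] by (auto simp: x_def y_def)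
  have e: "x 0 * y 1 = - (y 0 * x 1)" "x 0 * y 2 = - (y 0 * x 2)" "x 1 * y 2 = - (y 1 * x 2)"
    using off[of 0 1] off[of 0 2] off[of 1 2] by (simp_all add: x_def y_def eq_neg_iff_add_eq_0)
  \<comment> \<open>A form built from two linear functionals admits no three mutually orthogonal
    vectors of nonzero length: the three relations give \<open>x 0 * y 2\<close> and its negative
    the same value.\<close>
  have "(x 1 * y 1) * (x 0 * y 2) = (x 0 * y 1) * (x 1 * y 2)" by (simp only: mult_ac)
  also have "\<dots> = (x 1 * y 1) * (y 0 * x 2)" unfolding e by (simp add: mult_ac)
  finally have "x 0 * y 2 = y 0 * x 2" using nz[of 1] by simp
  then have "y 0 * x 2 = 0" using e(2) by simp
  then show False using nz[of 0] nz[of 2] by simp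
qed

text \<open>Regularity and the existence of a torus fixed point are each compared with specialness
  of \<open>I\<close>. The kernel of the irreducible representation is finite for every
  \<open>n\<close> and trivial for even \<open>n\<close>, which serves both readings of
  regularity.\<close>

theorem theorem3p3:
  fixes n :: nat and I :: "nat set"
  assumes "n \<ge> 2" and "I \<subseteq> {1..n-1}"
  shows "(special I \<longleftrightarrow> SL2_regular n (stratum_closure n I))
    \<and> (SL2_regular n (stratum_closure n I) \<longleftrightarrow>
         (\<exists>p \<in> stratum n I. \<forall>t \<in> diagonal_torus n. act n t p = p))
    \<and> (even n \<longrightarrow> (special I \<longleftrightarrow> SL2_regular_inj n (stratum_closure n I)))"
proof -
  have regular: "special I \<longleftrightarrow> SL2_regular n (stratum_closure n I)"
    using special_unique_fixed_point[OF assms] irrep_algebraic_hom irrep_finite_kernel[OF assms(1)]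
      fixed_point_unique_imp_special[OF assms] unfolding SL2_regular_def by blast
  have regular_inj: "special I \<longleftrightarrow> SL2_regular_inj n (stratum_closure n I)" if "even n"
    using special_unique_fixed_point[OF assms] irrep_algebraic_hom irrep_inj[OF assms(1) that]
      fixed_point_unique_imp_special[OF assms] unfolding SL2_regular_inj_def by blast
  have torus: "special I \<longleftrightarrow> (\<exists>p\<in>stratum n I. \<forall>t\<in>diagonal_torus n. act n t p = p)"
  proof
    assume "special I"
    then have K: "special (reflected n I)" by (simp add: special_reflected[OF assms(2)])
    let ?p = "trp n (pair_mat n (reflected n I)) (base_point n (reflected n I))"
    have "?p \<in> stratum n I"
      using stratum_iff[OF assms pair_mat_GL[OF K reflected_subset] reflected_subset] by simp
    moreover have "\<forall>t\<in>diagonal_torus n. act n t ?p = ?p"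
      unfolding torus_fixed_iff using torus_fixed_point[OF K reflected_subset] by blast
    ultimately show "\<exists>p\<in>stratum n I. \<forall>t\<in>diagonal_torus n. act n t p = p" by blast
  next
    assume "\<exists>p\<in>stratum n I. \<forall>t\<in>diagonal_torus n. act n t p = p"
    then obtain p where p: "p \<in> stratum n I" "\<forall>d. prod d {..<n} = 1 \<longrightarrow> trp n (diag n d) p = p"
      unfolding torus_fixed_iff by blast
    obtain g where "g \<in> GL n" "p = trp n g (base_point n (reflected n I))"
      using stratum_normal_form[OF assms p(1)] by metis
    then have "special (reflected n I)"
      using torus_fixed_point_imp_special[OF reflected_subset] p(2) by blast
    then show "special I" by (simp add: special_reflected[OF assms(2)])
  qed
  show ?thesis using regular regular_inj torus by blast
qed

end
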